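(* Let $n\ge 3$, let $\Omega$ be an open subset of $\mathbb{R}^n$, and let $\Gamma\subset\mathbb{R}^n$ be an open convex symmetric cone with vertex at the origin such that $\Gamma\supset\{\lambda\in\mathbb{R}^n:\lambda_i>0,\ i=1,\dots,n\}$. Assume that $u$ is a (positive) continuous viscosity solution of $$\lambda(A^u)\in\partial\Gamma,\qquad u>0,\qquad\text{in }\Omega .$$ Then $u\in C^{0,1}_{loc}(\Omega)$, i.e. $u$ is locally Lipschitz continuous in $\Omega$.
   Context: Symmetric means: if $\lambda\in\Gamma$ then every permutation of $\lambda$ belongs to $\Gamma$. For a positive function $u$ which is twice differentiable at a point, its conformal Hessian is $$A^u=-\frac{2}{n-2}u^{-\frac{n+2}{n-2}}\nabla^2u+\frac{2n}{(n-2)^2}u^{-\frac{2n}{n-2}}\nabla u\otimes\nabla u-\frac{2}{(n-2)^2}u^{-\frac{2n}{n-2}}|\nabla u|^2 I,$$ where $I$ is the $n\times n$ identity matrix and $(p\otimes q)_{ij}=p_iq_j$. $\lambda(A^u)$ denotes the eigenvalues of the symmetric matrix $A^u$. Viscosity solution: a positive continuous function $u$ on $\Omega$ is a viscosity solution of $\lambda(A^u)\in\partial\Gamma$ in $\Omega$ if for every $x_0\in\Omega$ and every $\varphi\in C^2(\Omega)$ with $(u-\varphi)(x_0)=0$: (i) if $u-\varphi\ge 0$ near $x_0$, then $\lambda(A^\varphi(x_0))\in\overline{\Gamma}$; and (ii) if $u-\varphi\le 0$ near $x_0$, then $\lambda(A^\varphi(x_0))\in\mathbb{R}^n\setminus\Gamma$.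 (Equivalently, with $u=e^{-\frac{n-2}{2}\psi}$ one has $A^u=e^{2\psi}(\nabla^2\psi+\nabla\psi\otimes\nabla\psi-\frac12|\nabla\psi|^2I)$, and $\psi$ is a viscosity solution of the corresponding equation for $\psi$; the map $u\mapsto\psi$ reverses the direction of touching.) *)

theory Defs
  imports "HOL-Analysis.Analysis"
begin

definition grad :: "(real^'n \<Rightarrow> real) \<Rightarrow> real^'n \<Rightarrow> real^'n" where
  "grad f x = (\<chi> i. frechet_derivative f (at x) (axis i 1))"

definition hess :: "(real^'n \<Rightarrow> real) \<Rightarrow> real^'n \<Rightarrow> real^'n^'n" where
  "hess f x = jacobian (grad f) (at x)"

(* Intended for open S only: the derivatives are taken at x and not within S. *)
definition C2_on :: "(real^'n) set \<Rightarrow> (real^'n \<Rightarrow> real) \<Rightarrow> bool" where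
  "C2_on S f \<longleftrightarrow>
     (\<forall>x\<in>S. f differentiable (at x)) \<and>
     (\<forall>x\<in>S. grad f differentiable (at x)) \<and>
     continuous_on S (hess f)"

definition tensor :: "real^'n \<Rightarrow> real^'n \<Rightarrow> real^'n^'n" (infixr "\<otimes>\<^sub>v" 75) where
  "p \<otimes>\<^sub>v q = (\<chi> i j. p $ i * q $ j)"

definition conformal_hessian :: "(real^'n \<Rightarrow> real) \<Rightarrow> real^'n \<Rightarrow> real^'n^'n" where
  "conformal_hessian u x = (let n = real CARD('n) in
       (- 2 / (n - 2) * u x powr (- (n + 2) / (n - 2))) *\<^sub>R hess u x
     + (2 * n / (n - 2)\<^sup>2 * u x powr (- (2 * n) / (n - 2))) *\<^sub>R (grad u x \<otimes>\<^sub>v grad u x)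
     - (2 / (n - 2)\<^sup>2 * u x powr (- (2 * n) / (n - 2)) * (norm (grad u x))\<^sup>2) *\<^sub>R mat 1)"

(* l lists the eigenvalues of A with multiplicity: the characteristic polynomial of A
   splits with the entries of l as its roots. *)
definition eigenvalue_vector :: "real^'n^'n \<Rightarrow> real^'n \<Rightarrow> bool" where
  "eigenvalue_vector A l \<longleftrightarrow> (\<forall>t. det (mat t - A) = (\<Prod>i\<in>UNIV. t - l $ i))"

(* For symmetric A such a vector exists and is unique up to a permutation of its entries,
   so membership of the chosen one in a symmetric set does not depend on the choice. *)
definition eigenvalues :: "real^'n^'n \<Rightarrow> real^'n" where
  "eigenvalues A = (SOME l. eigenvalue_vector A l)"

definition symmetric_set :: "(real^'n) set \<Rightarrow> bool" where
  "symmetric_set \<Gamma> \<longleftrightarrow> (\<forall>l\<in>\<Gamma>. \<forall>\<sigma>. \<sigma> permutes UNIV \<longrightarrow> (\<chi> i. l $ \<sigma> i) \<in> \<Gamma>)"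

(* Unlike the library's cone, this only asks for strictly positive factors; an open cone
   containing its vertex would be the whole space. *)
definition cone_at_origin :: "'a::real_vector set \<Rightarrow> bool" where
  "cone_at_origin \<Gamma> \<longleftrightarrow> (\<forall>x\<in>\<Gamma>. \<forall>c>0. c *\<^sub>R x \<in> \<Gamma>)"

(* u is a viscosity solution of "the eigenvalues of A^u lie on the boundary of \<Gamma>" in \<Omega>. *)
definition viscosity_solution ::
    "(real^'n) set \<Rightarrow> (real^'n) set \<Rightarrow> (real^'n \<Rightarrow> real) \<Rightarrow> bool" where
  "viscosity_solution \<Gamma> \<Omega> u \<longleftrightarrow>
     continuous_on \<Omega> u \<and> (\<forall>x\<in>\<Omega>. u x > 0) \<and>
     (\<forall>x0\<in>\<Omega>. \<forall>\<phi>. C2_on \<Omega> \<phi> \<and> u x0 - \<phi> x0 = 0 \<longrightarrow>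
        ((\<forall>\<^sub>F x in nhds x0. u x - \<phi> x \<ge> 0) \<longrightarrow>
           eigenvalues (conformal_hessian \<phi> x0) \<in> closure \<Gamma>) \<and>
        ((\<forall>\<^sub>F x in nhds x0. u x - \<phi> x \<le> 0) \<longrightarrow>
           eigenvalues (conformal_hessian \<phi> x0) \<in> UNIV - \<Gamma>))"

definition C01_loc :: "'a::metric_space set \<Rightarrow> ('a \<Rightarrow> real) \<Rightarrow> bool" where
  "C01_loc \<Omega> u \<longleftrightarrow> (\<forall>K. compact K \<and> K \<subseteq> \<Omega> \<longrightarrow> (\<exists>L. L-lipschitz_on K u))"

end

theory Submission
  imports Defs "HOL-Combinatorics.Permutations" "HOL-Computational_Algebra.Polynomial"
begin

text \<open>
Write \<open>u = w powr (- (n - 2) / 2)\<close>. Then the conformal Hessian of \<open>u\<close> is \<open>w D\<^sup>2w - |Dw|\<^sup>2 / 2 I\<close>, and since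
\<open>|p|\<^sup>2 / (2 w) = sup\<^sub>b (b \<bullet> p - |b|\<^sup>2 w / 2)\<close> and \<open>\<Gamma>\<close> is convex and symmetric, the condition that
its eigenvalues lie in the closure of \<open>\<Gamma>\<close> is equivalent to a family of linear inequalities for \<open>w\<close>
with constant coefficients. Hence it survives mollification, and adding a small multiple of \<open>1 + |x|\<^sup>2\<close>
gives smooth strict subsolutions uniformly close to \<open>w\<close>. No comparison principle between two
viscosity solutions is needed: these subsolutions are compared with the Kelvin transforms of \<open>w\<close>, for which
the other half of the definition of a viscosity solution is enough. The resulting inequality
\<open>w(y) \<le> |y - x|\<^sup>2 / \<rho>\<^sup>2 w(x + \<rho>\<^sup>2 (y - x) / |y - x|\<^sup>2)\<close> for all small \<open>\<rho>\<close> says that \<open>w / |y - x|\<close> is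
nonincreasing along short rays from every \<open>x\<close>, which makes \<open>w\<close> locally Lipschitz.
\<close>

section \<open>Eigenvalues of symmetric matrices\<close>

text \<open>The obstacle is averaging: the definition speaks only where a smooth function touches,
  and even a linear inequality with constant coefficients does not pass to mollifications by itself.
  Neither sup-convolutions nor twice differentiability almost everywhere are used. The operator is
  approximated by the difference operator of a finite random walk; its resolvent commutes exactly
  with mollification, and a mollified resolvent is smooth enough to be compared with
  \<open>w\<close> by touching. Second-order information is always a quadratic jet with cubic error,
  so a kernel with Lipschitz second derivatives suffices. The power in the substitution makes the
  gradient term |Dw|^2 / (2 w) jointly convex in w and Dw, and w D^2w - |Dw|^2 / 2 I homogeneous, so
  that multiples of a strict subsolution remain strict. As the power is decreasing, functions above
  \<open>w\<close> give test functions below \<open>u\<close>.\<close>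

definition orthonormal :: "real^'n^'n \<Rightarrow> bool" where
  "orthonormal E \<longleftrightarrow> (\<forall>i j. E $ i \<bullet> E $ j = (if i = j then 1 else 0))"

lemma orthonormal_iff_orthogonal_matrix: "orthonormal E \<longleftrightarrow> orthogonal_matrix E"
proof -
  have "E ** transpose E = (\<chi> i j. E $ i \<bullet> E $ j)"
    by (simp add: matrix_matrix_mult_def transpose_def inner_vec_def)
  then have "E ** transpose E = mat 1 \<longleftrightarrow> orthonormal E"
    by (auto simp: orthonormal_def mat_def vec_eq_iff)
  then show ?thesis
    by (metis orthogonal_matrix_def matrix_left_right_inverse)
qed

lemma compact_orthonormal: "compact (Collect (orthonormal :: real^'n^'n \<Rightarrow> bool))"
proof -
  have eq: "Collect orthonormal = (\<Inter>i. \<Inter>j. {E :: real^'n^'n. E $ i \<bullet> E $ j = (if i = j then 1 else 0)})"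
    by (auto simp: orthonormal_def)
  have "closed (Collect (orthonormal :: real^'n^'n \<Rightarrow> bool))"
    unfolding eq by (intro closed_INT ballI closed_Collect_eq continuous_intros)
  moreover have "bounded (Collect (orthonormal :: real^'n^'n \<Rightarrow> bool))"
  proof (rule boundedI)
    fix E :: "real^'n^'n" assume "E \<in> Collect orthonormal"
    then have "norm (E $ i) = 1" for i by (simp add: orthonormal_def norm_eq_1)
    then show "norm E \<le> real CARD('n)"
      using norm_le_l1_cart[of "\<chi> i. norm (E $ i)"] by (simp add: norm_vec_def)
  qed
  ultimately show ?thesis by (simp add: compact_eq_bounded_closed)
qed

lemma inner_symmetric_matrix:
  fixes A :: "real^'n^'n"
  assumes "transpose A = A"
  shows "x \<bullet> (A *v y) = y \<bullet> (A *v x)"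
  by (metis assms dot_lmul_matrix inner_commute transpose_matrix_vector)

text \<open>With \<open>a\<close> in the dual cone and \<open>E\<close> running over all frames,
  these functions, linear in \<open>A\<close>, detect whether the eigenvalues of a symmetric matrix
  lie in the closed cone.\<close>

abbreviation weighted_diagonal :: "('n \<Rightarrow> real) \<Rightarrow> real^'n^'n \<Rightarrow> real^'n^'n \<Rightarrow> real" where
  "weighted_diagonal a E A \<equiv> (\<Sum>i\<in>UNIV. a i * (E $ i \<bullet> (A *v E $ i)))"

definition rotate_rows :: "real^'n^'n \<Rightarrow> 'n \<Rightarrow> 'n \<Rightarrow> real \<Rightarrow> real \<Rightarrow> real^'n^'n" where
  "rotate_rows E i j c s = (\<chi> k. if k = i then c *\<^sub>R E $ i + s *\<^sub>R E $ j
      else if k = j then c *\<^sub>R E $ j - s *\<^sub>R E $ i else E $ k)"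

lemma orthonormal_rotate_rows:
  assumes "orthonormal E" "i \<noteq> j" "c\<^sup>2 + s\<^sup>2 = 1"
  shows "orthonormal (rotate_rows E i j c s)"
proof -
  have E: "E $ k \<bullet> E $ l = (if k = l then 1 else 0)" for k l
    using assms by (auto simp: orthonormal_def)
  show ?thesis
    unfolding orthonormal_def rotate_rows_def
    using assms(2,3)
    by (auto simp: inner_add_left inner_add_right inner_diff_left inner_diff_right E power2_eq_square)
qed

text \<open>The trace over the rotated plane is invariant, so only the difference of the two weights
  enters. The off-diagonal entry comes with a factor of first order in \<open>s\<close>, the
  diagonal entries with \<open>s\<^sup>2\<close>.\<close>

lemma weighted_diagonal_rotate_rows:
  fixes A E :: "real^'n^'n" and a :: "'n \<Rightarrow> real"
  assumes "transpose A = A" "i \<noteq> j" "c\<^sup>2 + s\<^sup>2 = 1"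
  defines "E' \<equiv> rotate_rows E i j c s"
  shows "weighted_diagonal a E' A = weighted_diagonal a E A
     + (a i - a j) * (s\<^sup>2 * (E $ j \<bullet> (A *v E $ j) - E $ i \<bullet> (A *v E $ i)) + 2 * c * s * (E $ i \<bullet> (A *v E $ j)))"
proof -
  let ?q = "\<lambda>k l. E $ k \<bullet> (A *v E $ l)"
  have sym: "?q j i = ?q i j" by (rule inner_symmetric_matrix[OF assms(1)])
  have U: "UNIV = insert i (insert j (UNIV - {i,j}))" by auto
  have split: "(\<Sum>k\<in>UNIV. f k) = f i + f j + (\<Sum>k\<in>UNIV - {i,j}. f k)" for f :: "'n \<Rightarrow> real"
    by (subst U) (use assms(2) in \<open>simp add: add.assoc\<close>)
  have i: "E' $ i \<bullet> (A *v E' $ i) = c\<^sup>2 * ?q i i + 2 * c * s * ?q i j + s\<^sup>2 * ?q j j"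
    by (simp add: E'_def rotate_rows_def matrix_vector_right_distrib matrix_vector_mult_scaleR
        inner_add_left inner_add_right sym power2_eq_square algebra_simps)
  have j: "E' $ j \<bullet> (A *v E' $ j) = c\<^sup>2 * ?q j j - 2 * c * s * ?q i j + s\<^sup>2 * ?q i i"
    using assms(2) by (simp add: E'_def rotate_rows_def matrix_vector_mult_diff_distrib matrix_vector_mult_scaleR
        inner_diff_left inner_diff_right sym power2_eq_square algebra_simps)
  have rest: "(\<Sum>k\<in>UNIV - {i,j}. a k * (E' $ k \<bullet> (A *v E' $ k))) = (\<Sum>k\<in>UNIV - {i,j}. a k * ?q k k)"
    by (rule sum.cong) (auto simp: E'_def rotate_rows_def)
  have c: "c\<^sup>2 = 1 - s\<^sup>2" using assms(3) by simp
  show ?thesis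
    unfolding split[of "\<lambda>k. a k * (E' $ k \<bullet> (A *v E' $ k))"] split[of "\<lambda>k. a k * ?q k k"] i j rest c
    by (simp add: algebra_simps)
qed

text \<open>A minimiser over the orthonormal frames of a weighted diagonal with distinct weights is an
  eigenframe, since otherwise a small rotation in a coordinate plane would decrease the value.
  This gives the spectral theorem together with a bound for the diagonal in every frame.\<close>

lemma weighted_diagonal_minimiser:
  fixes A :: "real^'n^'n" and a :: "'n \<Rightarrow> real"
  assumes sym: "transpose A = A" and "inj a"
  obtains E where "orthonormal E" "\<And>i j. i \<noteq> j \<Longrightarrow> E $ i \<bullet> (A *v E $ j) = 0"
    "\<And>E'. orthonormal E' \<Longrightarrow>
       weighted_diagonal a E A \<le> weighted_diagonal a E' A"
proof -
  let ?F = "\<lambda>E :: real^'n^'n. \<Sum>k\<in>UNIV. a k * (E $ k \<bullet> (A *v E $ k))"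
  have ne: "Collect (orthonormal :: real^'n^'n \<Rightarrow> bool) \<noteq> {}"
    using orthonormal_iff_orthogonal_matrix orthogonal_matrix_id by blast
  have "continuous_on (Collect (orthonormal :: real^'n^'n \<Rightarrow> bool)) ?F"
    by (intro continuous_intros matrix_vector_mult_linear_continuous_on [THEN continuous_on_compose2]) auto
  from continuous_attains_inf[OF compact_orthonormal ne this]
  obtain E where E: "orthonormal E" and min: "\<And>E'. orthonormal E' \<Longrightarrow> ?F E \<le> ?F E'" by auto
  have "E $ i \<bullet> (A *v E $ j) = 0" if "i \<noteq> j" for i j
  proof (rule ccontr)
    define m where "m = E $ i \<bullet> (A *v E $ j)"
    define D where "D = E $ j \<bullet> (A *v E $ j) - E $ i \<bullet> (A *v E $ i)"
    assume "E $ i \<bullet> (A *v E $ j) \<noteq> 0"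
    then have m: "m \<noteq> 0" by (simp add: m_def)
    have aij: "a i - a j \<noteq> 0" using \<open>inj a\<close> that by (simp add: inj_eq)
    define G where "G = (\<lambda>t. (a i - a j) * ((sin t)\<^sup>2 * D + 2 * cos t * sin t * m))"
    have pos: "0 \<le> G t" for t
      using min[OF orthonormal_rotate_rows[OF E that, of "cos t" "sin t"]]
        weighted_diagonal_rotate_rows[OF sym that, of "cos t" "sin t" a E]
      by (simp add: G_def D_def m_def)
    \<comment> \<open>Only the mixed term survives to first order, so a minimum at angle 0 forces
      the off-diagonal entry to vanish as soon as the two weights differ.\<close>
    have "(G has_real_derivative (a i - a j) * (2 * m)) (at 0)"
      unfolding G_def by (auto intro!: derivative_eq_intros)
    moreover have "G 0 = 0" by (simp add: G_def)
    ultimately have "(a i - a j) * (2 * m) = 0"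
      using DERIV_local_min[of G "(a i - a j) * (2 * m)" 0 1] pos by simp
    with aij m show False by (metis mult_eq_0_iff zero_neq_numeral)
  qed
  with E min that show thesis by blast
qed

text \<open>Conjugation by the orthogonal matrix \<open>E\<close> preserves the characteristic
  polynomial and makes the matrix diagonal.\<close>

lemma eigenvalue_vector_eigenframe:
  fixes A :: "real^'n^'n"
  assumes E: "orthonormal E" and off: "\<And>i j. i \<noteq> j \<Longrightarrow> E $ i \<bullet> (A *v E $ j) = 0"
  shows "eigenvalue_vector A (\<chi> i. E $ i \<bullet> (A *v E $ i))"
  unfolding eigenvalue_vector_def
proof
  fix t
  have O: "orthogonal_matrix E" using E orthonormal_iff_orthogonal_matrix by blast
  have entry: "(E ** B ** transpose E) $ i $ j = E $ i \<bullet> (B *v E $ j)" for B :: "real^'n^'n" and i j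
  proof -
    have "E ** B ** transpose E = E ** (B ** transpose E)" by (simp add: matrix_mul_assoc)
    then show ?thesis
      by (simp add: matrix_matrix_mult_def matrix_vector_mult_def transpose_def inner_vec_def)
  qed
  have mv: "(mat t - A) *v y = t *\<^sub>R y - A *v y" for y
  proof -
    have "mat t *v y = t *\<^sub>R y"
      by (simp add: mat_def vec_eq_iff matrix_vector_mult_def if_distrib if_distribR sum.delta cong: if_cong)
    then show ?thesis by (simp add: matrix_vector_mult_diff_rdistrib)
  qed
  have entry': "(E ** (mat t - A) ** transpose E) $ i $ j = (if i = j then t - E $ i \<bullet> (A *v E $ i) else 0)" for i j
    using E off[of i j] by (simp add: entry mv inner_diff_right orthonormal_def)
  have "det (mat t - A) = det (E ** (mat t - A) ** transpose E)"
    using det_orthogonal_matrix[OF O] by (auto simp: det_mul)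
  also have "\<dots> = (\<Prod>i\<in>UNIV. (E ** (mat t - A) ** transpose E) $ i $ i)"
    by (rule det_diagonal) (simp add: entry')
  finally show "det (mat t - A) = (\<Prod>i\<in>UNIV. t - (\<chi> i. E $ i \<bullet> (A *v E $ i)) $ i)"
    by (simp add: entry')
qed

text \<open>Polynomials that agree as functions have the same multiset of roots, and two families
  with the same multiset of values differ by a permutation of the indices.\<close>

lemma eigenvalue_vector_unique:
  fixes A :: "real^'n^'n"
  assumes "eigenvalue_vector A l" "eigenvalue_vector A l'"
  obtains \<sigma> where "\<sigma> permutes UNIV" "l' = (\<chi> i. l $ \<sigma> i)"
proof -
  let ?p = "\<lambda>l :: real^'n. \<Prod>i\<in>UNIV. [:- l $ i, 1:]"
  have "poly (?p l) = poly (?p l')"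
    using assms by (auto simp: eigenvalue_vector_def poly_prod fun_eq_iff)
  then have "?p l = ?p l'" by (simp add: poly_eq_poly_eq_iff)
  then have "proots (?p l) = proots (?p l')" by simp
  moreover have "proots (?p l) = image_mset (\<lambda>i. l $ i) (mset_set UNIV)" for l :: "real^'n"
  proof -
    have "proots (?p l) = (\<Sum>i\<in>UNIV. {#l $ i#})"
      by (subst proots_prod) (auto simp: proots_linear_factor)
    then show ?thesis by (simp add: sum_unfold_sum_mset image_mset.compositionality)
  qed
  ultimately have "image_mset (\<lambda>i. l' $ i) (mset_set UNIV) = image_mset (\<lambda>i. l $ i) (mset_set UNIV)"
    by simp
  from image_mset_eq_implies_permutes[OF _ this]
  obtain p where "p permutes UNIV" "\<And>i. l' $ i = l $ p i" by auto
  then show thesis using that by (simp add: vec_eq_iff)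
qed

lemma symmetric_set_closure:
  fixes S :: "(real^'n) set"
  assumes "symmetric_set S" shows "symmetric_set (closure S)"
  unfolding symmetric_set_def
proof (intro ballI allI impI)
  fix l :: "real^'n" and \<sigma> :: "'n \<Rightarrow> 'n" assume l: "l \<in> closure S" and \<sigma>: "\<sigma> permutes UNIV"
  have "(\<lambda>l. \<chi> i. l $ \<sigma> i) ` closure S \<subseteq> closure S"
  proof (rule image_closure_subset)
    show "continuous_on (closure S) (\<lambda>l. \<chi> i. l $ \<sigma> i)" by (intro continuous_intros)
    show "(\<lambda>l. \<chi> i. l $ \<sigma> i) ` S \<subseteq> closure S"
      using assms \<sigma> closure_subset unfolding symmetric_set_def by blast
  qed simp
  with l show "(\<chi> i. l $ \<sigma> i) \<in> closure S" by blast
qed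

text \<open>Removes the choice made in \<open>eigenvalues\<close>: for symmetric sets any vector of
  eigenvalues at hand will do.\<close>

lemma eigenvalues_mem_iff:
  assumes "symmetric_set S" "eigenvalue_vector A l"
  shows "eigenvalues A \<in> S \<longleftrightarrow> l \<in> S"
proof -
  have ev: "eigenvalue_vector A (eigenvalues A)"
    unfolding eigenvalues_def using assms(2) by (rule someI)
  have "l' \<in> S" if l: "eigenvalue_vector A l" "eigenvalue_vector A l'" "l \<in> S" for l l'
  proof -
    obtain \<sigma> where "\<sigma> permutes UNIV" "l' = (\<chi> i. l $ \<sigma> i)"
      using eigenvalue_vector_unique[OF l(1,2)] .
    with l(3) assms(1) show ?thesis by (simp add: symmetric_set_def)
  qed
  from this[OF ev assms(2)] this[OF assms(2) ev] show ?thesis by blast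
qed

section \<open>Eigenvalue conditions in terms of frames and dual cones\<close>

lemma ex_inj_real: "\<exists>c :: 'n::finite \<Rightarrow> real. inj c"
proof -
  obtain f :: "'n \<Rightarrow> nat" where "inj f"
    using finite_imp_inj_to_nat_seg[of "UNIV :: 'n set"] by auto
  then have "inj (\<lambda>i. real (f i))" by (simp add: inj_def)
  then show ?thesis by blast
qed

text \<open>The perturbed weights of two distinct indices agree for at most one \<epsilon>, so only
  the finite set \<open>B\<close> has to be avoided.\<close>

lemma ex_inj_perturbation:
  fixes a c :: "'n::finite \<Rightarrow> real"
  assumes "inj c" "0 < \<delta>"
  obtains \<epsilon> where "0 < \<epsilon>" "\<epsilon> < \<delta>" "inj (\<lambda>i. a i + \<epsilon> * c i)"
proof -
  define B where "B = (\<lambda>p. (a (snd p) - a (fst p)) / (c (fst p) - c (snd p))) ` (UNIV :: ('n \<times> 'n) set)"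
  have "finite B" unfolding B_def by (rule finite_imageI) (rule finite)
  then have "infinite ({0<..<\<delta>} - B)"
    using infinite_Ioo[OF assms(2)] by (rule_tac Diff_infinite_finite)
  then have "{0<..<\<delta>} - B \<noteq> {}" by force
  then obtain \<epsilon> where \<epsilon>: "\<epsilon> \<in> {0<..<\<delta>} - B" by blast
  have "inj (\<lambda>i. a i + \<epsilon> * c i)"
  proof (rule injI, rule ccontr)
    fix i j assume eq: "a i + \<epsilon> * c i = a j + \<epsilon> * c j" and "i \<noteq> j"
    then have "c i - c j \<noteq> 0" using assms(1) by (simp add: inj_eq)
    moreover have "\<epsilon> * (c i - c j) = a j - a i" using eq unfolding right_diff_distrib by linarith
    ultimately have "\<epsilon> = (a j - a i) / (c i - c j)" by (rule eq_divide_imp)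
    then have "\<epsilon> \<in> B" unfolding B_def by (intro image_eqI[of _ _ "(i, j)"]) simp_all
    with \<epsilon> show False by blast
  qed
  moreover have "0 < \<epsilon>" "\<epsilon> < \<delta>" using \<epsilon> by simp_all
  ultimately show thesis by (intro that)
qed

text \<open>A form of the trace inequality: over all frames the weighted diagonal is smallest in an
  eigenframe, where it is the pairing of \<open>a\<close> with a vector of eigenvalues. A minimiser
  is known to be an eigenframe only for distinct weights, hence the perturbation of \<open>a\<close>
  by a multiple of \<open>c\<close>.\<close>

lemma weighted_diagonal_nonneg:
  fixes A E :: "real^'n^'n" and a :: "'n \<Rightarrow> real"
  assumes sym: "transpose A = A" and "symmetric_set \<Gamma>" and mem: "eigenvalues A \<in> closure \<Gamma>"
    and dual: "\<And>l. l \<in> \<Gamma> \<Longrightarrow> 0 \<le> (\<Sum>i\<in>UNIV. a i * l $ i)" and E: "orthonormal E"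
  shows "0 \<le> weighted_diagonal a E A"
proof -
  have dual': "0 \<le> (\<Sum>i\<in>UNIV. a i * l $ i)" if "l \<in> closure \<Gamma>" for l
  proof -
    have "closure \<Gamma> \<subseteq> {l. 0 \<le> (\<Sum>i\<in>UNIV. a i * l $ i)}"
      using dual by (intro closure_minimal closed_Collect_le continuous_intros) auto
    with that show ?thesis by blast
  qed
  obtain c :: "'n \<Rightarrow> real" where c: "inj c" using ex_inj_real by blast
  obtain K where K: "0 < K" "\<And>x. norm (A *v x) \<le> norm x * K"
    using bounded_linear.pos_bounded[OF matrix_vector_mul_bounded_linear[of A]] by blast
  have bd: "\<bar>F $ i \<bullet> (A *v F $ i)\<bar> \<le> K" if "orthonormal F" for F i
  proof -
    have "norm (F $ i) = 1" using that by (simp add: orthonormal_def norm_eq_1)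
    then show ?thesis using Cauchy_Schwarz_ineq2[of "F $ i" "A *v F $ i"] K(2)[of "F $ i"] by simp
  qed
  define S where "S = (\<Sum>i\<in>UNIV. \<bar>c i\<bar> * K)"
  have S: "0 \<le> S" unfolding S_def using K(1) by (intro sum_nonneg) auto
  have bdc: "\<bar>\<Sum>i\<in>UNIV. c i * (F $ i \<bullet> (A *v F $ i))\<bar> \<le> S" if "orthonormal F" for F
    unfolding S_def using bd[OF that]
    by (intro order_trans[OF sum_abs] sum_mono) (auto simp: abs_mult intro: mult_left_mono)
  let ?Q = "\<Sum>i\<in>UNIV. a i * (E $ i \<bullet> (A *v E $ i))"
  show ?thesis
  proof (rule ccontr)
    assume neg: "\<not> 0 \<le> ?Q"
    \<comment> \<open>The perturbation changes the sums for \<open>E\<close> and for the minimiser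
      by at most \<open>\<epsilon> * S\<close> each, too little to make up for the negative value of
      \<open>?Q\<close>.\<close>
    define \<delta> where "\<delta> = - ?Q / (2 * (S + 1))"
    have "0 < \<delta>" using neg S by (simp add: \<delta>_def field_simps)
    then obtain \<epsilon> where \<epsilon>: "0 < \<epsilon>" "\<epsilon> < \<delta>" "inj (\<lambda>i. a i + \<epsilon> * c i)"
      using ex_inj_perturbation[OF c] by metis
    obtain F where F: "orthonormal F" "\<And>i j. i \<noteq> j \<Longrightarrow> F $ i \<bullet> (A *v F $ j) = 0"
      and min: "\<And>E'. orthonormal E' \<Longrightarrow> (\<Sum>k\<in>UNIV. (a k + \<epsilon> * c k) * (F $ k \<bullet> (A *v F $ k)))
         \<le> (\<Sum>k\<in>UNIV. (a k + \<epsilon> * c k) * (E' $ k \<bullet> (A *v E' $ k)))"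
      using weighted_diagonal_minimiser[OF sym \<epsilon>(3)] by blast
    have "(\<chi> i. F $ i \<bullet> (A *v F $ i)) \<in> closure \<Gamma>"
      using eigenvalues_mem_iff[OF symmetric_set_closure[OF assms(2)] eigenvalue_vector_eigenframe[OF F]] mem
      by blast
    from dual'[OF this] have "0 \<le> weighted_diagonal a F A" by simp
    moreover have sp: "(\<Sum>k\<in>UNIV. (a k + \<epsilon> * c k) * (E' $ k \<bullet> (A *v E' $ k)))
        = weighted_diagonal a E' A + \<epsilon> * weighted_diagonal c E' A" for E'
      unfolding distrib_right sum.distrib sum_distrib_left by (simp add: mult.assoc)
    moreover have "\<epsilon> * weighted_diagonal c E A \<le> \<epsilon> * S"
      "\<epsilon> * (- S) \<le> \<epsilon> * weighted_diagonal c F A"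
      using bdc[OF E] bdc[OF F(1)] \<epsilon>(1) by (intro mult_left_mono; linarith)+
    ultimately have "- ?Q \<le> 2 * \<epsilon> * S" using min[OF E] unfolding sp by linarith
    also have "\<dots> \<le> 2 * \<delta> * S" using \<epsilon> S by (intro mult_right_mono) auto
    also have "\<dots> < 2 * \<delta> * (S + 1)" using \<open>0 < \<delta>\<close> by simp
    also have "\<dots> = - ?Q"
    proof -
      have "2 * (- q / (2 * (S + 1))) * (S + 1) = - q" for q
        using S by (simp add: divide_simps)
      then show ?thesis unfolding \<delta>_def by blast
    qed
    finally show False by simp
  qed
qed

text \<open>A point \<open>x'\<close> of the cone replaces \<open>x\<close>; the difference is
  shifted to \<open>y\<close>, where openness leaves room, and twice the midpoint of
  \<open>x'\<close> and \<open>y + (x - x')\<close> is the sum.\<close>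

lemma add_closure_open_cone:
  fixes \<Gamma> :: "'a::real_normed_vector set"
  assumes "open \<Gamma>" "convex \<Gamma>" "cone_at_origin \<Gamma>" "x \<in> closure \<Gamma>" "y \<in> \<Gamma>"
  shows "x + y \<in> \<Gamma>"
proof -
  obtain e where e: "0 < e" "ball y e \<subseteq> \<Gamma>" using assms(1,5) openE by blast
  obtain x' where x': "x' \<in> \<Gamma>" "dist x' x < e" using assms(4) e(1) closure_approachable by blast
  have "y + (x - x') \<in> \<Gamma>" using e(2) x'(2) by (auto simp: dist_norm norm_minus_commute)
  with x'(1) have "(1/2) *\<^sub>R x' + (1/2) *\<^sub>R (y + (x - x')) \<in> \<Gamma>"
    using assms(2) by (intro convexD) auto
  then have "2 *\<^sub>R ((1/2) *\<^sub>R x' + (1/2) *\<^sub>R (y + (x - x'))) \<in> \<Gamma>"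
    using assms(3) by (simp add: cone_at_origin_def)
  then show ?thesis by (simp add: scaleR_add_right add.commute)
qed

text \<open>The bipolar theorem. If a hyperplane separated \<open>x\<close> from the closure, large
  multiples of points of the cone would show that its normal is nonnegative on the cone, and small
  multiples would exclude a positive level \<open>b\<close>.\<close>

lemma mem_closure_cone_dual:
  fixes \<Gamma> :: "(real^'n) set"
  assumes "convex \<Gamma>" "cone_at_origin \<Gamma>" "\<Gamma> \<noteq> {}"
    and "\<And>a. (\<And>l. l \<in> \<Gamma> \<Longrightarrow> 0 \<le> a \<bullet> l) \<Longrightarrow> 0 \<le> a \<bullet> x"
  shows "x \<in> closure \<Gamma>"
proof (rule ccontr)
  assume "x \<notin> closure \<Gamma>"
  then obtain a b where ab: "a \<bullet> x < b" "\<And>l. l \<in> closure \<Gamma> \<Longrightarrow> b < a \<bullet> l"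
    using separating_hyperplane_closed_point[of "closure \<Gamma>" x] assms(1) convex_closure by blast
  have *: "b < t * (a \<bullet> l)" if "l \<in> \<Gamma>" "0 < t" for l t
    using ab(2)[of "t *\<^sub>R l"] assms(2) that closure_subset[of \<Gamma>] by (auto simp: cone_at_origin_def)
  have nn: "0 \<le> a \<bullet> l" if l: "l \<in> \<Gamma>" for l
  proof (rule ccontr)
    assume neg: "\<not> 0 \<le> a \<bullet> l"
    have "b < (\<bar>b\<bar> + 1) / - (a \<bullet> l) * (a \<bullet> l)" using neg by (intro *[OF l]) (auto simp: field_simps)
    then show False using neg by auto
  qed
  have "0 \<le> a \<bullet> x" by (rule assms(4)) (rule nn)
  with ab have "0 < b" by simp
  obtain l where l: "l \<in> \<Gamma>" using assms(3) by blast
  have "b < b / (a \<bullet> l + 1) * (a \<bullet> l)" using nn[OF l] \<open>0 < b\<close> by (intro *[OF l]) auto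
  also have "\<dots> \<le> b" using nn[OF l] \<open>0 < b\<close> by (simp add: field_simps)
  finally show False by simp
qed

text \<open>The margin \<open>c\<close> says that the eigenvalues minus the constant vector
  \<open>v\<close> lie in the bidual, hence in the closure; adding back \<open>v\<close>, a point of
  the open cone, leads into the cone itself.\<close>

lemma eigenvalues_mem_open_cone:
  fixes A :: "real^'n^'n"
  assumes sym: "transpose A = A" and "symmetric_set \<Gamma>" "open \<Gamma>" "convex \<Gamma>" "cone_at_origin \<Gamma>"
    and pos: "{l. \<forall>i. l $ i > 0} \<subseteq> \<Gamma>" and "0 < c"
    and lower: "\<And>E a. orthonormal E \<Longrightarrow> (\<And>l. l \<in> \<Gamma> \<Longrightarrow> 0 \<le> (\<Sum>i\<in>UNIV. a i * l $ i)) \<Longrightarrow>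
       c * sum a UNIV \<le> weighted_diagonal a E A"
  shows "eigenvalues A \<in> \<Gamma>"
proof -
  obtain b :: "'n \<Rightarrow> real" where b: "inj b" using ex_inj_real by blast
  obtain E where E: "orthonormal E" "\<And>i j. i \<noteq> j \<Longrightarrow> E $ i \<bullet> (A *v E $ j) = 0"
    using weighted_diagonal_minimiser[OF sym b] by metis
  define l :: "real^'n" where "l = (\<chi> i. E $ i \<bullet> (A *v E $ i))"
  define v :: "real^'n" where "v = (\<chi> i. c)"
  have v: "v \<in> \<Gamma>"
    by (rule subsetD[OF pos]) (simp add: v_def \<open>0 < c\<close>)
  then have "\<Gamma> \<noteq> {}" by blast
  have "0 \<le> a \<bullet> (l - v)" if a: "\<And>l. l \<in> \<Gamma> \<Longrightarrow> 0 \<le> a \<bullet> l" for a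
  proof -
    have "c * (\<Sum>i\<in>UNIV. a $ i) \<le> (\<Sum>i\<in>UNIV. a $ i * (E $ i \<bullet> (A *v E $ i)))"
    proof (rule lower[OF E(1)])
      show "0 \<le> (\<Sum>i\<in>UNIV. a $ i * l $ i)" if "l \<in> \<Gamma>" for l
        using a[OF that] by (simp add: inner_vec_def)
    qed
    moreover have "a \<bullet> l = (\<Sum>i\<in>UNIV. a $ i * (E $ i \<bullet> (A *v E $ i)))"
      by (simp add: inner_vec_def l_def)
    moreover have "a \<bullet> v = c * (\<Sum>i\<in>UNIV. a $ i)"
      by (simp add: inner_vec_def v_def sum_distrib_left mult.commute)
    ultimately show ?thesis by (simp add: inner_diff_right)
  qed
  then have "l - v \<in> closure \<Gamma>"
    by (rule mem_closure_cone_dual[OF assms(4,5) \<open>\<Gamma> \<noteq> {}\<close>])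
  from add_closure_open_cone[OF assms(3-5) this v] have "l \<in> \<Gamma>" by simp
  then show ?thesis
    using eigenvalues_mem_iff[OF assms(2) eigenvalue_vector_eigenframe[OF E]] by (simp add: l_def)
qed

section \<open>Mollification\<close>

abbreviation jet2 :: "real \<Rightarrow> real^'n \<Rightarrow> real^'n^'n \<Rightarrow> real^'n \<Rightarrow> real" where
  "jet2 b p X h \<equiv> b + p \<bullet> h + h \<bullet> (X *v h) / 2"

text \<open>One constant controls gradient, Hessian and remainder, so that estimates based on this
  predicate are uniform in the point and linear in \<open>C\<close>.\<close>

definition taylor2 :: "real \<Rightarrow> (real^'n \<Rightarrow> real) \<Rightarrow> real^'n \<Rightarrow> real^'n \<Rightarrow> real^'n^'n \<Rightarrow> bool" where
  "taylor2 C f x p X \<longleftrightarrow> transpose X = X \<and> norm p \<le> C \<and>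
     (\<forall>v. \<bar>v \<bullet> (X *v v)\<bar> \<le> C * (norm v)\<^sup>2) \<and>
     (\<forall>h. norm h \<le> 1 \<longrightarrow> \<bar>f (x + h) - f x - p \<bullet> h - h \<bullet> (X *v h) / 2\<bar> \<le> C * norm h ^ 3)"

abbreviation bump_base :: "real \<Rightarrow> 'a::real_normed_vector \<Rightarrow> real" where
  "bump_base r z \<equiv> max 0 (r\<^sup>2 - (norm z)\<^sup>2)"

text \<open>The cube is the lowest power of the positive part with Lipschitz second derivatives,
  which is what a cubic Taylor remainder requires. Inside the ball the kernel is a polynomial, so
  its derivatives are explicit.\<close>

definition bump :: "real \<Rightarrow> 'a::real_normed_vector \<Rightarrow> real" where
  "bump r z = (bump_base r z) ^ 3"

definition bump_mass :: "'a::euclidean_space itself \<Rightarrow> real \<Rightarrow> real" where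
  "bump_mass _ r = (\<integral>z. bump r (z :: 'a) \<partial>lborel)"

text \<open>The kernel is even, so \<open>x + z\<close> gives the same average as the usual
  convolution with \<open>x - z\<close>.\<close>

definition moll :: "real \<Rightarrow> ('a::euclidean_space \<Rightarrow> real) \<Rightarrow> 'a \<Rightarrow> real" where
  "moll r W x = (\<integral>z. bump r z * W (x + z) \<partial>lborel) / bump_mass TYPE('a) r"

text \<open>The constant is 1 + 3 + 3, from the case where the sign changes from \<open>s\<close> to
  \<open>s + k < 0\<close>: then \<open>s \<le> \<bar>k\<bar>\<close>, and the three remaining terms
  are estimated separately.\<close>

lemma cube_pos_part_taylor:
  fixes s k :: real
  shows "\<bar>(max 0 (s + k)) ^ 3 - (max 0 s) ^ 3 - 3 * (max 0 s)\<^sup>2 * k - 3 * max 0 s * k\<^sup>2\<bar> \<le> 7 * \<bar>k\<bar> ^ 3"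
proof -
  consider "0 \<le> s" "0 \<le> s + k" | "0 \<le> s" "s + k < 0" | "s < 0" "0 \<le> s + k" | "s < 0" "s + k < 0" by linarith
  then show ?thesis
  proof cases
    case 1
    then have "(max 0 (s + k)) ^ 3 - (max 0 s) ^ 3 - 3 * (max 0 s)\<^sup>2 * k - 3 * max 0 s * k\<^sup>2 = k ^ 3"
      by (simp add: power2_eq_square power3_eq_cube algebra_simps)
    then show ?thesis by (simp add: power_abs)
  next
    case 2
    have sk: "0 \<le> s" "s \<le> \<bar>k\<bar>" using 2 by auto
    have "\<bar>- (s ^ 3) - 3 * s\<^sup>2 * k - 3 * s * k\<^sup>2\<bar> \<le> s ^ 3 + 3 * (s\<^sup>2 * \<bar>k\<bar>) + 3 * (s * \<bar>k\<bar>\<^sup>2)"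
    proof -
      have "\<bar>s ^ 3\<bar> = s ^ 3" "\<bar>s\<^sup>2 * k\<bar> = s\<^sup>2 * \<bar>k\<bar>" "\<bar>s * k\<^sup>2\<bar> = s * \<bar>k\<bar>\<^sup>2"
        using sk(1) by (auto simp: abs_mult)
      then show ?thesis by linarith
    qed
    also have "\<dots> \<le> \<bar>k\<bar> ^ 3 + 3 * (\<bar>k\<bar>\<^sup>2 * \<bar>k\<bar>) + 3 * (\<bar>k\<bar> * \<bar>k\<bar>\<^sup>2)"
      using sk by (intro add_mono mult_left_mono mult_right_mono power_mono) auto
    also have "\<dots> = 7 * \<bar>k\<bar> ^ 3" by (simp add: power2_eq_square power3_eq_cube)
    finally show ?thesis using 2 by simp
  next
    case 3
    then have "(s + k) ^ 3 \<le> k ^ 3" by (intro power_mono) auto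
    moreover have "0 \<le> (s + k) ^ 3" "0 \<le> k ^ 3" using 3 by simp_all
    ultimately have "\<bar>(s + k) ^ 3\<bar> \<le> 7 * k ^ 3" by linarith
    then show ?thesis using 3 by simp
  next
    case 4
    then show ?thesis by simp
  qed
qed

section \<open>Integration against the kernel\<close>

lemma bump_nonneg: "0 \<le> bump r z" by (simp add: bump_def)

lemma bump_eq_0:
  assumes "0 \<le> r" "r \<le> norm z" shows "bump r z = 0"
proof -
  have "r\<^sup>2 \<le> (norm z)\<^sup>2" using assms by (rule_tac power_mono)
  then show ?thesis by (simp add: bump_def)
qed

lemma continuous_on_bump [continuous_intros]:
  "continuous_on S g \<Longrightarrow> continuous_on S (\<lambda>x. bump r (g x))"
  unfolding bump_def by (intro continuous_intros)

lemma
  fixes f :: "'a::euclidean_space \<Rightarrow> 'b::{banach, second_countable_topology}"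
  assumes "continuous_on UNIV f" and zero: "\<And>z. R < norm z \<Longrightarrow> f z = 0"
  shows integrable_compact_support: "integrable lborel f"
    and norm_integral_compact_support_le:
      "(\<And>z. norm z \<le> R \<Longrightarrow> norm (f z) \<le> B) \<Longrightarrow>
        norm (\<integral>z. f z \<partial>lborel) \<le> B * measure lborel (cball (0::'a) R)"
proof -
  have f: "(\<lambda>x. indicator (cball 0 R) x *\<^sub>R f x) = f"
    using zero by (auto simp: indicator_def fun_eq_iff)
  have "integrable lborel (\<lambda>x. indicator (cball 0 R) x *\<^sub>R f x)"
    using assms(1) by (intro borel_integrable_compact) (auto intro: continuous_on_subset)
  then show int: "integrable lborel f" unfolding f .
  assume B: "norm (f z) \<le> B" if "norm z \<le> R" for z
  have "norm (\<integral>z. f z \<partial>lborel) \<le> (\<integral>z. B * indicator (cball (0::'a) R) z \<partial>lborel)"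
  proof (rule Bochner_Integration.integral_norm_bound_integral[OF int])
    show "integrable lborel (\<lambda>z::'a. B * indicator (cball 0 R) z)"
      by (intro integrable_mult_right integrable_real_indicator) (auto simp: emeasure_bounded_finite[simplified])
    show "norm (f z) \<le> B * indicator (cball 0 R) z" for z
      using B[of z] zero[of z] by (auto simp: indicator_def not_le)
  qed
  also have "\<dots> = B * measure lborel (cball (0::'a) R)" by simp
  finally show "norm (\<integral>z. f z \<partial>lborel) \<le> B * measure lborel (cball (0::'a) R)" .
qed

lemma integrable_bump_mult:
  fixes W :: "'a::euclidean_space \<Rightarrow> real"
  assumes "continuous_on UNIV W" "0 \<le> r"
  shows "integrable lborel (\<lambda>z. bump r z * W (x + z))"
proof (rule integrable_compact_support)
  show "continuous_on UNIV (\<lambda>z. bump r z * W (x + z))"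
    by (intro continuous_intros continuous_on_compose2[OF assms(1)]) auto
  show "bump r z * W (x + z) = 0" if "r < norm z" for z
    using bump_eq_0[of r z] assms(2) that by simp
qed

lemma bump_mass_pos:
  assumes "0 < r" shows "0 < bump_mass TYPE('a::euclidean_space) r"
proof -
  let ?B = "ball (0::'a) (r/2)"
  \<comment> \<open>The value of the kernel at distance \<open>r / 2\<close>, a lower bound for it
    on the ball of that radius.\<close>
  define c where "c = (3 * r\<^sup>2 / 4) ^ 3"
  have "0 < c * measure lborel ?B"
    using assms by (auto intro!: mult_pos_pos simp: c_def content_ball_pos)
  also have "\<dots> = (\<integral>z. c * indicator ?B z \<partial>lborel)" by simp
  also have "\<dots> \<le> (\<integral>z. bump r (z::'a) \<partial>lborel)"
  proof (rule Bochner_Integration.integral_mono)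
    show "integrable lborel (\<lambda>z::'a. c * indicator ?B z)"
      by (intro integrable_mult_right integrable_real_indicator) (auto simp: emeasure_bounded_finite[simplified])
    show "integrable lborel (bump r :: 'a \<Rightarrow> real)"
      using integrable_bump_mult[of "\<lambda>_. 1" r 0] assms by simp
    show "c * indicator ?B z \<le> bump r z" for z :: 'a
    proof (cases "z \<in> ?B")
      case True
      then have "(norm z)\<^sup>2 \<le> (r/2)\<^sup>2" by (intro power_mono) auto
      then have "3 * r\<^sup>2 / 4 \<le> r\<^sup>2 - (norm z)\<^sup>2" by (simp add: power_divide)
      then have "3 * r\<^sup>2 / 4 \<le> bump_base r z" by linarith
      then have "c \<le> bump r z" unfolding c_def bump_def by (intro power_mono) auto
      then show ?thesis using True by simp
    qed (simp add: bump_nonneg)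
  qed
  finally show ?thesis by (simp add: bump_mass_def)
qed

lemma moll_const: "0 < r \<Longrightarrow> moll r (\<lambda>_. c) x = c"
  using bump_mass_pos[of r, where ?'a = 'a] by (simp add: moll_def bump_mass_def)

lemma moll_cmult: "moll r (\<lambda>x. c * f x) x = c * moll r f x"
proof -
  have "(\<lambda>z. bump r z * (c * f (x + z))) = (\<lambda>z. c * (bump r z * f (x + z)))" by (auto simp: fun_eq_iff)
  then show ?thesis by (simp add: moll_def)
qed

lemma moll_add:
  assumes "continuous_on UNIV f" "continuous_on UNIV g" "0 \<le> r"
  shows "moll r (\<lambda>x. f x + g x) x = moll r f x + moll r g x"
  using assms by (simp add: moll_def distrib_left integrable_bump_mult add_divide_distrib)

lemma moll_sum:
  assumes "finite I" "\<And>i. i \<in> I \<Longrightarrow> continuous_on UNIV (f i)" "0 \<le> r"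
  shows "moll r (\<lambda>x. \<Sum>i\<in>I. f i x) x = (\<Sum>i\<in>I. moll r (f i) x)"
  using assms(1,2)
proof (induction I rule: finite_induct)
  case empty
  show ?case by (simp add: moll_def)
next
  case (insert i I)
  then show ?case using assms(3) by (simp add: moll_add continuous_on_sum)
qed

lemma moll_translate: "moll r (\<lambda>x. f (x + v)) x = moll r f (x + v)"
proof -
  have "(\<lambda>z. bump r z * f (x + z + v)) = (\<lambda>z. bump r z * f (x + v + z))" by (simp add: ac_simps)
  then show ?thesis by (simp add: moll_def)
qed

lemma moll_mono:
  fixes f g :: "'a::euclidean_space \<Rightarrow> real"
  assumes "continuous_on UNIV f" "continuous_on UNIV g" "0 < r"
    and "\<And>z. norm z \<le> r \<Longrightarrow> f (x + z) \<le> g (x + z)"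
  shows "moll r f x \<le> moll r g x"
  unfolding moll_def
proof (intro divide_right_mono Bochner_Integration.integral_mono integrable_bump_mult)
  show "bump r z * f (x + z) \<le> bump r z * g (x + z)" for z
    using assms(4)[of z] bump_eq_0[of r z] \<open>0 < r\<close> by (cases "norm z \<le> r") (auto intro: mult_left_mono bump_nonneg)
qed (use assms bump_mass_pos[of r, where ?'a = 'a] in auto)

lemma moll_close:
  fixes W :: "'a::euclidean_space \<Rightarrow> real"
  assumes W: "continuous_on UNIV W" "0 < r" "\<And>z. norm z \<le> r \<Longrightarrow> \<bar>W (x + z) - c\<bar> \<le> e"
  shows "\<bar>moll r W x - c\<bar> \<le> e"
proof -
  have "moll r W x \<le> moll r (\<lambda>_. c + e) x" "moll r (\<lambda>_. c - e) x \<le> moll r W x"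
    by (rule moll_mono; use W in \<open>force simp: abs_le_iff\<close>)+
  then show ?thesis using W(2) by (simp add: moll_const abs_le_iff)
qed

section \<open>Second-order expansion of averages\<close>

lemma lborel_integral_shift:
  fixes f :: "'a::euclidean_space \<Rightarrow> 'b::{banach, second_countable_topology}"
  assumes "f \<in> borel_measurable borel"
  shows "(\<integral>z. f (c + z) \<partial>lborel) = (\<integral>z. f z \<partial>lborel)"
proof -
  have "(\<integral>z. f z \<partial>lborel) = (\<integral>z. f z \<partial>distr lborel borel ((+) c))" by (simp add: lborel_distr_plus)
  also have "\<dots> = (\<integral>z. f (c + z) \<partial>lborel)" by (rule integral_distr) (use assms in auto)
  finally show ?thesis by simp
qed

text \<open>The sign is that of the derivative of \<open>bump r (z - h)\<close> in \<open>h\<close>,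
  since the increment will act on the kernel through a change of variables.\<close>

definition bump_grad :: "real \<Rightarrow> 'a::real_normed_vector \<Rightarrow> 'a" where
  "bump_grad r z = (6 * (bump_base r z)\<^sup>2) *\<^sub>R z"

definition bump_hess :: "real \<Rightarrow> real^'n \<Rightarrow> real^'n^'n" where
  "bump_hess r z = (- 6 * (bump_base r z)\<^sup>2) *\<^sub>R mat 1
     + (24 * bump_base r z) *\<^sub>R (\<chi> i j. z $ i * z $ j)"

lemma transpose_bump_hess: "transpose (bump_hess r z) = bump_hess r z"
  by (auto simp: vec_eq_iff transpose_def bump_hess_def mat_def)

lemma bump_hess_quadratic:
  "h \<bullet> (bump_hess r z *v h) = - 6 * (bump_base r z)\<^sup>2 * (norm h)\<^sup>2
     + 24 * bump_base r z * (z \<bullet> h)\<^sup>2"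
proof -
  have "(\<chi> i j. z $ i * z $ j) *v h = (z \<bullet> h) *\<^sub>R z"
    by (simp add: vec_eq_iff matrix_vector_mult_def inner_vec_def sum_distrib_left sum_distrib_right mult.assoc mult.commute mult.left_commute)
  then have "bump_hess r z *v h = (- 6 * (bump_base r z)\<^sup>2) *\<^sub>R h
      + (24 * bump_base r z) *\<^sub>R ((z \<bullet> h) *\<^sub>R z)"
    unfolding bump_hess_def matrix_vector_mult_add_rdistrib scaleR_matrix_vector_assoc[symmetric] by simp
  then show ?thesis
    by (simp only: inner_add_right inner_scaleR_right power2_norm_eq_inner inner_commute[of h z])
      (simp add: power2_eq_square)
qed

text \<open>In this order: the gradient, the two parts of the Hessian, the excess of
  \<open>3 * s * k\<^sup>2\<close> over second order, and the remainder of the cube. The radius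
  \<open>r + 1\<close> covers the support after a shift by at most 1.\<close>

definition bump_const :: "real \<Rightarrow> real" where
  "bump_const r = 6 * (r\<^sup>2)\<^sup>2 * (r + 1) + 6 * (r\<^sup>2)\<^sup>2 + 24 * r\<^sup>2 * (r + 1)\<^sup>2
     + 3 * r\<^sup>2 * (4 * (r + 1) + 1) + 7 * (2 * (r + 1) + 1) ^ 3"

lemma bump_taylor:
  fixes z :: "real^'n"
  assumes "0 < r" "norm z \<le> r + 1"
  shows "norm (bump_grad r z) \<le> bump_const r"
    and "\<bar>h \<bullet> (bump_hess r z *v h)\<bar> \<le> bump_const r * (norm h)\<^sup>2"
    and "norm h \<le> 1 \<Longrightarrow> \<bar>bump r (z - h) - bump r z - bump_grad r z \<bullet> h - h \<bullet> (bump_hess r z *v h) / 2\<bar>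
      \<le> bump_const r * norm h ^ 3"
proof -
  define s where "s = bump_base r z"
  \<comment> \<open>The increment of \<open>r\<^sup>2 - (norm z)\<^sup>2\<close> when
    \<open>z\<close> is replaced by \<open>z - h\<close>.\<close>
  define k where "k = 2 * (z \<bullet> h) - (norm h)\<^sup>2"
  have s: "0 \<le> s" "s \<le> r\<^sup>2" by (auto simp: s_def)
  then have s2: "s\<^sup>2 \<le> (r\<^sup>2)\<^sup>2" by (intro power_mono) auto
  have zh: "\<bar>z \<bullet> h\<bar> \<le> (r + 1) * norm h"
    by (rule order_trans[OF Cauchy_Schwarz_ineq2]) (use assms in \<open>auto intro: mult_right_mono\<close>)
  have pos: "0 \<le> 6 * (r\<^sup>2)\<^sup>2 * (r + 1)" "0 \<le> 6 * (r\<^sup>2)\<^sup>2" "0 \<le> 24 * r\<^sup>2 * (r + 1)\<^sup>2"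
     "0 \<le> 3 * r\<^sup>2 * (4 * (r + 1) + 1)" "0 \<le> 7 * (2 * (r + 1) + 1) ^ 3"
    using assms by auto
  have "norm (bump_grad r z) = 6 * s\<^sup>2 * norm z" by (simp add: bump_grad_def s_def)
  also have "\<dots> \<le> 6 * (r\<^sup>2)\<^sup>2 * (r + 1)" using s2 assms by (intro mult_mono) auto
  also have "\<dots> \<le> bump_const r" using pos by (simp add: bump_const_def)
  finally show "norm (bump_grad r z) \<le> bump_const r" .
  have "(z \<bullet> h)\<^sup>2 \<le> ((r + 1) * norm h)\<^sup>2" using zh by (simp add: abs_le_square_iff[symmetric])
  then have "s * (z \<bullet> h)\<^sup>2 \<le> r\<^sup>2 * ((r + 1) * norm h)\<^sup>2" using s by (intro mult_mono) auto
  moreover have "s\<^sup>2 * (norm h)\<^sup>2 \<le> (r\<^sup>2)\<^sup>2 * (norm h)\<^sup>2" using s2 by (intro mult_right_mono) auto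
  moreover have "\<bar>h \<bullet> (bump_hess r z *v h)\<bar> \<le> 6 * (s\<^sup>2 * (norm h)\<^sup>2) + 24 * (s * (z \<bullet> h)\<^sup>2)"
    unfolding bump_hess_quadratic s_def[symmetric] using s
    by (intro order_trans[OF abs_triangle_ineq]) (simp add: abs_mult)
  ultimately have "\<bar>h \<bullet> (bump_hess r z *v h)\<bar> \<le> 6 * ((r\<^sup>2)\<^sup>2 * (norm h)\<^sup>2) + 24 * (r\<^sup>2 * ((r + 1) * norm h)\<^sup>2)"
    by linarith
  also have "\<dots> = (6 * (r\<^sup>2)\<^sup>2 + 24 * r\<^sup>2 * (r + 1)\<^sup>2) * (norm h)\<^sup>2"
    unfolding power_mult_distrib by algebra
  also have "\<dots> \<le> bump_const r * (norm h)\<^sup>2"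
    using pos by (intro mult_right_mono) (simp_all add: bump_const_def)
  finally show "\<bar>h \<bullet> (bump_hess r z *v h)\<bar> \<le> bump_const r * (norm h)\<^sup>2" .
  assume h: "norm h \<le> 1"
  have "(norm (z - h))\<^sup>2 = (norm z)\<^sup>2 - k"
    by (simp add: k_def power2_norm_eq_inner inner_diff_left inner_diff_right inner_commute)
  then have "r\<^sup>2 - (norm (z - h))\<^sup>2 = r\<^sup>2 - (norm z)\<^sup>2 + k" by linarith
  then have "bump r (z - h) = (max 0 (r\<^sup>2 - (norm z)\<^sup>2 + k)) ^ 3"
    by (simp only: bump_def)
  then have t1: "\<bar>bump r (z - h) - bump r z - 3 * s\<^sup>2 * k - 3 * s * k\<^sup>2\<bar> \<le> 7 * \<bar>k\<bar> ^ 3"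
    using cube_pos_part_taylor[of "r\<^sup>2 - (norm z)\<^sup>2" k] by (simp add: bump_def s_def)
  have h2: "(norm h)\<^sup>2 \<le> norm h" using h by (simp add: power2_eq_square mult_left_le)
  have "\<bar>k\<bar> \<le> 2 * \<bar>z \<bullet> h\<bar> + (norm h)\<^sup>2"
    unfolding k_def using abs_triangle_ineq4[of "2 * (z \<bullet> h)" "(norm h)\<^sup>2"] by (simp add: abs_mult)
  also have "\<dots> \<le> (2 * (r + 1) + 1) * norm h" using zh h2 by (simp add: algebra_simps)
  finally have "\<bar>k\<bar> ^ 3 \<le> ((2 * (r + 1) + 1) * norm h) ^ 3" by (intro power_mono) auto
  then have t2: "7 * \<bar>k\<bar> ^ 3 \<le> 7 * (2 * (r + 1) + 1) ^ 3 * norm h ^ 3" by (simp add: power_mult_distrib)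
  \<comment> \<open>Separates what in \<open>k\<^sup>2\<close> exceeds second order in
    \<open>h\<close>; together with the factor \<open>(norm h)\<^sup>2\<close> it goes into the
    cubic remainder.\<close>
  define e where "e = - 4 * (z \<bullet> h) + (norm h)\<^sup>2"
  have k2: "k\<^sup>2 = 4 * (z \<bullet> h)\<^sup>2 + (norm h)\<^sup>2 * e"
    by (simp add: k_def e_def power2_eq_square algebra_simps)
  have "\<bar>e\<bar> \<le> 4 * \<bar>z \<bullet> h\<bar> + (norm h)\<^sup>2"
    unfolding e_def using abs_triangle_ineq[of "- 4 * (z \<bullet> h)" "(norm h)\<^sup>2"] by (simp add: abs_mult)
  also have "\<dots> \<le> (4 * (r + 1) + 1) * norm h" using zh h2 by (simp add: algebra_simps)
  finally have e: "\<bar>e\<bar> \<le> (4 * (r + 1) + 1) * norm h" .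
  have "\<bar>3 * s * ((norm h)\<^sup>2 * e)\<bar> = 3 * s * ((norm h)\<^sup>2 * \<bar>e\<bar>)" using s by (simp add: abs_mult)
  also have "\<dots> \<le> 3 * r\<^sup>2 * ((norm h)\<^sup>2 * ((4 * (r + 1) + 1) * norm h))"
    using s e by (intro mult_mono mult_left_mono) auto
  also have "\<dots> = 3 * r\<^sup>2 * (4 * (r + 1) + 1) * norm h ^ 3" by (simp add: power2_eq_square power3_eq_cube)
  finally have t3: "\<bar>3 * s * ((norm h)\<^sup>2 * e)\<bar> \<le> 3 * r\<^sup>2 * (4 * (r + 1) + 1) * norm h ^ 3" .
  have "bump_grad r z \<bullet> h + h \<bullet> (bump_hess r z *v h) / 2 + 3 * s * ((norm h)\<^sup>2 * e) = 3 * s\<^sup>2 * k + 3 * s * k\<^sup>2"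
    unfolding bump_hess_quadratic k2 by (simp add: bump_grad_def s_def[symmetric] k_def field_simps)
  then have "\<bar>bump r (z - h) - bump r z - bump_grad r z \<bullet> h - h \<bullet> (bump_hess r z *v h) / 2\<bar>
      \<le> 7 * (2 * (r + 1) + 1) ^ 3 * norm h ^ 3 + 3 * r\<^sup>2 * (4 * (r + 1) + 1) * norm h ^ 3"
    using t1 t2 t3 by linarith
  also have "\<dots> = (7 * (2 * (r + 1) + 1) ^ 3 + 3 * r\<^sup>2 * (4 * (r + 1) + 1)) * norm h ^ 3"
    by (rule distrib_right[symmetric])
  also have "\<dots> \<le> bump_const r * norm h ^ 3"
    using pos by (intro mult_right_mono) (simp_all add: bump_const_def)
  finally show "\<bar>bump r (z - h) - bump r z - bump_grad r z \<bullet> h - h \<bullet> (bump_hess r z *v h) / 2\<bar>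
      \<le> bump_const r * norm h ^ 3" .
qed

text \<open>No regularity of \<open>W\<close> beyond continuity is spent: translation invariance
  moves the increment to the kernel, whose expansion is then integrated against \<open>W\<close>.
  Hence \<open>C\<close> depends on the kernel only and the bound is linear in
  \<open>M\<close>.\<close>

lemma moll_taylor2:
  assumes "0 < r"
  shows "\<exists>C\<ge>0. \<forall>(W :: real^'n \<Rightarrow> real) M x. continuous_on UNIV W \<longrightarrow> (\<forall>y. \<bar>W y\<bar> \<le> M) \<longrightarrow>
       (\<exists>p X. taylor2 (C * M) (moll r W) x p X)"
proof -
  let ?m = "bump_mass TYPE(real^'n) r"
  let ?vol = "measure lborel (cball (0 :: real^'n) (r + 1))"
  have m: "0 < ?m" using assms by (rule bump_mass_pos)
  define C where "C = bump_const r * ?vol / ?m"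
  have bc: "0 \<le> bump_const r" using assms by (simp add: bump_const_def)
  have C: "0 \<le> C" using m bc by (simp add: C_def)
  have ex: "\<exists>p X. taylor2 (C * M) (moll r W) x p X"
    if W: "continuous_on UNIV W" and M: "\<And>y. \<bar>W y\<bar> \<le> M" for W :: "real^'n \<Rightarrow> real" and M x
  proof -
    have contW [continuous_intros]: "continuous_on UNIV (\<lambda>z. W (x + z))"
      by (intro continuous_on_compose2[OF W] continuous_intros) auto
    have s0: "bump_base r z = 0" if "r + 1 < norm z" for z :: "real^'n"
    proof -
      have "r\<^sup>2 \<le> (norm z)\<^sup>2" using that assms by (intro power_mono) auto
      then show ?thesis by simp
    qed
    have M0: "0 \<le> M" using M[of 0] by linarith
    define g where "g = (\<lambda>z. (W (x + z) / ?m) *\<^sub>R bump_grad r z)"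
    define H where "H = (\<lambda>z. (W (x + z) / ?m) *\<^sub>R bump_hess r z)"
    have g0: "g z = 0" and H0: "H z = 0" if "r + 1 < norm z" for z
      using s0[OF that] by (auto simp: g_def H_def bump_grad_def bump_hess_def)
    have contg: "continuous_on UNIV g" and contH: "continuous_on UNIV H"
      unfolding g_def H_def bump_grad_def bump_hess_def by (intro continuous_intros; use m in simp)+
    have intg: "integrable lborel g" and intH: "integrable lborel H"
      using integrable_compact_support[OF contg g0] integrable_compact_support[OF contH H0] by auto
    have Wm: "\<bar>W y / ?m\<bar> \<le> M / ?m" for y using M[of y] m by (simp add: divide_right_mono)
    define p where "p = (\<integral>z. g z \<partial>lborel)"
    define X where "X = (\<integral>z. H z \<partial>lborel)"
    have X1: "transpose X = X"
    proof -
      have bl: "bounded_linear (transpose :: real^'n^'n \<Rightarrow> _)"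
        unfolding linear_conv_bounded_linear[symmetric] by (rule linearI) (simp_all add: transpose_def vec_eq_iff)
      have tH: "transpose (H z) = H z" for z
        unfolding H_def linear_scale[OF bounded_linear.linear[OF bl]] transpose_bump_hess ..
      have "transpose X = (\<integral>z. transpose (H z) \<partial>lborel)"
        unfolding X_def by (rule integral_bounded_linear[OF bl intH, symmetric])
      then show ?thesis unfolding tH X_def .
    qed
    have X2: "norm p \<le> C * M"
    proof -
      have "norm p \<le> (M / ?m * bump_const r) * ?vol"
        unfolding p_def
      proof (rule norm_integral_compact_support_le[OF contg g0])
        show "norm (g z) \<le> M / ?m * bump_const r" if "norm z \<le> r + 1" for z
          unfolding g_def norm_scaleR using Wm[of "x + z"] bump_taylor(1)[OF assms that] M0 m
          by (intro mult_mono) auto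
      qed
      then show ?thesis by (simp add: C_def mult_ac)
    qed
    have blq: "bounded_linear (\<lambda>X :: real^'n^'n. h \<bullet> (X *v h))" for h
      unfolding linear_conv_bounded_linear[symmetric]
      by (rule linearI) (simp_all add: matrix_vector_mult_add_rdistrib inner_add_right scaleR_matrix_vector_assoc[symmetric])
    then have XH: "h \<bullet> (X *v h) = (\<integral>z. h \<bullet> (H z *v h) \<partial>lborel)"
      and intXH: "integrable lborel (\<lambda>z. h \<bullet> (H z *v h))" for h
      unfolding X_def using integral_bounded_linear[OF blq intH] integrable_bounded_linear[OF blq intH] by auto
    have Hq: "h \<bullet> (H z *v h) = W (x + z) / ?m * (h \<bullet> (bump_hess r z *v h))" for h z
      by (simp add: H_def scaleR_matrix_vector_assoc[symmetric])
    have X3: "\<bar>h \<bullet> (X *v h)\<bar> \<le> C * M * (norm h)\<^sup>2" for h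
    proof -
      have "norm (h \<bullet> (X *v h)) \<le> (M / ?m * (bump_const r * (norm h)\<^sup>2)) * ?vol"
        unfolding XH
      proof (rule norm_integral_compact_support_le)
        show "continuous_on UNIV (\<lambda>z. h \<bullet> (H z *v h))"
          by (rule bounded_linear.continuous_on[OF blq contH])
        show "norm (h \<bullet> (H z *v h)) \<le> M / ?m * (bump_const r * (norm h)\<^sup>2)" if "norm z \<le> r + 1" for z
          unfolding Hq real_norm_def abs_mult
          using Wm[of "x + z"] bump_taylor(2)[OF assms that] M0 m by (intro mult_mono) auto
      qed (simp add: H0)
      then show ?thesis by (simp add: C_def mult_ac)
    qed
    have X4: "\<bar>moll r W (x + h) - moll r W x - p \<bullet> h - h \<bullet> (X *v h) / 2\<bar> \<le> C * M * norm h ^ 3"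
      if h: "norm h \<le> 1" for h
    proof -
      have contb: "continuous_on UNIV (\<lambda>z. bump r (z - h) * W (x + z))"
        by (intro continuous_intros)
      have contb0: "continuous_on UNIV (\<lambda>z. bump r z * W (x + z))"
        by (intro continuous_intros)
      have b0: "bump r (z - h) = 0" if "r + 1 < norm z" for z
      proof (rule bump_eq_0)
        show "r \<le> norm (z - h)" using norm_triangle_ineq2[of z h] that h by linarith
      qed (use assms in simp)
      have "(\<integral>z. bump r (z - h) * W (x + z) \<partial>lborel) = (\<integral>z. bump r (h + z - h) * W (x + (h + z)) \<partial>lborel)"
        by (rule lborel_integral_shift[symmetric]) (rule borel_measurable_continuous_onI[OF contb])
      then have m1: "moll r W (x + h) = (\<integral>z. bump r (z - h) * W (x + z) / ?m \<partial>lborel)"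
        by (simp add: moll_def add.assoc)
      have m2: "moll r W x = (\<integral>z. bump r z * W (x + z) / ?m \<partial>lborel)" by (simp add: moll_def)
      have i1: "integrable lborel (\<lambda>z. bump r (z - h) * W (x + z) / ?m)"
      proof (rule integrable_compact_support)
        show "continuous_on UNIV (\<lambda>z. bump r (z - h) * W (x + z) / ?m)"
          using m by (intro continuous_on_divide continuous_on_const contb) auto
        show "bump r (z - h) * W (x + z) / ?m = 0" if "r + 1 < norm z" for z
          using b0[OF that] by simp
      qed
      have i2: "integrable lborel (\<lambda>z. bump r z * W (x + z) / ?m)"
        using integrable_bump_mult[OF W, of r x] assms by simp
      define Rem where "Rem = (\<lambda>z. bump r (z - h) * W (x + z) / ?m - bump r z * W (x + z) / ?m
         - g z \<bullet> h - h \<bullet> (H z *v h) / 2)"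
      have "moll r W (x + h) - moll r W x - p \<bullet> h - h \<bullet> (X *v h) / 2 = (\<integral>z. Rem z \<partial>lborel)"
      proof -
        have pg: "p \<bullet> h = (\<integral>z. g z \<bullet> h \<partial>lborel)" and intgh: "integrable lborel (\<lambda>z. g z \<bullet> h)"
          unfolding p_def using intg by simp_all
        have intH2: "integrable lborel (\<lambda>z. h \<bullet> (H z *v h) / 2)"
          and XH2: "h \<bullet> (X *v h) / 2 = (\<integral>z. h \<bullet> (H z *v h) / 2 \<partial>lborel)"
          using intXH[of h] by (simp_all add: XH)
        have "has_bochner_integral lborel Rem
          ((\<integral>z. bump r (z - h) * W (x + z) / ?m \<partial>lborel) - (\<integral>z. bump r z * W (x + z) / ?m \<partial>lborel)
            - (\<integral>z. g z \<bullet> h \<partial>lborel) - (\<integral>z. h \<bullet> (H z *v h) / 2 \<partial>lborel))"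
          unfolding Rem_def
          by (intro has_bochner_integral_diff has_bochner_integral_integrable i1 i2 intgh intH2)
        then show ?thesis
          unfolding m1 m2 XH2 pg by (rule has_bochner_integral_integral_eq[symmetric])
      qed
      moreover have "norm (\<integral>z. Rem z \<partial>lborel) \<le> (M / ?m * (bump_const r * norm h ^ 3)) * ?vol"
      proof (rule norm_integral_compact_support_le)
        show "continuous_on UNIV Rem"
          unfolding Rem_def using m
          by (intro continuous_on_diff continuous_on_divide continuous_on_const continuous_on_inner
              contg contb contb0 bounded_linear.continuous_on[OF blq contH]) auto
        show "Rem z = 0" if "r + 1 < norm z" for z
          using that b0 g0 H0 bump_eq_0[of r z] assms by (simp add: Rem_def)
        show "norm (Rem z) \<le> M / ?m * (bump_const r * norm h ^ 3)" if "norm z \<le> r + 1" for z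
        proof -
          have "Rem z = W (x + z) / ?m *
             (bump r (z - h) - bump r z - bump_grad r z \<bullet> h - h \<bullet> (bump_hess r z *v h) / 2)"
          proof -
            have eq: "b1 * w - b2 * w - w * a - w * q / 2 = w * (b1 - b2 - a - q / 2)" for b1 b2 w a q :: real
              by (simp add: algebra_simps)
            show ?thesis
              unfolding Rem_def Hq g_def inner_scaleR_left times_divide_eq_right[of "bump r _", symmetric] by (rule eq)
          qed
          then have "norm (Rem z) = \<bar>W (x + z) / ?m\<bar> *
             \<bar>bump r (z - h) - bump r z - bump_grad r z \<bullet> h - h \<bullet> (bump_hess r z *v h) / 2\<bar>"
            by (simp only: real_norm_def abs_mult)
          also have "\<dots> \<le> M / ?m * (bump_const r * norm h ^ 3)"
            using M0 m by (intro mult_mono Wm bump_taylor(3)[OF assms that h]) auto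
          finally show ?thesis .
        qed
      qed
      moreover have "(M / ?m * (bump_const r * norm h ^ 3)) * ?vol = C * M * norm h ^ 3" by (simp add: C_def)
      ultimately show ?thesis by (simp only: real_norm_def)
    qed
    from X1 X2 X3 X4 have "taylor2 (C * M) (moll r W) x p X" by (simp add: taylor2_def)
    then show ?thesis by blast
  qed
  show ?thesis
  proof (rule exI[of _ C], intro conjI allI impI)
    fix W :: "real^'n \<Rightarrow> real" and M x
    assume "continuous_on UNIV W" "\<forall>y. \<bar>W y\<bar> \<le> M"
    then show "\<exists>p X. taylor2 (C * M) (moll r W) x p X" by (intro ex) simp_all
  qed (rule C)
qed

section \<open>Viscosity inequalities with constant coefficients\<close>

text \<open>A degenerate elliptic operator with constant coefficients, its second-order part split
  into second derivatives along the directions \<open>d i\<close>; this splitting is what a random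
  walk can imitate.\<close>

definition generator :: "('n \<Rightarrow> real^'n) \<Rightarrow> real^'n \<Rightarrow> real^'n \<Rightarrow> real^'n^'n \<Rightarrow> real" where
  "generator d \<beta> p X = (\<Sum>i\<in>UNIV. d i \<bullet> (X *v d i)) + \<beta> \<bullet> p"

text \<open>One step of duration \<rho>: a drift \<open>\<rho> *\<^sub>R \<beta>\<close> and a jump
  along one of the vectors \<open>d i\<close> or its opposite, all equally likely. The jump is
  scaled so that the mean increment of a smooth function is \<rho> times the generator to leading
  order.\<close>

definition walk :: "('n \<Rightarrow> real^'n) \<Rightarrow> real^'n \<Rightarrow> real \<Rightarrow> (real^'n \<Rightarrow> real) \<Rightarrow> real^'n \<Rightarrow> real" where
  "walk d \<beta> \<rho> f x = (\<Sum>i\<in>UNIV. 1 / (2 * real CARD('n)) *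
     (f (x + (\<rho> *\<^sub>R \<beta> + sqrt (2 * real CARD('n) * \<rho>) *\<^sub>R d i)) +
      f (x + (\<rho> *\<^sub>R \<beta> - sqrt (2 * real CARD('n) * \<rho>) *\<^sub>R d i))))"

lemma generator_bound:
  assumes "taylor2 C f x p X"
  shows "\<bar>generator d \<beta> p X\<bar> \<le> C * ((\<Sum>i\<in>UNIV. (norm (d i))\<^sup>2) + norm \<beta>)"
proof -
  have "\<bar>\<Sum>i\<in>UNIV. d i \<bullet> (X *v d i)\<bar> \<le> (\<Sum>i\<in>UNIV. C * (norm (d i))\<^sup>2)"
    using assms by (intro order_trans[OF sum_abs] sum_mono) (simp add: taylor2_def)
  moreover have "\<bar>\<beta> \<bullet> p\<bar> \<le> norm \<beta> * C"
    by (rule order_trans[OF Cauchy_Schwarz_ineq2]) (use assms in \<open>auto simp: taylor2_def intro: mult_left_mono\<close>)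
  ultimately show ?thesis
    unfolding generator_def by (simp add: sum_distrib_left distrib_left mult.commute[of C "norm \<beta>"])
qed

lemma generator_add_scaleR_mat:
  "generator d \<beta> (p + c *\<^sub>R q) (X + c *\<^sub>R mat 1) = generator d \<beta> p X + c * ((\<Sum>i\<in>UNIV. (norm (d i))\<^sup>2) + \<beta> \<bullet> q)"
  by (simp add: generator_def matrix_vector_mult_add_rdistrib scaleR_matrix_vector_assoc[symmetric]
      inner_add_right sum.distrib power2_norm_eq_inner distrib_left flip: sum_distrib_left)

lemma walk_diff: "walk d \<beta> \<rho> (\<lambda>x. f x - g x) x = walk d \<beta> \<rho> f x - walk d \<beta> \<rho> g x"
proof -
  have eq: "c * ((a - a') + (b - b')) = c * (a + b) - c * (a' + b')" for a a' b b' c :: real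
    by (simp add: algebra_simps)
  show ?thesis
    unfolding walk_def eq sum_subtractf ..
qed

lemma walk_abs_le:
  fixes d :: "'n \<Rightarrow> real^'n"
  assumes "\<And>y. \<bar>f y\<bar> \<le> S"
  shows "\<bar>walk d \<beta> \<rho> f x\<bar> \<le> S"
proof -
  let ?N = "real CARD('n)"
  have "\<bar>walk d \<beta> \<rho> f x\<bar> \<le> (\<Sum>i\<in>(UNIV::'n set). 1 / (2 * ?N) * (S + S))"
    unfolding walk_def
  proof (intro order_trans[OF sum_abs] sum_mono)
    have "\<bar>f a + f b\<bar> \<le> S + S" for a b
      using assms[of a] assms[of b] by linarith
    then show "\<bar>1 / (2 * ?N) * (f a + f b)\<bar> \<le> 1 / (2 * ?N) * (S + S)" for a b
      unfolding abs_mult by (intro mult_mono) auto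
  qed
  also have "\<dots> = S"
  proof -
    have "?N * (1 / (2 * ?N) * (S + S)) = S" using zero_less_card_finite[where ?'a = 'n] by (simp add: field_simps)
    then show ?thesis by (simp only: sum_constant)
  qed
  finally show ?thesis .
qed

lemma walk_diff_le:
  assumes "\<And>y. \<bar>f y - g y\<bar> \<le> S"
  shows "\<bar>walk d \<beta> \<rho> f x - walk d \<beta> \<rho> g x\<bar> \<le> S"
  using walk_abs_le[of "\<lambda>y. f y - g y", OF assms] unfolding walk_diff .

lemma walk_translate: "walk d \<beta> \<rho> (\<lambda>x. f (x + v)) x = walk d \<beta> \<rho> f (x + v)"
  by (simp add: walk_def ac_simps)

lemma continuous_on_walk:
  assumes "continuous_on UNIV f" shows "continuous_on UNIV (walk d \<beta> \<rho> f)"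
  unfolding walk_def by (intro continuous_intros continuous_on_compose2[OF assms]) auto

lemma moll_walk:
  fixes f :: "real^'n \<Rightarrow> real"
  assumes f: "continuous_on UNIV f" and "0 \<le> r"
  shows "moll r (walk d \<beta> \<rho> f) x = walk d \<beta> \<rho> (moll r f) x"
proof -
  have c: "continuous_on UNIV (\<lambda>x. f (x + v))" for v
    by (intro continuous_on_compose2[OF f] continuous_intros) auto
  have "walk d \<beta> \<rho> f = (\<lambda>x. \<Sum>i\<in>UNIV. 1 / (2 * real CARD('n)) *
     (f (x + (\<rho> *\<^sub>R \<beta> + sqrt (2 * real CARD('n) * \<rho>) *\<^sub>R d i)) +
      f (x + (\<rho> *\<^sub>R \<beta> - sqrt (2 * real CARD('n) * \<rho>) *\<^sub>R d i))))"
    by (simp add: walk_def fun_eq_iff)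
  moreover have "moll r (\<lambda>x. a * (f (x + u) + f (x + v))) x = a * (moll r f (x + u) + moll r f (x + v))" for a u v
    by (simp only: moll_cmult moll_add[OF c c \<open>0 \<le> r\<close>] moll_translate)
  ultimately show ?thesis
    by (simp only: walk_def moll_sum[OF finite continuous_on_mult[OF continuous_on_const continuous_on_add[OF c c]] \<open>0 \<le> r\<close>])
qed

text \<open>Opposite jumps cancel the odd terms, and steps of length of order
  \<open>sqrt \<rho>\<close> make the cubic remainder of order \<open>\<rho> * sqrt \<rho>\<close>.
  That \<open>K\<close> and \<open>\<rho>0\<close> depend on \<open>d\<close> and \<beta> only
  allows \<rho> to be chosen after the function.\<close>

lemma walk_expansion:
  fixes d :: "'n \<Rightarrow> real^'n"
  shows "\<exists>K\<ge>0. \<exists>\<rho>0>0. \<forall>C f x p X \<rho>. taylor2 C f x p X \<longrightarrow> 0 < \<rho> \<longrightarrow> \<rho> \<le> \<rho>0 \<longrightarrow>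
     \<bar>walk d \<beta> \<rho> f x - f x - \<rho> * generator d \<beta> p X\<bar> \<le> K * C * \<rho> * sqrt \<rho>"
proof -
  let ?N = "real CARD('n)"
  \<comment> \<open>Steps are at most \<open>sqrt \<rho> * B\<close> long;
    \<open>\<rho>0 = 1 / B\<^sup>2\<close> therefore keeps them in the unit ball, where
    \<open>taylor2\<close> gives information.\<close>
  define B where "B = 1 + norm \<beta> + sqrt (2 * ?N) * (\<Sum>i\<in>UNIV. norm (d i))"
  have B1: "1 \<le> B" unfolding B_def by (simp add: sum_nonneg)
  \<comment> \<open>The first summand pays for the Taylor remainders, the second for the
    second-order effect of the drift, which is no part of the generator.\<close>
  define K where "K = B ^ 3 + (norm \<beta>)\<^sup>2"
  have K0: "0 \<le> K" using B1 by (simp add: K_def)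
  define \<rho>0 where "\<rho>0 = 1 / B\<^sup>2"
  have \<rho>0: "0 < \<rho>0" using B1 by (simp add: \<rho>0_def)
  have main: "\<bar>walk d \<beta> \<rho> f x - f x - \<rho> * generator d \<beta> p X\<bar> \<le> K * C * \<rho> * sqrt \<rho>"
    if T: "taylor2 C f x p X" and \<rho>: "0 < \<rho>" "\<rho> \<le> \<rho>0" for C f x p X \<rho>
  proof -
    have C0: "0 \<le> C" using T norm_ge_zero[of p] unfolding taylor2_def by linarith
    define s where "s = sqrt \<rho>"
    have s: "0 < s" "s\<^sup>2 = \<rho>" using \<rho> by (auto simp: s_def)
    have "s \<le> sqrt (1 / B\<^sup>2)" unfolding s_def using \<rho> by (simp add: \<rho>0_def)
    also have "\<dots> = 1 / B" using B1 by (simp add: real_sqrt_divide)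
    finally have sB: "s * B \<le> 1" using B1 by (simp add: field_simps)
    have s1: "s \<le> 1" using sB B1 s mult_left_mono[of 1 B s] by linarith
    have cube: "s ^ 3 = \<rho> * s" by (simp add: s(2)[symmetric] power2_eq_square power3_eq_cube)
    define \<tau> where "\<tau> = sqrt (2 * ?N * \<rho>)"
    have \<tau>: "\<tau>\<^sup>2 = 2 * ?N * \<rho>" "\<tau> = sqrt (2 * ?N) * s"
      using \<rho> by (simp_all add: \<tau>_def s_def flip: real_sqrt_mult)
    have h: "norm (\<rho> *\<^sub>R \<beta> + t *\<^sub>R d i) \<le> s * B" if "\<bar>t\<bar> = \<tau>" for t i
    proof -
      have "norm (d i) \<le> (\<Sum>i\<in>UNIV. norm (d i))" by (rule member_le_sum) auto
      then have "\<tau> * norm (d i) \<le> sqrt (2 * ?N) * s * (\<Sum>i\<in>UNIV. norm (d i))"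
        unfolding \<tau>(2) using s(1) by (intro mult_left_mono) auto
      moreover have "\<rho> * norm \<beta> \<le> s * norm \<beta>"
        using s s1 by (intro mult_right_mono) (auto simp: power2_eq_square mult_left_le)
      moreover have "norm (\<rho> *\<^sub>R \<beta> + t *\<^sub>R d i) \<le> \<rho> * norm \<beta> + \<tau> * norm (d i)"
        by (rule order_trans[OF norm_triangle_ineq]) (use that \<rho> in simp)
      moreover have "s * B = s + s * norm \<beta> + sqrt (2 * ?N) * s * (\<Sum>i\<in>UNIV. norm (d i))"
        by (simp add: B_def algebra_simps)
      ultimately show ?thesis using s(1) by linarith
    qed
    have rem: "\<bar>f (x + h) - f x - p \<bullet> h - h \<bullet> (X *v h) / 2\<bar> \<le> C * B ^ 3 * (\<rho> * s)"
      if "norm h \<le> s * B" for h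
    proof -
      have "norm h \<le> 1" using that sB by linarith
      then have "\<bar>f (x + h) - f x - p \<bullet> h - h \<bullet> (X *v h) / 2\<bar> \<le> C * norm h ^ 3"
        using T unfolding taylor2_def by blast
      also have "\<dots> \<le> C * (s * B) ^ 3" using C0 that by (intro mult_left_mono power_mono) auto
      finally show ?thesis by (simp add: power_mult_distrib cube mult_ac)
    qed
    define T' where "T' = (\<lambda>i. f (x + (\<rho> *\<^sub>R \<beta> + \<tau> *\<^sub>R d i)) + f (x + (\<rho> *\<^sub>R \<beta> - \<tau> *\<^sub>R d i)) - 2 * f x
       - 2 * \<rho> * (\<beta> \<bullet> p) - \<rho>\<^sup>2 * (\<beta> \<bullet> (X *v \<beta>)) - 2 * ?N * \<rho> * (d i \<bullet> (X *v d i)))"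
    have T'_le: "\<bar>T' i\<bar> \<le> 2 * (C * B ^ 3 * (\<rho> * s))" for i
    proof -
      let ?u = "\<rho> *\<^sub>R \<beta> + \<tau> *\<^sub>R d i" and ?v = "\<rho> *\<^sub>R \<beta> - \<tau> *\<^sub>R d i"
      have "norm ?u \<le> s * B" using h[of \<tau> i] \<rho> by (simp add: \<tau>_def)
      moreover have "norm ?v \<le> s * B" using h[of "- \<tau>" i] \<rho> by (simp add: \<tau>_def)
      moreover have "p \<bullet> ?u + p \<bullet> ?v = 2 * \<rho> * (\<beta> \<bullet> p)"
        by (simp add: inner_add_right inner_diff_right inner_commute)
      moreover have "?u \<bullet> (X *v ?u) / 2 + ?v \<bullet> (X *v ?v) / 2 = \<rho>\<^sup>2 * (\<beta> \<bullet> (X *v \<beta>)) + \<tau>\<^sup>2 * (d i \<bullet> (X *v d i))"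
        by (simp add: matrix_vector_right_distrib matrix_vector_mult_diff_distrib matrix_vector_mult_scaleR
            inner_add_right inner_diff_right inner_add_left inner_diff_left power2_eq_square field_simps)
      ultimately show ?thesis using rem[of ?u] rem[of ?v] unfolding T'_def \<tau>(1)[symmetric] by linarith
    qed
    have a1: "sum T' UNIV = 2 * ?N * (walk d \<beta> \<rho> f x - f x - \<rho> * generator d \<beta> p X) - ?N * \<rho>\<^sup>2 * (\<beta> \<bullet> (X *v \<beta>))"
    proof -
      have w: "2 * ?N * walk d \<beta> \<rho> f x = (\<Sum>i\<in>UNIV. f (x + (\<rho> *\<^sub>R \<beta> + \<tau> *\<^sub>R d i)) + f (x + (\<rho> *\<^sub>R \<beta> - \<tau> *\<^sub>R d i)))"
        unfolding walk_def \<tau>_def sum_distrib_left[symmetric] by simp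
      have g: "2 * ?N * (\<rho> * generator d \<beta> p X) = (\<Sum>i\<in>UNIV. 2 * ?N * \<rho> * (d i \<bullet> (X *v d i))) + 2 * ?N * \<rho> * (\<beta> \<bullet> p)"
        by (simp add: generator_def sum_distrib_left algebra_simps)
      show ?thesis
        unfolding right_diff_distrib w g T'_def sum_subtractf by simp
    qed
    have a2: "\<bar>sum T' UNIV\<bar> \<le> (\<Sum>i\<in>(UNIV::'n set). 2 * (C * B ^ 3 * (\<rho> * s)))"
      by (intro order_trans[OF sum_abs] sum_mono T'_le)
    have a3: "\<bar>\<rho>\<^sup>2 * (\<beta> \<bullet> (X *v \<beta>))\<bar> \<le> \<rho> * s * (C * (norm \<beta>)\<^sup>2)"
    proof -
      have "\<bar>\<beta> \<bullet> (X *v \<beta>)\<bar> \<le> C * (norm \<beta>)\<^sup>2" using T by (simp add: taylor2_def)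
      moreover have "\<rho>\<^sup>2 \<le> \<rho> * s"
        using s s1 \<rho>(1) by (auto simp: power2_eq_square intro!: mult_left_mono mult_left_le)
      ultimately show ?thesis unfolding abs_mult using \<rho>(1) s(1) by (intro mult_mono) auto
    qed
    have "2 * ?N * \<bar>walk d \<beta> \<rho> f x - f x - \<rho> * generator d \<beta> p X\<bar>
        \<le> 2 * ?N * (C * B ^ 3 * (\<rho> * s)) + 2 * ?N * (\<rho> * s * (C * (norm \<beta>)\<^sup>2))"
    proof -
      define y where "y = 2 * ?N * (walk d \<beta> \<rho> f x - f x - \<rho> * generator d \<beta> p X)"
      have "\<bar>?N * (\<rho>\<^sup>2 * (\<beta> \<bullet> (X *v \<beta>)))\<bar> \<le> ?N * (\<rho> * s * (C * (norm \<beta>)\<^sup>2))"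
        unfolding abs_mult[of ?N] using a3 by (intro mult_mono) auto
      moreover have "0 \<le> ?N * (\<rho> * s * (C * (norm \<beta>)\<^sup>2))" using \<rho>(1) s(1) C0 by simp
      moreover have "(\<Sum>i\<in>(UNIV::'n set). 2 * (C * B ^ 3 * (\<rho> * s))) = 2 * ?N * (C * B ^ 3 * (\<rho> * s))" by simp
      moreover have "sum T' UNIV = y - ?N * (\<rho>\<^sup>2 * (\<beta> \<bullet> (X *v \<beta>)))"
        using a1 by (simp add: y_def mult.assoc)
      ultimately have "\<bar>y\<bar> \<le> 2 * ?N * (C * B ^ 3 * (\<rho> * s)) + 2 * (?N * (\<rho> * s * (C * (norm \<beta>)\<^sup>2)))"
        using a2 by linarith
      moreover have "\<bar>y\<bar> = 2 * ?N * \<bar>walk d \<beta> \<rho> f x - f x - \<rho> * generator d \<beta> p X\<bar>"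
        by (simp add: y_def abs_mult)
      ultimately show ?thesis by (simp only: mult.assoc)
    qed
    also have "\<dots> = 2 * ?N * (K * C * \<rho> * s)" by (simp add: K_def algebra_simps)
    finally show ?thesis by (simp add: s_def)
  qed
  show ?thesis
    by (rule exI[of _ K], intro conjI K0, rule exI[of _ \<rho>0], intro conjI \<rho>0 allI impI) (rule main)
qed

section \<open>Resolvents of the walk and comparison with viscosity inequalities\<close>

lemma resolvent_exists:
  fixes d :: "'n \<Rightarrow> real^'n" and w :: "real^'n \<Rightarrow> real"
  assumes w: "continuous_on UNIV w" "\<And>x. \<bar>w x\<bar> \<le> M" and "0 < \<epsilon>" "0 < \<rho>"
  obtains W where "continuous_on UNIV W" "bounded (range W)"
    "\<And>x. W x = w x + \<epsilon> / \<rho> * (walk d \<beta> \<rho> W x - W x)"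
proof -
  \<comment> \<open>The equation is an implicit Euler step. Solved for \<open>W\<close>, it is a
    fixed point equation with weight \<open>1 - c\<close> on \<open>w\<close> and \<open>c\<close>
    on the walk; the walk averages, so this is a contraction in the supremum norm.\<close>
  define c where "c = \<epsilon> / (\<epsilon> + \<rho>)"
  have c: "0 \<le> c" "c < 1" using assms(3,4) by (auto simp: c_def)
  define G where "G = (\<lambda>g x. (1 - c) * w x + c * walk d \<beta> \<rho> (apply_bcontfun g) x)"
  have G: "G g \<in> bcontfun" for g
  proof -
    obtain S where S: "\<And>x. norm (apply_bcontfun g x) \<le> S"
      using bounded_apply_bcontfun[of g] by (auto simp: bounded_iff)
    have "\<bar>G g x\<bar> \<le> (1 - c) * M + c * S" for x
    proof -
      have "\<bar>walk d \<beta> \<rho> (apply_bcontfun g) x\<bar> \<le> S"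
        using S by (intro walk_abs_le) simp
      then have "\<bar>c * walk d \<beta> \<rho> (apply_bcontfun g) x\<bar> \<le> c * S"
        unfolding abs_mult using c by (intro mult_mono) auto
      moreover have "\<bar>(1 - c) * w x\<bar> \<le> (1 - c) * M"
        unfolding abs_mult using c w(2)[of x] by (intro mult_mono) auto
      ultimately show ?thesis unfolding G_def by linarith
    qed
    then have "bounded (range (G g))" by (auto simp: bounded_iff)
    moreover have "continuous_on UNIV (G g)"
      unfolding G_def by (intro continuous_intros w continuous_on_walk) auto
    ultimately show ?thesis by (simp add: bcontfun_def)
  qed
  define F where "F = (\<lambda>g. Bcontfun (G g))"
  have F: "apply_bcontfun (F g) = G g" for g unfolding F_def using G by (rule Bcontfun_inverse)
  have "dist (F g) (F g') \<le> c * dist g g'" for g g'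
  proof (rule dist_bound)
    fix x
    have "\<bar>walk d \<beta> \<rho> (apply_bcontfun g) x - walk d \<beta> \<rho> (apply_bcontfun g') x\<bar> \<le> dist g g'"
      by (rule walk_diff_le) (metis dist_bounded dist_real_def)
    then have "c * \<bar>walk d \<beta> \<rho> (apply_bcontfun g) x - walk d \<beta> \<rho> (apply_bcontfun g') x\<bar> \<le> c * dist g g'"
      using c by (intro mult_left_mono)
    moreover have "dist (F g x) (F g' x) = \<bar>c * (walk d \<beta> \<rho> (apply_bcontfun g) x - walk d \<beta> \<rho> (apply_bcontfun g') x)\<bar>"
      unfolding F G_def dist_real_def right_diff_distrib by simp
    ultimately show "dist (F g x) (F g' x) \<le> c * dist g g'" using c by (simp add: abs_mult)
  qed
  then obtain g where g: "F g = g" using banach_fix_type[OF c, of F] by metis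
  have eq: "g x = (1 - c) * w x + c * walk d \<beta> \<rho> (apply_bcontfun g) x" for x
    using F[of g] unfolding g G_def by (rule fun_cong)
  have "g x = w x + \<epsilon> / \<rho> * (walk d \<beta> \<rho> (apply_bcontfun g) x - g x)" for x
  proof -
    have c': "(\<epsilon> + \<rho>) * c = \<epsilon>" using assms(3,4) by (simp add: c_def)
    then have c'': "(\<epsilon> + \<rho>) * (1 - c) = \<rho>" by (simp add: right_diff_distrib)
    have "(\<epsilon> + \<rho>) * g x = ((\<epsilon> + \<rho>) * (1 - c)) * w x + ((\<epsilon> + \<rho>) * c) * walk d \<beta> \<rho> (apply_bcontfun g) x"
      by (subst eq) (simp only: distrib_left mult.assoc)
    then have "(\<epsilon> + \<rho>) * g x = \<rho> * w x + \<epsilon> * walk d \<beta> \<rho> (apply_bcontfun g) x"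
      unfolding c' c'' .
    then show ?thesis using assms(4) by (simp add: field_simps)
  qed
  then show thesis by (rule that[rotated 2]) auto
qed

text \<open>The discrete maximum principle: \<open>walk\<close> is an average, so the solution
  cannot exceed the right-hand side, whatever the size of \<kappa>. Applied to differences it gives
  stability uniformly in the step of the walk.\<close>

lemma resolvent_bound:
  fixes d :: "'n \<Rightarrow> real^'n"
  assumes bdd: "bounded (range W)" and eq: "\<And>x. W x = v x + \<kappa> * (walk d \<beta> \<rho> W x - W x)"
    and "0 \<le> \<kappa>" and v: "\<And>x. \<bar>v x\<bar> \<le> e"
  shows "\<bar>W x\<bar> \<le> e"
proof -
  define S where "S = (SUP x. \<bar>W x\<bar>)"
  have "bdd_above (range (\<lambda>x. \<bar>W x\<bar>))" using bdd by (auto simp: bounded_iff bdd_above_def)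
  then have S: "\<bar>W x\<bar> \<le> S" for x unfolding S_def by (rule cSUP_upper[rotated]) simp
  have "\<bar>W x\<bar> \<le> (e + \<kappa> * S) / (1 + \<kappa>)" for x
  proof -
    have "\<bar>walk d \<beta> \<rho> W x\<bar> \<le> S" using S by (intro walk_abs_le)
    then have "\<bar>\<kappa> * walk d \<beta> \<rho> W x\<bar> \<le> \<kappa> * S"
      unfolding abs_mult using assms(3) by (intro mult_mono) auto
    moreover have "(1 + \<kappa>) * W x = v x + \<kappa> * walk d \<beta> \<rho> W x"
      using eq[of x] by (simp add: algebra_simps)
    moreover have "\<bar>(1 + \<kappa>) * W x\<bar> = (1 + \<kappa>) * \<bar>W x\<bar>" using assms(3) by (simp add: abs_mult)
    ultimately have "(1 + \<kappa>) * \<bar>W x\<bar> \<le> e + \<kappa> * S" using v[of x] by linarith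
    then show ?thesis using assms(3) by (simp add: field_simps)
  qed
  then have "S \<le> (e + \<kappa> * S) / (1 + \<kappa>)" unfolding S_def by (intro cSUP_least) auto
  then have "S \<le> e" using assms(3) by (simp add: field_simps)
  with S[of x] show ?thesis by linarith
qed

text \<open>A paraboloid \<open>q\<close> centred at \<open>x1\<close> is subtracted, so that
  \<open>w - \<phi> - q\<close> has an interior maximum over the ball or there is nothing to prove.
  There the jet of \<open>\<phi> + q\<close> touches \<open>w\<close> from above; the viscosity
  inequality bounds the generator of \<phi> from below, and the resolvent equation turns this into a
  lower bound for \<phi>. The term with \<open>R\<^sup>2\<close> is the price of
  localisation.\<close>

lemma walk_comparison:
  fixes d :: "'n \<Rightarrow> real^'n" and w \<phi> :: "real^'n \<Rightarrow> real"
  assumes w: "continuous_on UNIV w" and \<phi>: "continuous_on UNIV \<phi>"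
    and visc: "\<And>x p X C r. x \<in> U \<Longrightarrow> transpose X = X \<Longrightarrow> 0 < r \<Longrightarrow>
       (\<And>h. norm h < r \<Longrightarrow> w (x + h) \<le> jet2 (w x) p X h + C * norm h ^ 3) \<Longrightarrow>
       0 \<le> generator d \<beta> p X + \<gamma> * w x"
    and U: "cball x1 R \<subseteq> U" "0 < R"
    and jets: "\<And>x. \<exists>p X. taylor2 C \<phi> x p X"
    and gen: "\<And>x p X. taylor2 C \<phi> x p X \<Longrightarrow> \<rho> * generator d \<beta> p X - e * \<rho> \<le> walk d \<beta> \<rho> \<phi> x - \<phi> x"
    and eq: "\<And>x. \<phi> x = (1 + \<epsilon> * \<gamma>) * v x + \<epsilon> / \<rho> * (walk d \<beta> \<rho> \<phi> x - \<phi> x)"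
    and v: "\<And>x. \<bar>v x - w x\<bar> \<le> \<delta>" and \<sigma>: "\<And>x. \<bar>w x - \<phi> x\<bar> \<le> \<sigma>"
    and pos: "0 < \<epsilon>" "0 < \<rho>" "0 \<le> \<gamma>" "0 \<le> e"
  shows "w x1 - \<phi> x1 \<le> (1 + \<epsilon> * \<gamma>) * \<delta>
     + \<epsilon> * (2 * \<sigma> / R\<^sup>2 * ((\<Sum>i\<in>UNIV. (norm (d i))\<^sup>2) + norm \<beta> * R) + e)"
proof -
  define D where "D = (\<Sum>i\<in>UNIV. (norm (d i))\<^sup>2)"
  have D: "0 \<le> D" by (simp add: D_def sum_nonneg)
  have \<sigma>0: "0 \<le> \<sigma>" using \<sigma>[of 0] by linarith
  have \<delta>0: "0 \<le> \<delta>" using v[of 0] by linarith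
  \<comment> \<open>The paraboloid reaches \<sigma> on the sphere of radius \<open>R\<close>, so
    that a maximum on that sphere already gives \<open>w x1 \<le> \<phi> x1\<close>.\<close>
  define c where "c = \<sigma> / R\<^sup>2"
  have c: "0 \<le> c" using \<sigma>0 by (simp add: c_def)
  define q where "q = (\<lambda>x. c * (norm (x - x1))\<^sup>2)"
  have "continuous_on (cball x1 R) (\<lambda>x. w x - \<phi> x - q x)"
    unfolding q_def by (intro continuous_intros continuous_on_subset[OF w] continuous_on_subset[OF \<phi>]) auto
  then obtain x0 where x0: "x0 \<in> cball x1 R"
    and max: "\<And>x. x \<in> cball x1 R \<Longrightarrow> w x - \<phi> x - q x \<le> w x0 - \<phi> x0 - q x0"
    using continuous_attains_sup[of "cball x1 R" "\<lambda>x. w x - \<phi> x - q x"] U(2) by auto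
  have le: "w x1 - \<phi> x1 \<le> w x0 - \<phi> x0 - q x0" using max[of x1] U(2) by (simp add: q_def)
  have q0: "0 \<le> q x0" using c by (simp add: q_def)
  let ?rhs = "(1 + \<epsilon> * \<gamma>) * \<delta> + \<epsilon> * (2 * c * (D + norm \<beta> * R) + e)"
  have "w x1 - \<phi> x1 \<le> ?rhs"
  proof (cases "norm (x0 - x1) = R")
    case True
    then have "q x0 = \<sigma>" using U(2) by (simp add: q_def c_def)
    then have "w x1 - \<phi> x1 \<le> 0" using le \<sigma>[of x0] by linarith
    also have "0 \<le> ?rhs"
      using pos \<delta>0 D c U(2) by (intro add_nonneg_nonneg mult_nonneg_nonneg) auto
    finally show ?thesis .
  next
    case False
    then have r: "0 < R - norm (x0 - x1)" using x0 by (simp add: dist_norm norm_minus_commute)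
    obtain p X where T: "taylor2 C \<phi> x0 p X" using jets by blast
    have "0 \<le> generator d \<beta> (p + (2 * c) *\<^sub>R (x0 - x1)) (X + (2 * c) *\<^sub>R mat 1) + \<gamma> * w x0"
    proof (rule visc)
      show "x0 \<in> U" using x0 U by blast
      show "transpose (X + (2 * c) *\<^sub>R mat 1) = X + (2 * c) *\<^sub>R mat 1"
        using T by (auto simp: taylor2_def transpose_def vec_eq_iff mat_def)
      show "0 < min 1 (R - norm (x0 - x1))" using r by simp
      fix h :: "real^'n" assume h: "norm h < min 1 (R - norm (x0 - x1))"
      have "x0 + h \<in> cball x1 R"
        using norm_triangle_ineq[of "x0 - x1" h] h by (simp add: dist_norm norm_minus_commute algebra_simps)
      from max[OF this] have "w (x0 + h) \<le> w x0 + (\<phi> (x0 + h) - \<phi> x0) + (q (x0 + h) - q x0)" by linarith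
      moreover have "\<phi> (x0 + h) - \<phi> x0 \<le> p \<bullet> h + h \<bullet> (X *v h) / 2 + C * norm h ^ 3"
        using T h unfolding taylor2_def by (smt (verit))
      moreover have "q (x0 + h) - q x0 = (2 * c) * ((x0 - x1) \<bullet> h) + c * (norm h)\<^sup>2"
      proof -
        have "(norm (x0 + h - x1))\<^sup>2 = (norm (x0 - x1))\<^sup>2 + 2 * ((x0 - x1) \<bullet> h) + (norm h)\<^sup>2"
          by (simp add: power2_norm_eq_inner inner_add_left inner_add_right inner_diff_left inner_diff_right inner_commute)
        then show ?thesis unfolding q_def by (simp only: distrib_left)
      qed
      moreover have "h \<bullet> ((X + (2 * c) *\<^sub>R mat 1) *v h) / 2 = h \<bullet> (X *v h) / 2 + c * (norm h)\<^sup>2"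
        by (simp add: matrix_vector_mult_add_rdistrib scaleR_matrix_vector_assoc[symmetric] inner_add_right
            power2_norm_eq_inner add_divide_distrib)
      moreover have "(p + (2 * c) *\<^sub>R (x0 - x1)) \<bullet> h = p \<bullet> h + (2 * c) * ((x0 - x1) \<bullet> h)"
        by (simp add: inner_add_left)
      ultimately show "w (x0 + h) \<le> w x0 + (p + (2 * c) *\<^sub>R (x0 - x1)) \<bullet> h
          + h \<bullet> ((X + (2 * c) *\<^sub>R mat 1) *v h) / 2 + C * norm h ^ 3"
        by linarith
    qed
    then have "0 \<le> generator d \<beta> p X + 2 * c * (D + \<beta> \<bullet> (x0 - x1)) + \<gamma> * w x0"
      unfolding generator_add_scaleR_mat D_def .
    moreover have "2 * c * (D + \<beta> \<bullet> (x0 - x1)) \<le> 2 * c * (D + norm \<beta> * R)"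
    proof -
      have "\<beta> \<bullet> (x0 - x1) \<le> norm \<beta> * norm (x0 - x1)" by (rule norm_cauchy_schwarz)
      also have "\<dots> \<le> norm \<beta> * R" using r by (intro mult_left_mono) auto
      finally show ?thesis using c by (intro mult_left_mono) auto
    qed
    ultimately have g: "- (2 * c * (D + norm \<beta> * R)) - \<gamma> * w x0 \<le> generator d \<beta> p X" by linarith
    have "generator d \<beta> p X - e \<le> (walk d \<beta> \<rho> \<phi> x0 - \<phi> x0) / \<rho>"
      using gen[OF T] pos(2) by (simp add: field_simps)
    with g have "- (2 * c * (D + norm \<beta> * R)) - \<gamma> * w x0 - e \<le> (walk d \<beta> \<rho> \<phi> x0 - \<phi> x0) / \<rho>" by linarith
    then have "\<epsilon> * (- (2 * c * (D + norm \<beta> * R)) - \<gamma> * w x0 - e) \<le> \<epsilon> * ((walk d \<beta> \<rho> \<phi> x0 - \<phi> x0) / \<rho>)"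
      using pos(1) by (intro mult_left_mono) auto
    then have "(1 + \<epsilon> * \<gamma>) * v x0 + \<epsilon> * (- (2 * c * (D + norm \<beta> * R)) - \<gamma> * w x0 - e) \<le> \<phi> x0"
      using eq[of x0] by simp
    \<comment> \<open>The factor \<open>1 + \<epsilon> * \<gamma>\<close> in the resolvent equation
      is there to cancel the zeroth-order term \<open>\<gamma> * w x0\<close> of the viscosity
      inequality.\<close>
    moreover have "(1 + \<epsilon> * \<gamma>) * (w x0 - \<delta>) \<le> (1 + \<epsilon> * \<gamma>) * v x0"
      using v[of x0] pos by (intro mult_left_mono) auto
    ultimately have "w x0 - \<phi> x0 \<le> ?rhs" by (simp add: algebra_simps)
    with le q0 show ?thesis by linarith
  qed
  then show ?thesis by (simp add: c_def D_def)
qed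

lemma taylor2_isCont:
  assumes "taylor2 C f x p X" shows "isCont f x"
proof -
  have "0 \<le> C" using assms norm_ge_zero[of p] unfolding taylor2_def by linarith
  have "(f \<longlongrightarrow> f x) (at x)"
  proof (rule Lim_null_comparison[THEN LIM_zero_cancel])
    have "\<forall>\<^sub>F y in at x. norm (y - x) < 1"
      unfolding eventually_at by (intro exI[of _ 1]) (simp add: dist_norm)
    then show "\<forall>\<^sub>F y in at x. norm (f y - f x) \<le> norm p * norm (y - x) + C * (norm (y - x))\<^sup>2 / 2 + C * norm (y - x) ^ 3"
    proof eventually_elim
      case (elim y)
      let ?h = "y - x"
      have "norm ?h \<le> 1" using elim by simp
      then have "\<bar>f (x + ?h) - f x - p \<bullet> ?h - ?h \<bullet> (X *v ?h) / 2\<bar> \<le> C * norm ?h ^ 3"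
        "\<bar>?h \<bullet> (X *v ?h)\<bar> \<le> C * (norm ?h)\<^sup>2"
        using assms unfolding taylor2_def by blast+
      moreover have "\<bar>p \<bullet> ?h\<bar> \<le> norm p * norm ?h" by (rule Cauchy_Schwarz_ineq2)
      moreover have "f (x + ?h) = f y" by simp
      ultimately show ?case unfolding real_norm_def by linarith
    qed
    show "((\<lambda>y. norm p * norm (y - x) + C * (norm (y - x))\<^sup>2 / 2 + C * norm (y - x) ^ 3) \<longlongrightarrow> 0) (at x)"
      by (auto intro!: tendsto_eq_intros)
  qed
  then show ?thesis by (simp add: isCont_def)
qed

lemma continuous_on_moll:
  fixes W :: "real^'n \<Rightarrow> real"
  assumes "continuous_on UNIV W" "0 < r" "\<And>x. \<bar>W x\<bar> \<le> M"
  shows "continuous_on UNIV (moll r W)"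
proof (rule continuous_at_imp_continuous_on, rule ballI)
  fix x
  obtain C where "\<exists>p X. taylor2 (C * M) (moll r W) x p X"
    using moll_taylor2[OF assms(2), where ?'n = 'n] assms(1,3) by blast
  then show "isCont (moll r W) x" using taylor2_isCont by blast
qed

text \<open>The resolvent of a random walk approximating the operator is applied to \<open>w\<close>. Mollified at
  a scale \<open>r\<close> much finer than the walk, it can be compared with \<open>w\<close> pointwise by the
  viscosity inequality; the result is then averaged against the kernel of scale \<open>r0\<close>.
  The parameters are chosen in the order \<open>t\<close>, \<open>\<sigma>\<close>, \<open>\<epsilon>\<close>, \<open>r\<close>, \<open>\<rho>\<close>.\<close>

lemma viscosity_moll:
  fixes d :: "'n \<Rightarrow> real^'n" and w :: "real^'n \<Rightarrow> real"
  assumes unif: "uniformly_continuous_on UNIV w" and M: "\<And>x. \<bar>w x\<bar> \<le> M" and \<gamma>: "0 \<le> \<gamma>"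
    and visc: "\<And>x p X C r. x \<in> U \<Longrightarrow> transpose X = X \<Longrightarrow> 0 < r \<Longrightarrow>
       (\<And>h. norm h < r \<Longrightarrow> w (x + h) \<le> jet2 (w x) p X h + C * norm h ^ 3) \<Longrightarrow>
       0 \<le> generator d \<beta> p X + \<gamma> * w x"
    and r0: "0 < r0" and R: "0 < R" and U: "cball x1 (r0 + R) \<subseteq> U"
    and T: "taylor2 C (moll r0 w) x1 p X"
  shows "0 \<le> generator d \<beta> p X + \<gamma> * moll r0 w x1"
proof (rule field_le_epsilon)
  fix \<eta> :: real assume \<eta>: "0 < \<eta>"
  \<comment> \<open>Four errors \<theta> arise for the mollified resolvent and two more on returning
    to the generator at the jet of \<open>moll r0 w\<close>.\<close>
  define \<theta> where "\<theta> = \<eta> / 6"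
  have \<theta>: "0 < \<theta>" using \<eta> by (simp add: \<theta>_def)
  have w: "continuous_on UNIV w" using unif by (rule uniformly_continuous_imp_continuous)
  have M0: "0 \<le> M" using M[of 0] by linarith
  have modulus: "\<exists>r>0. \<forall>z. norm z \<le> r \<longrightarrow> (\<forall>x. \<bar>w (x + z) - w x\<bar> \<le> e)" if "0 < e" for e
  proof -
    obtain s where s: "0 < s" "\<And>x y. dist y x < s \<Longrightarrow> dist (w y) (w x) < e"
      using unif \<open>0 < e\<close> unfolding uniformly_continuous_on_def by (metis UNIV_I)
    have "\<bar>w (x + z) - w x\<bar> \<le> e" if "norm z \<le> s / 2" for x z
      using s(2)[of "x + z" x] that s(1) by (simp add: dist_norm)
    then show ?thesis using s(1) by (intro exI[of _ "s / 2"]) auto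
  qed
  obtain K \<rho>0 where K: "0 \<le> K" and \<rho>0: "0 < \<rho>0"
    and walk: "\<And>C f x p X \<rho>. taylor2 C f x p X \<Longrightarrow> 0 < \<rho> \<Longrightarrow> \<rho> \<le> \<rho>0 \<Longrightarrow>
      \<bar>walk d \<beta> \<rho> f x - f x - \<rho> * generator d \<beta> p X\<bar> \<le> K * C * \<rho> * sqrt \<rho>"
    using walk_expansion[of d \<beta>] by blast
  have small: "\<exists>t>0. t \<le> \<rho>0 \<and> (\<forall>s. 0 < s \<longrightarrow> s \<le> t \<longrightarrow> a * sqrt s \<le> b)" if "0 \<le> a" "0 < b" for a b
  proof -
    define t where "t = min \<rho>0 ((b / (a + 1))\<^sup>2)"
    have "a * sqrt s \<le> b" if "0 < s" "s \<le> t" for s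
    proof -
      have "sqrt s \<le> sqrt ((b / (a + 1))\<^sup>2)" using that by (intro real_sqrt_le_mono) (simp add: t_def)
      then have "sqrt s \<le> b / (a + 1)" using \<open>0 \<le> a\<close> \<open>0 < b\<close> by simp
      then have "(a + 1) * sqrt s \<le> b" using \<open>0 \<le> a\<close> by (simp add: field_simps)
      moreover have "0 < sqrt s" using that(1) by simp
      ultimately show ?thesis unfolding distrib_right by linarith
    qed
    moreover have "0 < t" "t \<le> \<rho>0" using \<rho>0 that by (auto simp: t_def)
    ultimately show ?thesis by blast
  qed
  define D where "D = (\<Sum>i\<in>UNIV. (norm (d i))\<^sup>2)"
  have D: "0 \<le> D" by (simp add: D_def sum_nonneg)
  obtain C0 where C0: "0 \<le> C0" and C0': "\<And>(W :: real^'n \<Rightarrow> real) M x. continuous_on UNIV W \<Longrightarrow> (\<And>y. \<bar>W y\<bar> \<le> M) \<Longrightarrow>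
       \<exists>p X. taylor2 (C0 * M) (moll r0 W) x p X"
    using moll_taylor2[OF r0, where ?'n = 'n] by blast
  have Cpos: "0 \<le> C" using T norm_ge_zero[of p] unfolding taylor2_def by linarith
  define C1 where "C1 = C + C0 * (2 * M)"
  have C1: "0 \<le> C1" using Cpos C0 M0 by (simp add: C1_def)
  obtain t where t: "0 < t" "t \<le> \<rho>0" "\<And>s. 0 < s \<Longrightarrow> s \<le> t \<Longrightarrow> (K * C1) * sqrt s \<le> \<theta>"
    using small[of "K * C1" \<theta>] K C1 \<theta> by auto
  \<comment> \<open>Bounds the distance between \<open>w\<close> and the mollified resolvent. The
    first entry makes it small against the step \<open>t\<close>, through which generators are
    compared at the end; the second makes the cost of localisation at most \<theta>.\<close>
  define \<sigma> where "\<sigma> = \<theta> * min (t / 2) (R\<^sup>2 / (2 * (D + norm \<beta> * R + 1)))"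
  have DR: "0 < D + norm \<beta> * R + 1" using D R by (simp add: add_nonneg_pos)
  have \<sigma>: "0 < \<sigma>" using \<theta> t(1) R DR by (simp add: \<sigma>_def)
  have \<sigma>t: "2 * \<sigma> / t \<le> \<theta>"
  proof -
    have "\<sigma> \<le> \<theta> * (t / 2)" unfolding \<sigma>_def using \<theta> by (intro mult_left_mono min.cobounded1) simp
    then show ?thesis using t(1) by (simp add: field_simps)
  qed
  have \<sigma>R: "2 * \<sigma> / R\<^sup>2 * (D + norm \<beta> * R) \<le> \<theta>"
  proof -
    have "\<sigma> \<le> \<theta> * (R\<^sup>2 / (2 * (D + norm \<beta> * R + 1)))" unfolding \<sigma>_def using \<theta> by (intro mult_left_mono min.cobounded2) simp
    then have "2 * \<sigma> / R\<^sup>2 * (D + norm \<beta> * R + 1) \<le> \<theta>" using R DR by (simp add: field_simps)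
    moreover have "0 \<le> 2 * \<sigma> / R\<^sup>2" using \<sigma> by simp
    ultimately show ?thesis by (simp add: distrib_left)
  qed
  obtain ra where ra: "0 < ra" "\<And>z x. norm z \<le> ra \<Longrightarrow> \<bar>w (x + z) - w x\<bar> \<le> \<sigma> / 8"
    using modulus[of "\<sigma> / 8"] \<sigma> by auto
  \<comment> \<open>A smooth stand-in for \<open>w\<close>, fixed before the walk: its increments
    are of order \<rho>, so the resolvent stays near it, hence near \<open>w\<close>, uniformly in
    \<rho>.\<close>
  define va where "va = moll ra w"
  have va: "\<bar>va x - w x\<bar> \<le> \<sigma> / 8" for x
    unfolding va_def using ra by (intro moll_close[OF w]) auto
  obtain Ca where Ca: "0 \<le> Ca" "\<And>x. \<exists>p X. taylor2 Ca va x p X"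
  proof -
    obtain C' where "0 \<le> C'" "\<And>x. \<exists>p X. taylor2 (C' * M) va x p X"
      using moll_taylor2[OF ra(1), where ?'n = 'n] w M unfolding va_def by blast
    then show thesis using that[of "C' * M"] M0 by simp
  qed
  define G where "G = Ca * (D + norm \<beta>) + K * Ca * sqrt \<rho>0"
  have G0: "0 \<le> G" using Ca K D \<rho>0 by (simp add: G_def)
  have G: "\<bar>walk d \<beta> \<rho> va x - va x\<bar> \<le> \<rho> * G" if "0 < \<rho>" "\<rho> \<le> \<rho>0" for \<rho> x
  proof -
    obtain p X where J: "taylor2 Ca va x p X" using Ca(2) by blast
    have "\<rho> * \<bar>generator d \<beta> p X\<bar> \<le> \<rho> * (Ca * (D + norm \<beta>))"
      using generator_bound[OF J, of d \<beta>] that(1) by (simp add: D_def)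
    moreover have "\<bar>\<rho> * generator d \<beta> p X\<bar> = \<rho> * \<bar>generator d \<beta> p X\<bar>" using that(1) by (simp add: abs_mult)
    moreover have "K * Ca * \<rho> * sqrt \<rho> \<le> K * Ca * \<rho> * sqrt \<rho>0"
      using that K Ca by (intro mult_left_mono) auto
    moreover have "\<rho> * G = \<rho> * (Ca * (D + norm \<beta>)) + K * Ca * \<rho> * sqrt \<rho>0"
      by (simp add: G_def algebra_simps)
    ultimately show ?thesis using walk[OF J that] by linarith
  qed
  define \<epsilon> where "\<epsilon> = min (1 / (\<gamma> + 1)) (\<sigma> / (4 * (\<gamma> * M + G + 1)))"
  have GM: "0 < \<gamma> * M + G + 1" using \<gamma> M0 G0 by (simp add: add_nonneg_pos)
  have \<epsilon>: "0 < \<epsilon>" using \<gamma> \<sigma> GM by (simp add: \<epsilon>_def)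
  have \<epsilon>\<gamma>: "\<epsilon> * \<gamma> \<le> 1"
  proof -
    have "\<epsilon> * \<gamma> \<le> 1 / (\<gamma> + 1) * \<gamma>" unfolding \<epsilon>_def using \<gamma> by (intro mult_right_mono min.cobounded1)
    also have "\<dots> \<le> 1" using \<gamma> by simp
    finally show ?thesis .
  qed
  have \<epsilon>G: "\<epsilon> * (\<gamma> * M + G) \<le> \<sigma> / 4"
  proof -
    have "\<epsilon> * (\<gamma> * M + G) \<le> \<epsilon> * (\<gamma> * M + G + 1)" using \<epsilon> by (intro mult_left_mono) auto
    also have "\<dots> \<le> \<sigma> / (4 * (\<gamma> * M + G + 1)) * (\<gamma> * M + G + 1)"
      unfolding \<epsilon>_def using GM by (intro mult_right_mono min.cobounded2) simp
    also have "\<dots> = \<sigma> / 4"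
    proof -
      have "\<sigma> / (4 * a) * a = \<sigma> / 4" if "0 < a" for a using that by simp
      then show ?thesis using GM .
    qed
    finally show ?thesis .
  qed
  \<comment> \<open>The mollification at scale \<open>r\<close> costs up to
    \<open>4 * \<delta>\<close>, and all errors have to be small against \<epsilon>, by which the
    final inequality is divided.\<close>
  define \<delta> where "\<delta> = min (\<sigma> / 8) (\<epsilon> * \<theta> / 4)"
  have \<delta>: "0 < \<delta>" "\<delta> \<le> \<sigma> / 8" "4 * \<delta> \<le> \<epsilon> * \<theta>" using \<sigma> \<epsilon> \<theta> by (auto simp: \<delta>_def)
  obtain r where r: "0 < r" "\<And>z x. norm z \<le> r \<Longrightarrow> \<bar>w (x + z) - w x\<bar> \<le> \<delta>"
    using modulus[OF \<delta>(1)] by auto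
  obtain Cr where Cr: "0 \<le> Cr" "\<And>(W :: real^'n \<Rightarrow> real) M x. continuous_on UNIV W \<Longrightarrow> (\<And>y. \<bar>W y\<bar> \<le> M) \<Longrightarrow>
       \<exists>p X. taylor2 (Cr * M) (moll r W) x p X"
    using moll_taylor2[OF r(1), where ?'n = 'n] by blast
  obtain \<rho>1 where \<rho>1: "0 < \<rho>1" "\<rho>1 \<le> \<rho>0" "\<And>s. 0 < s \<Longrightarrow> s \<le> \<rho>1 \<Longrightarrow> (K * (Cr * (2 * M))) * sqrt s \<le> \<theta>"
    using small[of "K * (Cr * (2 * M))" \<theta>] K Cr(1) M0 \<theta> by auto
  \<comment> \<open>Chosen last, as the constant \<open>Cr\<close> of the kernel of scale
    \<open>r\<close> enters the expansion of the walk.\<close>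
  define \<rho> where "\<rho> = min \<rho>1 t"
  have \<rho>: "0 < \<rho>" "\<rho> \<le> \<rho>0" "\<rho> \<le> \<rho>1" "\<rho> \<le> t" using \<rho>1 t by (auto simp: \<rho>_def)
  have \<kappa>: "0 \<le> \<epsilon> / \<rho>" using \<epsilon> \<rho>(1) by simp
  define k where "k = 1 + \<epsilon> * \<gamma>"
  have k: "1 \<le> k" "k \<le> 2" using \<epsilon> \<gamma> \<epsilon>\<gamma> by (auto simp: k_def)
  have kw: "\<bar>k * a\<bar> \<le> 2 * b" if "\<bar>a\<bar> \<le> b" for a b
    unfolding abs_mult using k that by (intro mult_mono) auto
  obtain W where W: "continuous_on UNIV W" "bounded (range W)"
    "\<And>x. W x = k * w x + \<epsilon> / \<rho> * (walk d \<beta> \<rho> W x - W x)"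
    using resolvent_exists[of "\<lambda>x. k * w x" "2 * M" \<epsilon> \<rho> d \<beta>] continuous_on_mult[OF continuous_on_const w] kw[OF M] \<epsilon> \<rho>(1)
    by blast
  have W2: "\<bar>W x\<bar> \<le> 2 * M" for x
    by (rule resolvent_bound[OF W(2,3) \<kappa> kw[OF M]])
  have bdd: "bounded (range (\<lambda>x. W x - f x))" if "\<And>x. \<bar>f x\<bar> \<le> S" for f S
  proof -
    have "\<bar>W x - f x\<bar> \<le> 2 * M + S" for x using W2[of x] that[of x] by linarith
    then show ?thesis by (auto simp: bounded_iff)
  qed
  \<comment> \<open>The walk commutes with translations, so the difference of two translates solves
    the resolvent equation with the corresponding difference of \<open>w\<close>.\<close>
  have Wmod: "\<bar>W (x + z) - W x\<bar> \<le> 2 * \<delta>" if z: "norm z \<le> r" for x z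
  proof -
    have "\<bar>W x - W (x + z)\<bar> \<le> 2 * \<delta>"
    proof (rule resolvent_bound[where W = "\<lambda>x. W x - W (x + z)" and \<kappa> = "\<epsilon> / \<rho>" and v = "\<lambda>x. k * (w x - w (x + z))"])
      show "bounded (range (\<lambda>x. W x - W (x + z)))" by (rule bdd[OF W2])
      show "W x - W (x + z) = k * (w x - w (x + z))
           + \<epsilon> / \<rho> * (walk d \<beta> \<rho> (\<lambda>x. W x - W (x + z)) x - (W x - W (x + z)))" for x
      proof -
        have e: "a = b + c * (y - a) \<Longrightarrow> a' = b' + c * (y' - a') \<Longrightarrow>
          a - a' = (b - b') + c * ((y - y') - (a - a'))" for a b c y a' b' y' :: real
          by (simp add: algebra_simps)
        show ?thesis
          unfolding walk_diff walk_translate right_diff_distrib[of k] by (rule e[OF W(3) W(3)])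
      qed
      show "\<bar>k * (w x - w (x + z))\<bar> \<le> 2 * \<delta>" for x
        by (rule kw) (use r(2)[OF z, of x] in linarith)
    qed (rule \<kappa>)
    then show ?thesis by linarith
  qed
  have Wva: "\<bar>W x - va x\<bar> \<le> \<sigma> / 8 + \<sigma> / 4" for x
  proof (rule resolvent_bound[where W = "\<lambda>x. W x - va x" and \<kappa> = "\<epsilon> / \<rho>"
        and v = "\<lambda>x. k * w x - va x + \<epsilon> / \<rho> * (walk d \<beta> \<rho> va x - va x)"])
    have "\<bar>va x\<bar> \<le> M + \<sigma> / 8" for x using va[of x] M[of x] by linarith
    then show "bounded (range (\<lambda>x. W x - va x))" by (rule bdd)
    show "W x - va x = k * w x - va x + \<epsilon> / \<rho> * (walk d \<beta> \<rho> va x - va x)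
        + \<epsilon> / \<rho> * (walk d \<beta> \<rho> (\<lambda>x. W x - va x) x - (W x - va x))" for x
    proof -
      have e: "a = b + c * (y - a) \<Longrightarrow>
          a - a' = b - a' + c * (y' - a') + c * ((y - y') - (a - a'))" for a b c y a' y' :: real
        by (simp add: algebra_simps)
      show ?thesis unfolding walk_diff by (rule e[OF W(3)])
    qed
    show "\<bar>k * w x - va x + \<epsilon> / \<rho> * (walk d \<beta> \<rho> va x - va x)\<bar> \<le> \<sigma> / 8 + \<sigma> / 4" for x
    proof -
      have "\<bar>\<epsilon> / \<rho> * (walk d \<beta> \<rho> va x - va x)\<bar> \<le> \<epsilon> / \<rho> * (\<rho> * G)"
        unfolding abs_mult using \<kappa> G[OF \<rho>(1,2)] by (intro mult_mono) auto
      moreover have "\<epsilon> / \<rho> * (\<rho> * G) = \<epsilon> * G" using \<rho>(1) by simp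
      moreover have "\<bar>\<epsilon> * \<gamma> * w x\<bar> \<le> \<epsilon> * \<gamma> * M"
        unfolding abs_mult[of "\<epsilon> * \<gamma>"] using \<epsilon> \<gamma> M by (intro mult_mono) auto
      moreover have "k * w x - va x = \<epsilon> * \<gamma> * w x - (va x - w x)" by (simp add: k_def algebra_simps)
      moreover have "\<epsilon> * \<gamma> * M + \<epsilon> * G \<le> \<sigma> / 4" using \<epsilon>G by (simp add: algebra_simps)
      ultimately show ?thesis using va[of x] by linarith
    qed
  qed (rule \<kappa>)
  have Ww: "\<bar>W x - w x\<bar> \<le> \<sigma> / 2" for x using Wva[of x] va[of x] by linarith
  define \<phi> where "\<phi> = moll r W"
  have \<phi>W: "\<bar>\<phi> x - W x\<bar> \<le> 2 * \<delta>" for x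
    unfolding \<phi>_def using Wmod by (intro moll_close[OF W(1) r(1)])
  have mollW: "moll s W x = k * moll s w x + \<epsilon> / \<rho> * (walk d \<beta> \<rho> (moll s W) x - moll s W x)" if "0 < s" for s x
  proof -
    have cw: "continuous_on UNIV (walk d \<beta> \<rho> W)" by (rule continuous_on_walk[OF W(1)])
    have c1: "continuous_on UNIV (\<lambda>x. k * w x)" by (intro continuous_intros w)
    have c2: "continuous_on UNIV (\<lambda>x. (\<epsilon> / \<rho>) * walk d \<beta> \<rho> W x)"
      by (intro continuous_on_mult continuous_on_const cw)
    have c3: "continuous_on UNIV (\<lambda>x. - (\<epsilon> / \<rho>) * W x)"
      by (intro continuous_on_mult continuous_on_const W(1))
    have "W = (\<lambda>x. k * w x + ((\<epsilon> / \<rho>) * walk d \<beta> \<rho> W x + - (\<epsilon> / \<rho>) * W x))"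
      by (rule ext) (subst W(3), simp add: right_diff_distrib)
    then have "moll s W x = moll s (\<lambda>x. k * w x + ((\<epsilon> / \<rho>) * walk d \<beta> \<rho> W x + - (\<epsilon> / \<rho>) * W x)) x"
      by (rule arg_cong)
    also have "\<dots> = k * moll s w x + ((\<epsilon> / \<rho>) * walk d \<beta> \<rho> (moll s W) x + - (\<epsilon> / \<rho>) * moll s W x)"
      using that by (simp only: moll_add[OF c1 continuous_on_add[OF c2 c3]] moll_add[OF c2 c3] moll_cmult
          moll_walk[OF W(1)] less_imp_le)
    finally show ?thesis by (simp only: right_diff_distrib)
  qed
  have est: "w x \<le> W x + 3 * (\<epsilon> * \<theta>)" if x: "cball x R \<subseteq> U" for x
  proof -
    have "w x - \<phi> x \<le> (1 + \<epsilon> * \<gamma>) * \<delta> + \<epsilon> * (2 * \<sigma> / R\<^sup>2 * ((\<Sum>i\<in>UNIV. (norm (d i))\<^sup>2) + norm \<beta> * R) + \<theta>)"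
    proof (rule walk_comparison[where U = U and C = "Cr * (2 * M)" and \<rho> = \<rho> and v = "moll r w"])
      show "continuous_on UNIV \<phi>"
        unfolding \<phi>_def by (rule continuous_on_moll[OF W(1) r(1) W2])
      show "\<exists>p X. taylor2 (Cr * (2 * M)) \<phi> x p X" for x
        unfolding \<phi>_def by (rule Cr(2)[OF W(1) W2])
      show "\<rho> * generator d \<beta> p X - \<theta> * \<rho> \<le> walk d \<beta> \<rho> \<phi> x - \<phi> x"
        if "taylor2 (Cr * (2 * M)) \<phi> x p X" for x p X
      proof -
        have "K * (Cr * (2 * M)) * sqrt \<rho> * \<rho> \<le> \<theta> * \<rho>"
          using \<rho>1(3)[OF \<rho>(1,3)] \<rho>(1) by (intro mult_right_mono) auto
        moreover have "K * (Cr * (2 * M)) * \<rho> * sqrt \<rho> = K * (Cr * (2 * M)) * sqrt \<rho> * \<rho>" by simp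
        ultimately show ?thesis using walk[OF that \<rho>(1,2)] by linarith
      qed
      show "\<phi> x = (1 + \<epsilon> * \<gamma>) * moll r w x + \<epsilon> / \<rho> * (walk d \<beta> \<rho> \<phi> x - \<phi> x)" for x
        using mollW[OF r(1), of x] unfolding \<phi>_def k_def .
      show "\<bar>moll r w x - w x\<bar> \<le> \<delta>" for x
        using r by (intro moll_close[OF w]) auto
      show "\<bar>w x - \<phi> x\<bar> \<le> \<sigma>" for x using Ww[of x] \<phi>W[of x] \<delta>(2) by linarith
      show "0 \<le> generator d \<beta> p X + \<gamma> * w x" if "x \<in> U" "transpose X = X" "0 < r"
          "\<And>h. norm h < r \<Longrightarrow> w (x + h) \<le> jet2 (w x) p X h + C * norm h ^ 3" for x p X C r
        by (rule visc[OF that])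
    qed (use w x R \<epsilon> \<rho>(1) \<gamma> \<theta> in auto)
    moreover have "(1 + \<epsilon> * \<gamma>) * \<delta> \<le> 2 * \<delta>" using k \<delta>(1) by (simp add: k_def)
    moreover have "\<epsilon> * (2 * \<sigma> / R\<^sup>2 * (D + norm \<beta> * R) + \<theta>) \<le> \<epsilon> * (\<theta> + \<theta>)"
      using \<sigma>R \<epsilon> by (intro mult_left_mono) auto
    moreover have "\<epsilon> * (\<theta> + \<theta>) = 2 * (\<epsilon> * \<theta>)" by simp
    ultimately show ?thesis using \<phi>W[of x] \<delta>(3) unfolding D_def by linarith
  qed
  define f where "f = moll r0 w x1"
  define fW where "fW = moll r0 W"
  have "f \<le> moll r0 (\<lambda>x. W x + 3 * (\<epsilon> * \<theta>)) x1"
    unfolding f_def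
  proof (rule moll_mono[OF w _ r0])
    show "continuous_on UNIV (\<lambda>x. W x + 3 * (\<epsilon> * \<theta>))" by (intro continuous_intros W(1))
    fix z :: "real^'n" assume z: "norm z \<le> r0"
    have "cball (x1 + z) R \<subseteq> cball x1 (r0 + R)"
      using z by (intro cball_subset_cball_iff[THEN iffD2]) (simp add: dist_norm)
    then show "w (x1 + z) \<le> W (x1 + z) + 3 * (\<epsilon> * \<theta>)" using U by (intro est) blast
  qed
  also have "\<dots> = fW x1 + 3 * (\<epsilon> * \<theta>)"
    unfolding fW_def using r0 by (simp add: moll_add[OF W(1) continuous_on_const] moll_const)
  finally have f1: "f \<le> fW x1 + 3 * (\<epsilon> * \<theta>)" .
  obtain p' X' where T': "taylor2 (C0 * (2 * M)) fW x1 p' X'"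
    using C0'[OF W(1) W2] unfolding fW_def by blast
  let ?g = "generator d \<beta> p X" and ?g' = "generator d \<beta> p' X'"
  have Kle: "K * C * sqrt s \<le> \<theta>" "K * (C0 * (2 * M)) * sqrt s \<le> \<theta>"
      "K * C * sqrt s + K * (C0 * (2 * M)) * sqrt s \<le> \<theta>" if "0 < s" "s \<le> t" for s
  proof -
    have "K * C1 * sqrt s = K * C * sqrt s + K * (C0 * (2 * M)) * sqrt s" by (simp add: C1_def algebra_simps)
    moreover have "0 \<le> K * C * sqrt s" "0 \<le> K * (C0 * (2 * M)) * sqrt s" using K Cpos C0 M0 that by auto
    ultimately show "K * C * sqrt s \<le> \<theta>" "K * (C0 * (2 * M)) * sqrt s \<le> \<theta>"
      "K * C * sqrt s + K * (C0 * (2 * M)) * sqrt s \<le> \<theta>"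
      using t(3)[OF that] by linarith+
  qed
  \<comment> \<open>Combined with \<open>f1\<close>, the terms of order zero cancel up to
    \<open>\<epsilon> * \<gamma> * f\<close>, and \<epsilon> can be divided off.\<close>
  have "fW x1 \<le> k * f + \<epsilon> * (?g' + \<theta>)"
  proof -
    have "walk d \<beta> \<rho> fW x1 - fW x1 \<le> \<rho> * ?g' + \<rho> * (K * (C0 * (2 * M)) * sqrt \<rho>)"
      using walk[OF T' \<rho>(1,2)] by (simp add: mult_ac)
    also have "\<dots> \<le> \<rho> * ?g' + \<rho> * \<theta>" using Kle(2)[OF \<rho>(1,4)] \<rho>(1) by simp
    finally have "\<epsilon> / \<rho> * (walk d \<beta> \<rho> fW x1 - fW x1) \<le> \<epsilon> / \<rho> * (\<rho> * ?g' + \<rho> * \<theta>)"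
      using \<kappa> by (intro mult_left_mono)
    also have "\<dots> = \<epsilon> * (?g' + \<theta>)" using \<rho>(1) by (simp add: field_simps)
    finally show ?thesis using mollW[OF r0, of x1] unfolding fW_def f_def by linarith
  qed
  with f1 have "0 \<le> \<epsilon> * (\<gamma> * f + ?g' + 4 * \<theta>)" by (simp add: k_def algebra_simps)
  then have 1: "0 \<le> \<gamma> * f + ?g' + 4 * \<theta>" using \<epsilon> by (simp add: zero_le_mult_iff)
  \<comment> \<open>The two functions are only uniformly close, so their generators are compared
    through walks of the step \<open>t\<close>, which was fixed before \<sigma>; for the step \<rho>
    their distance need not be small against the step.\<close>
  have "?g' \<le> ?g + 2 * \<theta>"
  proof -
    have "\<bar>fW y - moll r0 w y\<bar> \<le> \<sigma> / 2" for y
    proof -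
      have e: "fW y - moll r0 w y = moll r0 (\<lambda>x. W x + (- 1) * w x) y"
        unfolding fW_def using r0
        by (simp only: moll_add[OF W(1) continuous_on_mult[OF continuous_on_const w]] moll_cmult less_imp_le)
      have "\<bar>moll r0 (\<lambda>x. W x + (- 1) * w x) y - 0\<bar> \<le> \<sigma> / 2"
        by (rule moll_close[OF _ r0]) (use Ww in \<open>auto intro!: continuous_intros W(1) w\<close>)
      then show ?thesis unfolding e by simp
    qed
    note cl = this
    have "\<bar>walk d \<beta> t fW x1 - walk d \<beta> t (moll r0 w) x1\<bar> \<le> \<sigma> / 2" by (rule walk_diff_le[OF cl])
    moreover have "\<bar>walk d \<beta> t fW x1 - fW x1 - t * ?g'\<bar> \<le> t * (K * (C0 * (2 * M)) * sqrt t)"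
      using walk[OF T' t(1,2)] by (simp add: mult_ac)
    moreover have "\<bar>walk d \<beta> t (moll r0 w) x1 - moll r0 w x1 - t * ?g\<bar> \<le> t * (K * C * sqrt t)"
      using walk[OF T t(1,2)] by (simp add: mult_ac)
    moreover have "t * (K * C * sqrt t + K * (C0 * (2 * M)) * sqrt t) \<le> t * \<theta>"
      using Kle(3)[OF t(1)] t(1) by (intro mult_left_mono) auto
    moreover have "2 * \<sigma> \<le> t * \<theta>" using \<sigma>t t(1) by (simp add: field_simps)
    ultimately have "t * ?g' \<le> t * ?g + 2 * (t * \<theta>)"
      using cl[of x1] \<sigma> unfolding distrib_left by linarith
    then have "t * ?g' \<le> t * (?g + 2 * \<theta>)" by (simp add: algebra_simps)
    then show ?thesis using t(1) by simp
  qed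
  with 1 show "0 \<le> generator d \<beta> p X + \<gamma> * moll r0 w x1 + \<eta>"
    by (simp add: f_def \<theta>_def)
qed

section \<open>The conformal factor\<close>

lemma powr_taylor:
  fixes w0 m :: real
  assumes w0: "0 < w0"
  obtains C r where "0 \<le> C" "0 < r" "\<And>k. \<bar>k\<bar> < r \<Longrightarrow>
    \<bar>(w0 + k) powr (- m) - (w0 powr (- m) - m * w0 powr (- m - 1) * k + m * (m + 1) * w0 powr (- m - 2) / 2 * k\<^sup>2)\<bar>
      \<le> C * \<bar>k\<bar> ^ 3"
proof -
  define dd where "dd = (\<lambda>(j::nat) t. (if j = 0 then 1 else if j = 1 then - m else if j = 2 then m * (m + 1)
      else - (m * (m + 1) * (m + 2))) * t powr (- m - real j))"
  have D: "DERIV (dd j) t :> dd (Suc j) t" if "j < 3" "w0 / 2 \<le> t" for j t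
  proof -
    have t: "0 < t" using that w0 by linarith
    consider "j = 0" | "j = 1" | "j = 2" using \<open>j < 3\<close> by linarith
    then show ?thesis
      unfolding dd_def by cases (auto intro!: derivative_eq_intros simp: t t[THEN less_imp_neq, symmetric] algebra_simps)
  qed
  \<comment> \<open>The power is monotone between the end points; the sum of its two end values
    bounds it whatever the sign of the exponent.\<close>
  define C where "C = \<bar>m * (m + 1) * (m + 2)\<bar> * ((w0 / 2) powr (- m - 3) + (2 * w0) powr (- m - 3)) / 6"
  have C: "0 \<le> C" by (simp add: C_def)
  have "\<bar>(w0 + k) powr (- m) - (w0 powr (- m) - m * w0 powr (- m - 1) * k + m * (m + 1) * w0 powr (- m - 2) / 2 * k\<^sup>2)\<bar>
      \<le> C * \<bar>k\<bar> ^ 3" if k: "\<bar>k\<bar> < w0 / 2" for k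
  proof (cases "k = 0")
    case True
    then show ?thesis by simp
  next
    case False
    obtain t where t: "if w0 + k < w0 then w0 + k < t \<and> t < w0 else w0 < t \<and> t < w0 + k"
      and eq: "(w0 + k) powr (- m) = (\<Sum>j<3. dd j w0 / fact j * (w0 + k - w0) ^ j) + dd 3 t / fact 3 * (w0 + k - w0) ^ 3"
    proof -
      have "\<exists>t. (if w0 + k < w0 then w0 + k < t \<and> t < w0 else w0 < t \<and> t < w0 + k) \<and>
        (w0 + k) powr (- m) = (\<Sum>j<3. dd j w0 / fact j * (w0 + k - w0) ^ j) + dd 3 t / fact 3 * (w0 + k - w0) ^ 3"
      proof (rule Taylor[where f = "\<lambda>t. t powr (- m)" and a = "w0 / 2" and b = "2 * w0"])
        show "dd 0 = (\<lambda>t. t powr (- m))" by (simp add: dd_def)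
        show "\<forall>j t. j < 3 \<and> w0 / 2 \<le> t \<and> t \<le> 2 * w0 \<longrightarrow> DERIV (dd j) t :> dd (Suc j) t" using D by blast
        show "w0 / 2 \<le> w0 + k" "w0 + k \<le> 2 * w0" using k by linarith+
      qed (use w0 False in auto)
      then show ?thesis using that by blast
    qed
    have t': "w0 / 2 \<le> t" "t \<le> 2 * w0" using t k by (auto split: if_splits)
    have "t powr (- m - 3) \<le> (w0 / 2) powr (- m - 3) + (2 * w0) powr (- m - 3)"
    proof (cases "0 \<le> - m - 3")
      case True
      then have "t powr (- m - 3) \<le> (2 * w0) powr (- m - 3)" using t' w0 by (intro powr_mono2) auto
      then show ?thesis using powr_ge_zero[of "w0 / 2" "- m - 3"] by linarith
    next
      case False
      then have "t powr (- m - 3) \<le> (w0 / 2) powr (- m - 3)" using t' w0 by (intro powr_mono2') auto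
      then show ?thesis using powr_ge_zero[of "2 * w0" "- m - 3"] by linarith
    qed
    then have "\<bar>dd 3 t / 6\<bar> \<le> C" unfolding C_def dd_def
      by (auto simp: abs_mult intro!: divide_right_mono mult_left_mono)
    moreover have "(w0 + k) powr (- m) - (w0 powr (- m) - m * w0 powr (- m - 1) * k + m * (m + 1) * w0 powr (- m - 2) / 2 * k\<^sup>2)
      = dd 3 t / 6 * k ^ 3"
      unfolding eq by (simp add: eval_nat_numeral fact_numeral) (simp add: dd_def power2_eq_square)
    ultimately show ?thesis by (simp only: abs_mult power_abs) (intro mult_right_mono, auto)
  qed
  then show thesis using C w0 by (intro that[of C "w0 / 2"]) auto
qed

lemma outer_quadratic: "h \<bullet> ((p \<otimes>\<^sub>v q) *v h) = (h \<bullet> p) * (q \<bullet> h)"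
proof -
  have "(p \<otimes>\<^sub>v q) *v h = (q \<bullet> h) *\<^sub>R p"
    by (simp add: tensor_def vec_eq_iff matrix_vector_mult_def inner_vec_def sum_distrib_left mult_ac)
  then show ?thesis by simp
qed

lemma matrix_quadratic_bound:
  fixes Y :: "real^'n^'n"
  obtains K where "0 < K" "\<And>h. \<bar>h \<bullet> (Y *v h)\<bar> \<le> K * (norm h)\<^sup>2"
proof -
  obtain K where K: "0 < K" "\<And>x. norm (Y *v x) \<le> norm x * K"
    using bounded_linear.pos_bounded[OF matrix_vector_mul_bounded_linear[of Y]] by blast
  have "\<bar>h \<bullet> (Y *v h)\<bar> \<le> K * (norm h)\<^sup>2" for h
  proof -
    have "\<bar>h \<bullet> (Y *v h)\<bar> \<le> norm h * norm (Y *v h)" by (rule Cauchy_Schwarz_ineq2)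
    also have "\<dots> \<le> norm h * (norm h * K)" using K(2) by (intro mult_left_mono) auto
    finally show ?thesis by (simp add: power2_eq_square mult_ac)
  qed
  then show thesis using that K(1) by blast
qed

text \<open>Substitution into the expansion of the power: of the squared increment only
  \<open>(q \<bullet> h)\<^sup>2\<close> is of second order. The term \<open>c * norm h ^ 3\<close>
  is carried along because jets of \<open>w\<close> are known only up to a cubic error.\<close>

lemma powr_jet:
  fixes q :: "real^'n" and w0 m c :: real
  assumes w0: "0 < w0"
  obtains C r where "0 \<le> C" "0 < r" "\<And>h. norm h < r \<Longrightarrow> 0 < w0 + (q \<bullet> h + h \<bullet> (Y *v h) / 2 + c * norm h ^ 3) \<and>
    \<bar>(w0 + (q \<bullet> h + h \<bullet> (Y *v h) / 2 + c * norm h ^ 3)) powr (- m) - (w0 powr (- m)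
      - m * w0 powr (- m - 1) * (q \<bullet> h + h \<bullet> (Y *v h) / 2) + m * (m + 1) * w0 powr (- m - 2) / 2 * (q \<bullet> h)\<^sup>2)\<bar>
      \<le> C * norm h ^ 3"
proof -
  obtain C1 r1 where C1: "0 \<le> C1" "0 < r1" "\<And>k. \<bar>k\<bar> < r1 \<Longrightarrow>
    \<bar>(w0 + k) powr (- m) - (w0 powr (- m) - m * w0 powr (- m - 1) * k + m * (m + 1) * w0 powr (- m - 2) / 2 * k\<^sup>2)\<bar>
      \<le> C1 * \<bar>k\<bar> ^ 3"
    using powr_taylor[OF w0, of m] by blast
  obtain K where K: "0 < K" "\<And>h. \<bar>h \<bullet> (Y *v h)\<bar> \<le> K * (norm h)\<^sup>2"
    using matrix_quadratic_bound[of Y] by blast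
  define B where "B = norm q + K + \<bar>c\<bar>"
  have B: "0 < B" using K by (simp add: B_def add_pos_nonneg add_nonneg_pos)
  define r where "r = min 1 (min r1 w0 / B)"
  have r: "0 < r" using B C1 w0 by (simp add: r_def)
  define A1 where "A1 = m * w0 powr (- m - 1)"
  define A2 where "A2 = m * (m + 1) * w0 powr (- m - 2) / 2"
  define C where "C = C1 * B ^ 3 + \<bar>A1\<bar> * \<bar>c\<bar> + \<bar>A2\<bar> * (3 * B\<^sup>2)"
  have "0 < w0 + k \<and> \<bar>(w0 + k) powr (- m) - (w0 powr (- m)
      - A1 * (q \<bullet> h + h \<bullet> (Y *v h) / 2) + A2 * (q \<bullet> h)\<^sup>2)\<bar> \<le> C * norm h ^ 3"
    if h: "norm h < r" and k_def: "k = q \<bullet> h + h \<bullet> (Y *v h) / 2 + c * norm h ^ 3" for h k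
  proof -
    let ?n = "norm h"
    have n1: "?n \<le> 1" using h by (simp add: r_def)
    have n2: "?n ^ 3 \<le> ?n\<^sup>2" "?n\<^sup>2 \<le> ?n" using n1 by (auto simp: power3_eq_cube power2_eq_square mult_left_le)
    have a: "\<bar>q \<bullet> h\<bar> \<le> norm q * ?n" by (rule Cauchy_Schwarz_ineq2)
    define b where "b = h \<bullet> (Y *v h) / 2 + c * ?n ^ 3"
    have "\<bar>c * ?n ^ 3\<bar> \<le> \<bar>c\<bar> * ?n\<^sup>2" unfolding abs_mult using n2 by (intro mult_mono) auto
    moreover have "0 \<le> K * ?n\<^sup>2" using K by simp
    ultimately have b1: "\<bar>b\<bar> \<le> (K + \<bar>c\<bar>) * ?n\<^sup>2" using K(2)[of h] unfolding b_def distrib_right by linarith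
    also have "\<dots> \<le> B * ?n\<^sup>2" by (intro mult_right_mono) (auto simp: B_def)
    finally have b: "\<bar>b\<bar> \<le> B * ?n\<^sup>2" .
    have "(K + \<bar>c\<bar>) * ?n\<^sup>2 \<le> (K + \<bar>c\<bar>) * ?n" using n2 K by (intro mult_left_mono) auto
    then have kB: "\<bar>k\<bar> \<le> B * ?n" using a b1 unfolding k_def b_def B_def distrib_right by linarith
    have "B * ?n < min r1 w0" using h B unfolding r_def by (simp add: field_simps)
    then have kr: "\<bar>k\<bar> < r1" "\<bar>k\<bar> < w0" using kB by auto
    have t1: "\<bar>(w0 + k) powr (- m) - (w0 powr (- m) - A1 * k + A2 * k\<^sup>2)\<bar> \<le> C1 * B ^ 3 * ?n ^ 3"
    proof -
      have "C1 * \<bar>k\<bar> ^ 3 \<le> C1 * (B * ?n) ^ 3" using kB C1(1) by (intro mult_left_mono power_mono) auto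
      then show ?thesis using C1(3)[OF kr(1)] by (simp add: A1_def A2_def power_mult_distrib)
    qed
    have t2: "\<bar>A1 * (c * ?n ^ 3)\<bar> \<le> \<bar>A1\<bar> * \<bar>c\<bar> * ?n ^ 3" by (simp add: abs_mult)
    have "\<bar>2 * (q \<bullet> h) + b\<bar> \<le> 3 * B * ?n"
    proof -
      have "norm q * ?n \<le> B * ?n" using K by (intro mult_right_mono) (auto simp: B_def)
      moreover have "B * ?n\<^sup>2 \<le> B * ?n" using n2 B by (intro mult_left_mono) auto
      ultimately show ?thesis using a b by linarith
    qed
    then have "\<bar>b * (2 * (q \<bullet> h) + b)\<bar> \<le> (B * ?n\<^sup>2) * (3 * B * ?n)"
      unfolding abs_mult using b B by (intro mult_mono) auto
    also have "\<dots> = 3 * B\<^sup>2 * ?n ^ 3" by (simp add: power2_eq_square power3_eq_cube)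
    finally have "\<bar>A2 * (b * (2 * (q \<bullet> h) + b))\<bar> \<le> \<bar>A2\<bar> * (3 * B\<^sup>2 * ?n ^ 3)"
      unfolding abs_mult[of A2] by (intro mult_left_mono) auto
    then have t3: "\<bar>A2 * (b * (2 * (q \<bullet> h) + b))\<bar> \<le> \<bar>A2\<bar> * (3 * B\<^sup>2) * ?n ^ 3" by (simp add: mult_ac)
    have "k = q \<bullet> h + b" by (simp add: k_def b_def)
    then have "A2 * k\<^sup>2 = A2 * (q \<bullet> h)\<^sup>2 + A2 * (b * (2 * (q \<bullet> h) + b))"
      by (simp add: power2_eq_square algebra_simps)
    moreover have "A1 * k = A1 * (q \<bullet> h + h \<bullet> (Y *v h) / 2) + A1 * (c * ?n ^ 3)"
      by (simp add: k_def distrib_left)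
    ultimately have "\<bar>(w0 + k) powr (- m) - (w0 powr (- m)
      - A1 * (q \<bullet> h + h \<bullet> (Y *v h) / 2) + A2 * (q \<bullet> h)\<^sup>2)\<bar> \<le> C * ?n ^ 3"
      using t1 t2 t3 unfolding C_def distrib_right by linarith
    then show ?thesis using kr by auto
  qed
  moreover have "0 \<le> C" using C1 B by (simp add: C_def)
  ultimately show thesis using that[of C r] r unfolding A1_def A2_def by blast
qed

section \<open>Quadratic test functions and their conformal Hessians\<close>

definition quad :: "real \<Rightarrow> real^'n \<Rightarrow> real^'n^'n \<Rightarrow> real^'n \<Rightarrow> real^'n \<Rightarrow> real" where
  "quad a p X x0 x = a + p \<bullet> (x - x0) + (x - x0) \<bullet> (X *v (x - x0)) / 2"

lemma
  fixes X :: "real^'n^'n"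
  assumes sym: "transpose X = X"
  shows grad_quad: "grad (quad a p X x0) x = p + X *v (x - x0)"
    and hess_quad: "hess (quad a p X x0) x = X"
    and C2_on_quad: "C2_on S (quad a p X x0)"
proof -
  have d: "(quad a p X x0 has_derivative (\<lambda>h. p \<bullet> h + h \<bullet> (X *v (x - x0)))) (at x)" for x
  proof -
    have X: "((\<lambda>x. X *v (x - x0)) has_derivative (\<lambda>h. X *v h)) (at x)"
      by (rule bounded_linear.has_derivative[OF matrix_vector_mul_bounded_linear]) (auto intro!: derivative_eq_intros)
    have "(quad a p X x0 has_derivative (\<lambda>h. p \<bullet> h + ((x - x0) \<bullet> (X *v h) + h \<bullet> (X *v (x - x0))) / 2)) (at x)"
      unfolding quad_def by (rule derivative_eq_intros X refl | simp)+
    moreover have "(x - x0) \<bullet> (X *v h) = h \<bullet> (X *v (x - x0))" for h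
      by (rule inner_symmetric_matrix[OF sym])
    ultimately show ?thesis by simp
  qed
  have g: "grad (quad a p X x0) x = p + X *v (x - x0)" for x
    unfolding grad_def frechet_derivative_at[OF d, symmetric]
    by (simp add: vec_eq_iff inner_axis inner_axis')
  then show "grad (quad a p X x0) x = p + X *v (x - x0)" .
  have "grad (quad a p X x0) = (\<lambda>x. p + X *v (x - x0))" using g by (rule ext)
  moreover have d2: "((\<lambda>x. p + X *v (x - x0)) has_derivative (\<lambda>h. X *v h)) (at x)" for x
    by (auto intro!: derivative_eq_intros bounded_linear.has_derivative[OF matrix_vector_mul_bounded_linear])
  ultimately have d': "(grad (quad a p X x0) has_derivative (\<lambda>h. X *v h)) (at x)" for x by simp
  have h: "hess (quad a p X x0) x = X" for x
    unfolding hess_def jacobian_def frechet_derivative_at[OF d', symmetric]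
    by (simp add: matrix_of_matrix_vector_mul)
  then show "hess (quad a p X x0) x = X" .
  have "hess (quad a p X x0) = (\<lambda>x. X)" using h by (rule ext)
  then show "C2_on S (quad a p X x0)"
    unfolding C2_on_def using d d' by (auto simp: differentiable_def)
qed

text \<open>\<open>p\<close> and \<open>X\<close> come from the chain rule for the power
  \<open>- m\<close> of a function with jet \<open>w0\<close>, \<open>q\<close>, \<open>Y\<close>.
  The multiples \<open>- (m + 1)\<close> and \<open>m + 1\<close> of
  \<open>q \<otimes>\<^sub>v q\<close>, from the Hessian and from the gradient term, cancel.\<close>

lemma conformal_hessian_quad:
  fixes q :: "real^'n" and Y :: "real^'n^'n"
  assumes n: "CARD('n) \<ge> 3" and w0: "0 < w0" and sym: "transpose Y = Y"
  defines "N \<equiv> real CARD('n)"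
  defines "m \<equiv> (N - 2) / 2"
  defines "p \<equiv> (- (m * w0 powr (- m - 1))) *\<^sub>R q"
  defines "X \<equiv> (- (m * w0 powr (- m - 1))) *\<^sub>R Y + (m * (m + 1) * w0 powr (- m - 2)) *\<^sub>R (q \<otimes>\<^sub>v q)"
  shows "conformal_hessian (quad (w0 powr (- m)) p (X + t *\<^sub>R mat 1) x0) x0
    = (w0 *\<^sub>R Y - ((norm q)\<^sup>2 / 2) *\<^sub>R mat 1) - (t * (w0 powr (m + 2) / m)) *\<^sub>R mat 1"
proof -
  have m: "0 < m" using n by (simp add: m_def N_def)
  have N: "N = 2 * m + 2" unfolding m_def by (simp add: field_simps)
  have tqq: "transpose (q \<otimes>\<^sub>v q) = q \<otimes>\<^sub>v q" by (simp add: transpose_def tensor_def vec_eq_iff mult.commute)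
  have symX: "transpose (X + t *\<^sub>R mat 1) = X + t *\<^sub>R mat 1"
    using sym tqq unfolding X_def by (auto simp: transpose_def vec_eq_iff mat_def)
  have e1: "(w0 powr (- m)) powr (- (N + 2) / (N - 2)) = w0 powr (m + 2)"
    unfolding powr_powr N using m by (intro arg_cong[where f = "\<lambda>e. w0 powr e"]) (simp add: field_simps)
  have e2: "(w0 powr (- m)) powr (- (2 * N) / (N - 2)) = w0 powr (2 * m + 2)"
    unfolding powr_powr N using m by (intro arg_cong[where f = "\<lambda>e. w0 powr e"]) (simp add: field_simps)
  have q0: "quad (w0 powr (- m)) p (X + t *\<^sub>R mat 1) x0 x0 = w0 powr (- m)" by (simp add: quad_def)
  have g0: "grad (quad (w0 powr (- m)) p (X + t *\<^sub>R mat 1) x0) x0 = p" by (simp add: grad_quad[OF symX])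
  have c: "conformal_hessian (quad (w0 powr (- m)) p (X + t *\<^sub>R mat 1) x0) x0
    = (- 2 / (N - 2) * w0 powr (m + 2)) *\<^sub>R (X + t *\<^sub>R mat 1)
     + (2 * N / (N - 2)\<^sup>2 * w0 powr (2 * m + 2)) *\<^sub>R (p \<otimes>\<^sub>v p)
     - (2 / (N - 2)\<^sup>2 * w0 powr (2 * m + 2) * (norm p)\<^sup>2) *\<^sub>R mat 1"
    unfolding conformal_hessian_def Let_def N_def[symmetric] q0 g0 hess_quad[OF symX] e1 e2 ..
  define W where "W = w0 powr m"
  have W: "0 < W" using w0 by (simp add: W_def)
  have p1: "w0 powr (m + 2) = W * w0\<^sup>2" "w0 powr (2 * m + 2) = W\<^sup>2 * w0\<^sup>2"
     "w0 powr (- m - 1) = 1 / (W * w0)" "w0 powr (- m - 2) = 1 / (W * w0\<^sup>2)"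
  proof -
    have m1: "w0 powr (- m) = 1 / W" by (simp add: W_def powr_minus_divide)
    have s2: "w0 powr 2 = w0\<^sup>2" using w0 by (simp add: powr_numeral)
    show "w0 powr (m + 2) = W * w0\<^sup>2" by (simp only: powr_add s2 W_def)
    have "w0 powr (2 * m) = W\<^sup>2" unfolding W_def power2_eq_square powr_add[symmetric] by simp
    then show "w0 powr (2 * m + 2) = W\<^sup>2 * w0\<^sup>2" by (simp only: powr_add s2)
    show "w0 powr (- m - 1) = 1 / (W * w0)" using w0 by (simp add: powr_diff m1)
    show "w0 powr (- m - 2) = 1 / (W * w0\<^sup>2)" using w0 by (simp add: powr_diff m1 s2)
  qed
  have pp: "p \<otimes>\<^sub>v p = (m / (W * w0))\<^sup>2 *\<^sub>R (q \<otimes>\<^sub>v q)"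
    unfolding p_def p1 by (simp add: tensor_def vec_eq_iff power2_eq_square)
  have np: "(norm p)\<^sup>2 = (m / (W * w0))\<^sup>2 * (norm q)\<^sup>2"
    unfolding p_def p1 norm_scaleR power_mult_distrib power2_abs by simp
  have k1: "- 2 / (N - 2) * w0 powr (m + 2) * - (m * w0 powr (- m - 1)) = w0"
    unfolding p1 N using m W w0 by (simp add: field_simps power2_eq_square)
  have k2: "- 2 / (N - 2) * w0 powr (m + 2) * (m * (m + 1) * w0 powr (- m - 2)) = - (m + 1)"
    unfolding p1 N using m W w0 by (simp add: field_simps)
  have k3: "2 * N / (N - 2)\<^sup>2 * w0 powr (2 * m + 2) * (m / (W * w0))\<^sup>2 = m + 1"
    unfolding p1 N using m W w0 by (simp add: field_simps power2_eq_square)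
  have k4: "2 / (N - 2)\<^sup>2 * w0 powr (2 * m + 2) * ((m / (W * w0))\<^sup>2 * (norm q)\<^sup>2) = (norm q)\<^sup>2 / 2"
    unfolding p1 N using m W w0 by (simp add: field_simps power2_eq_square)
  have k5: "- 2 / (N - 2) * w0 powr (m + 2) * t = - (t * (w0 powr (m + 2) / m))"
    unfolding N using m by (simp add: field_simps)
  show ?thesis
    unfolding c
    unfolding pp np k4 X_def scaleR_add_right scaleR_scaleR k1 k2 k3 k5
    by (simp add: algebra_simps)
qed

definition dual_weights :: "(real^'n) set \<Rightarrow> ('n \<Rightarrow> real) set" where
  "dual_weights \<Gamma> = {a. \<forall>l\<in>\<Gamma>. 0 \<le> (\<Sum>i\<in>UNIV. a i * l $ i)}"

text \<open>With \<open>u = w powr (- (n - 2) / 2)\<close> the conformal Hessian of \<open>u\<close> is \<open>w D\<^sup>2w - |Dw|\<^sup>2 / 2 I\<close>.\<close>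

definition conformal_jet :: "real \<Rightarrow> real^'n \<Rightarrow> real^'n^'n \<Rightarrow> real^'n^'n" where
  "conformal_jet a q Y = a *\<^sub>R Y - ((norm q)\<^sup>2 / 2) *\<^sub>R mat 1"

lemma weighted_diagonal_add_mat:
  assumes "orthonormal E"
  shows "weighted_diagonal a E (A + c *\<^sub>R mat 1) = weighted_diagonal a E A + c * sum a UNIV"
proof -
  have "E $ i \<bullet> ((A + c *\<^sub>R mat 1) *v E $ i) = E $ i \<bullet> (A *v E $ i) + c" for i
    using assms by (simp add: matrix_vector_mult_add_rdistrib scaleR_matrix_vector_assoc[symmetric]
        inner_add_right orthonormal_def)
  then show ?thesis by (simp add: distrib_left sum.distrib sum_distrib_left mult.commute)
qed

lemma quad_power_jet:
  fixes q h :: "real^'n"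
  shows "quad b (- A1 *\<^sub>R q) (- A1 *\<^sub>R Y + (2 * A2) *\<^sub>R (q \<otimes>\<^sub>v q) + t *\<^sub>R mat 1) x0 (x0 + h)
    = b - A1 * (q \<bullet> h + h \<bullet> (Y *v h) / 2) + A2 * (q \<bullet> h)\<^sup>2 + t / 2 * (norm h)\<^sup>2"
proof -
  have k: "h \<bullet> ((- A1 *\<^sub>R Y + (2 * A2) *\<^sub>R (q \<otimes>\<^sub>v q) + t *\<^sub>R mat 1) *v h)
    = - A1 * (h \<bullet> (Y *v h)) + 2 * A2 * (h \<bullet> ((q \<otimes>\<^sub>v q) *v h)) + t * (norm h)\<^sup>2"
    unfolding matrix_vector_mult_add_rdistrib scaleR_matrix_vector_assoc[symmetric]
    by (simp add: inner_add_right inner_diff_right power2_norm_eq_inner)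
  show ?thesis
    unfolding quad_def add_diff_cancel_left' k outer_quadratic inner_commute[of h q]
    by (simp add: power2_eq_square field_simps)
qed

section \<open>Viscosity conditions for the conformal factor\<close>

context
  fixes \<Omega> \<Gamma> :: "(real^'n) set" and u w :: "real^'n \<Rightarrow> real"
  assumes n: "CARD('n) \<ge> 3" and \<Omega>: "open \<Omega>"
    and sol: "viscosity_solution \<Gamma> \<Omega> u" and sym: "symmetric_set \<Gamma>"
    and uw: "\<forall>x\<in>\<Omega>. 0 < w x \<and> u x = w x powr (- ((real CARD('n) - 2) / 2))"
begin

lemma w_factor: "x \<in> \<Omega> \<Longrightarrow> 0 < w x" "x \<in> \<Omega> \<Longrightarrow> u x = w x powr (- ((real CARD('n) - 2) / 2))"
  using uw by blast+

text \<open>The sign \<open>\<sigma>\<close> treats touching from above and from below at once; a quadratic polynomial with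
  a Hessian perturbed by \<open>\<sigma>\<close> serves as test function for \<open>u\<close>.\<close>

lemma eigenvalues_perturbed_jet:
  assumes x0: "x0 \<in> \<Omega>" and Y: "transpose Y = Y" and "0 < r" and \<epsilon>: "0 < \<epsilon>" and \<sigma>: "\<sigma> = 1 \<or> \<sigma> = - 1"
    and jet: "\<And>h. norm h < r \<Longrightarrow> \<sigma> * w (x0 + h) \<le> \<sigma> * (jet2 (w x0) q Y h) + C * norm h ^ 3"
  defines "A \<equiv> conformal_jet (w x0) q Y + (\<sigma> * \<epsilon>) *\<^sub>R mat 1"
  shows "transpose A = A" "\<sigma> = 1 \<Longrightarrow> eigenvalues A \<in> closure \<Gamma>" "\<sigma> = - 1 \<Longrightarrow> eigenvalues A \<notin> \<Gamma>"
proof -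
  define m where "m = (real CARD('n) - 2) / 2"
  have m: "0 < m" using n by (simp add: m_def)
  have w0: "0 < w x0" using w_factor(1)[OF x0] .
  define A1 where "A1 = m * w x0 powr (- m - 1)"
  define A2 where "A2 = m * (m + 1) * w x0 powr (- m - 2) / 2"
  define k where "k = (\<lambda>h. q \<bullet> h + h \<bullet> (Y *v h) / 2 + \<sigma> * C * norm h ^ 3)"
  define T where "T = (\<lambda>h. w x0 powr (- m) - A1 * (q \<bullet> h + h \<bullet> (Y *v h) / 2) + A2 * (q \<bullet> h)\<^sup>2)"
  obtain C3 r3 where C3: "0 \<le> C3" "0 < r3"
    and P: "\<And>h. norm h < r3 \<Longrightarrow> 0 < w x0 + k h \<and> \<bar>(w x0 + k h) powr (- m) - T h\<bar> \<le> C3 * norm h ^ 3"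
    using powr_jet[OF w0, of q Y "\<sigma> * C" m] unfolding k_def T_def A1_def A2_def by blast
  obtain e where e: "0 < e" "ball x0 e \<subseteq> \<Omega>" using \<Omega> x0 openE by blast
  have A2': "2 * A2 = m * (m + 1) * w x0 powr (- m - 2)" by (simp add: A2_def)
  define X where "X = - A1 *\<^sub>R Y + (2 * A2) *\<^sub>R (q \<otimes>\<^sub>v q)"
  define \<kappa> where "\<kappa> = w x0 powr (m + 2) / m"
  have \<kappa>: "0 < \<kappa>" using w0 m by (simp add: \<kappa>_def)
  \<comment> \<open>Adding \<open>t *\<^sub>R mat 1\<close> to the Hessian of the test function
    changes its conformal Hessian by \<open>- t * \<kappa>\<close> times the identity; here
    \<open>t = - \<sigma> * \<eta>\<close> produces the shift
    \<open>\<sigma> * \<epsilon>\<close>.\<close>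
  define \<eta> where "\<eta> = \<epsilon> / \<kappa>"
  have \<eta>: "0 < \<eta>" using \<epsilon> \<kappa> by (simp add: \<eta>_def)
  define \<phi> where "\<phi> = quad (w x0 powr (- m)) (- A1 *\<^sub>R q) (X + (- \<sigma> * \<eta>) *\<^sub>R mat 1) x0"
  have tqq: "transpose (q \<otimes>\<^sub>v q) = q \<otimes>\<^sub>v q" by (simp add: transpose_def tensor_def vec_eq_iff mult.commute)
  have "transpose (X + (- \<sigma> * \<eta>) *\<^sub>R mat 1) = X + (- \<sigma> * \<eta>) *\<^sub>R mat 1"
    using Y tqq unfolding X_def by (auto simp: transpose_def vec_eq_iff mat_def)
  then have C2: "C2_on \<Omega> \<phi>" unfolding \<phi>_def by (rule C2_on_quad)
  have ev: "\<forall>\<^sub>F x in nhds x0. 0 \<le> \<sigma> * (u x - \<phi> x)"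
    unfolding eventually_nhds_metric
  \<comment> \<open>The last entry lets the quadratic perturbation absorb the cubic error
    \<open>C3 * norm h ^ 3\<close>.\<close>
  proof (intro exI[of _ "min (min r r3) (min e (\<eta> / (2 * (C3 + 1))))"] conjI allI impI)
    show "0 < min (min r r3) (min e (\<eta> / (2 * (C3 + 1))))" using \<open>0 < r\<close> C3 e \<eta> by simp
    fix x assume d: "dist x x0 < min (min r r3) (min e (\<eta> / (2 * (C3 + 1))))"
    define h where "h = x - x0"
    have h: "norm h < r" "norm h < r3" "norm h < e" "norm h < \<eta> / (2 * (C3 + 1))" and x: "x = x0 + h"
      using d by (auto simp: h_def dist_norm)
    have x\<Omega>: "x0 + h \<in> \<Omega>" using e h by (auto simp: dist_norm)
    have "\<sigma> * (w x0 + k h) powr (- m) \<le> \<sigma> * w (x0 + h) powr (- m)"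
      using \<sigma>
    proof
      assume 1: "\<sigma> = 1"
      then have "w (x0 + h) \<le> w x0 + k h" using jet[OF h(1)] by (simp add: k_def)
      then have "(w x0 + k h) powr (- m) \<le> w (x0 + h) powr (- m)"
        using w_factor(1)[OF x\<Omega>] m by (intro powr_mono2') auto
      then show ?thesis using 1 by simp
    next
      assume 1: "\<sigma> = - 1"
      then have "w x0 + k h \<le> w (x0 + h)" using jet[OF h(1)] by (simp add: k_def)
      then have "w (x0 + h) powr (- m) \<le> (w x0 + k h) powr (- m)" using P[OF h(2)] m by (intro powr_mono2') auto
      then show ?thesis using 1 by simp
    qed
    moreover have "2 * (norm h + C3 * norm h) < \<eta>" using h(4) C3(1) by (simp add: pos_less_divide_eq algebra_simps)
    then have "C3 * norm h \<le> \<eta> / 2" using norm_ge_zero[of h] unfolding distrib_left by linarith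
    then have "C3 * norm h * (norm h)\<^sup>2 \<le> \<eta> / 2 * (norm h)\<^sup>2" by (intro mult_right_mono) auto
    then have "C3 * norm h ^ 3 \<le> \<eta> / 2 * (norm h)\<^sup>2" by (simp add: power2_eq_square power3_eq_cube)
    moreover have "\<phi> (x0 + h) = T h + - \<sigma> * \<eta> / 2 * (norm h)\<^sup>2"
      unfolding \<phi>_def X_def T_def by (rule quad_power_jet)
    moreover have "u (x0 + h) = w (x0 + h) powr (- m)" using w_factor(2)[OF x\<Omega>] by (simp add: m_def)
    ultimately show "0 \<le> \<sigma> * (u x - \<phi> x)"
      using P[OF h(2)] \<sigma> unfolding x by (auto simp: abs_le_iff)
  qed
  have u0: "u x0 - \<phi> x0 = 0" using w_factor(2)[OF x0] by (simp add: \<phi>_def quad_def m_def)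
  have "conformal_hessian \<phi> x0 = conformal_jet (w x0) q Y - (- \<sigma> * \<eta> * \<kappa>) *\<^sub>R mat 1"
    unfolding \<phi>_def X_def A2' A1_def \<kappa>_def conformal_jet_def m_def by (rule conformal_hessian_quad[OF n w0 Y])
  also have "- \<sigma> * \<eta> * \<kappa> = - (\<sigma> * \<epsilon>)" using \<kappa> by (simp add: \<eta>_def)
  finally have A: "conformal_hessian \<phi> x0 = A" by (simp add: A_def)
  show "transpose A = A" using Y by (auto simp: A_def conformal_jet_def transpose_def vec_eq_iff mat_def)
  show "eigenvalues A \<in> closure \<Gamma>" if "\<sigma> = 1"
    using sol x0 C2 u0 ev unfolding viscosity_solution_def A[symmetric] that by simp
  show "eigenvalues A \<notin> \<Gamma>" if "\<sigma> = - 1"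
  proof -
    have "\<forall>\<^sub>F x in nhds x0. u x - \<phi> x \<le> 0" using ev unfolding that by simp
    then show ?thesis using sol x0 C2 u0 unfolding viscosity_solution_def A[symmetric] by blast
  qed
qed

text \<open>The perturbation of the test function adds only \<open>\<epsilon> * sum a UNIV\<close>,
  which is too small to compensate a negative value.\<close>

lemma w_upper_jet:
  assumes x0: "x0 \<in> \<Omega>" and Y: "transpose Y = Y" and "0 < r"
    and jet: "\<And>h. norm h < r \<Longrightarrow> w (x0 + h) \<le> jet2 (w x0) q Y h + C * norm h ^ 3"
    and E: "orthonormal E" and a: "a \<in> dual_weights \<Gamma>"
  shows "0 \<le> weighted_diagonal a E (conformal_jet (w x0) q Y)"
proof (rule ccontr)
  let ?S = "weighted_diagonal a E (conformal_jet (w x0) q Y)" and ?s = "sum a UNIV"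
  assume neg: "\<not> 0 \<le> ?S"
  define \<epsilon> where "\<epsilon> = - ?S / (2 * (\<bar>?s\<bar> + 1))"
  have \<epsilon>: "0 < \<epsilon>" using neg by (simp add: \<epsilon>_def divide_neg_pos)
  have jet': "\<And>h. norm h < r \<Longrightarrow> 1 * w (x0 + h) \<le> 1 * (jet2 (w x0) q Y h) + C * norm h ^ 3"
    using jet by simp
  note test = eigenvalues_perturbed_jet[OF x0 Y \<open>0 < r\<close> \<epsilon> _ jet']
  have "0 \<le> weighted_diagonal a E (conformal_jet (w x0) q Y + (1 * \<epsilon>) *\<^sub>R mat 1)"
  proof (rule weighted_diagonal_nonneg[OF _ sym _ _ E])
    show "0 \<le> (\<Sum>i\<in>UNIV. a i * l $ i)" if "l \<in> \<Gamma>" for l using a that by (simp add: dual_weights_def)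
  qed (use test in simp_all)
  then have "0 \<le> ?S + \<epsilon> * ?s" unfolding weighted_diagonal_add_mat[OF E] by simp
  also have "\<epsilon> * ?s \<le> \<epsilon> * (\<bar>?s\<bar> + 1)" using \<epsilon> by (intro mult_left_mono) auto
  also have "\<dots> = - ?S / 2"
  proof -
    have "b / (2 * (\<bar>c\<bar> + 1)) * (\<bar>c\<bar> + 1) = b / 2" for b c :: real by (simp add: add_pos_nonneg divide_simps)
    then show ?thesis unfolding \<epsilon>_def .
  qed
  finally show False using neg by linarith
qed

text \<open>Half of the margin \<open>c\<close> pays for the perturbation of the test function; the
  other half puts the eigenvalues into the open cone, which touching \<open>u\<close> from above
  forbids.\<close>

lemma w_lower_jet:
  assumes x0: "x0 \<in> \<Omega>" and Y: "transpose Y = Y" and "0 < r"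
    and jet: "\<And>h. norm h < r \<Longrightarrow> jet2 (w x0) q Y h - C * norm h ^ 3 \<le> w (x0 + h)"
    and \<Gamma>: "open \<Gamma>" "convex \<Gamma>" "cone_at_origin \<Gamma>" "{l. \<forall>i. l $ i > 0} \<subseteq> \<Gamma>"
    and "0 < c"
    and lower: "\<And>E a. orthonormal E \<Longrightarrow> a \<in> dual_weights \<Gamma> \<Longrightarrow>
       c * sum a UNIV \<le> weighted_diagonal a E (conformal_jet (w x0) q Y)"
  shows False
proof -
  have c: "0 < c / 2" using \<open>0 < c\<close> by simp
  have jet': "- 1 * w (x0 + h) \<le> - 1 * (jet2 (w x0) q Y h) + C * norm h ^ 3" if "norm h < r" for h
    using jet[OF that] by simp
  note test = eigenvalues_perturbed_jet[OF x0 Y \<open>0 < r\<close> c _ jet']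
  have "eigenvalues (conformal_jet (w x0) q Y + (- 1 * (c / 2)) *\<^sub>R mat 1) \<in> \<Gamma>"
  proof (rule eigenvalues_mem_open_cone[OF _ sym \<Gamma> c])
    show "transpose (conformal_jet (w x0) q Y + (- 1 * (c / 2)) *\<^sub>R mat 1)
        = conformal_jet (w x0) q Y + (- 1 * (c / 2)) *\<^sub>R mat 1" by (rule test(1)) simp
    fix E :: "real^'n^'n" and a :: "'n \<Rightarrow> real"
    assume E: "orthonormal E" and "\<And>l. l \<in> \<Gamma> \<Longrightarrow> 0 \<le> (\<Sum>i\<in>UNIV. a i * l $ i)"
    then have "a \<in> dual_weights \<Gamma>" by (simp add: dual_weights_def)
    from lower[OF E this] show "c / 2 * sum a UNIV
      \<le> weighted_diagonal a E (conformal_jet (w x0) q Y + (- 1 * (c / 2)) *\<^sub>R mat 1)"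
      unfolding weighted_diagonal_add_mat[OF E] by simp
  qed
  then show False using test(3) by simp
qed

end

section \<open>Kelvin transforms\<close>

lemma conformal_jet_quadratic:
  "norm e = 1 \<Longrightarrow> e \<bullet> (conformal_jet a q Y *v e) = a * (e \<bullet> (Y *v e)) - (norm q)\<^sup>2 / 2"
  by (simp add: conformal_jet_def matrix_vector_mult_diff_rdistrib scaleR_matrix_vector_assoc[symmetric]
      inner_diff_right norm_eq_1)

lemma orthonormal_norm: "orthonormal E \<Longrightarrow> norm (E $ i) = 1"
  by (simp add: orthonormal_def norm_eq_1)

text \<open>A negative weight would be exposed by a positive vector with one large entry.\<close>

lemma dual_weights_nonneg:
  fixes \<Gamma> :: "(real^'n) set"
  assumes "{l. \<forall>i. l $ i > 0} \<subseteq> \<Gamma>" "a \<in> dual_weights \<Gamma>"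
  shows "0 \<le> a i"
proof (rule ccontr)
  assume neg: "\<not> 0 \<le> a i"
  define S where "S = (\<Sum>j\<in>UNIV - {i}. \<bar>a j\<bar>)"
  define t where "t = (S + 1) / - a i"
  have S: "0 \<le> S" by (simp add: S_def sum_nonneg)
  have t: "0 < t" using neg S by (simp add: t_def divide_pos_neg)
  define l :: "real^'n" where "l = (\<chi> j. if j = i then t else 1)"
  have "l \<in> \<Gamma>" by (rule subsetD[OF assms(1)]) (simp add: l_def t)
  then have "0 \<le> (\<Sum>j\<in>UNIV. a j * l $ j)" using assms(2) by (simp add: dual_weights_def)
  also have "\<dots> = a i * l $ i + (\<Sum>j\<in>UNIV - {i}. a j * l $ j)" by (rule sum.remove) auto
  also have "(\<Sum>j\<in>UNIV - {i}. a j * l $ j) \<le> S" unfolding S_def by (intro sum_mono) (auto simp: l_def)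
  also have "a i * l $ i = - (S + 1)" using neg by (simp add: l_def t_def)
  finally show False by simp
qed

text \<open>The differential of the inversion at \<zeta> is this map times
  \<open>\<rho>\<^sup>2 / (norm \<zeta>)\<^sup>2\<close>. For \<open>\<zeta> = 0\<close> it is the
  identity.\<close>

definition reflection :: "real^'n \<Rightarrow> real^'n \<Rightarrow> real^'n" where
  "reflection \<zeta> h = h - (2 * (\<zeta> \<bullet> h) / (norm \<zeta>)\<^sup>2) *\<^sub>R \<zeta>"

lemma linear_reflection: "linear (reflection \<zeta>)"
  by (rule linearI) (simp_all add: reflection_def inner_add_right add_divide_distrib algebra_simps)

lemma reflection_self_adjoint: "reflection \<zeta> a \<bullet> b = a \<bullet> reflection \<zeta> b"
  by (simp add: reflection_def inner_diff_left inner_diff_right inner_commute)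

lemma reflection_inner [simp]: "reflection \<zeta> a \<bullet> reflection \<zeta> b = a \<bullet> b"
proof (cases "\<zeta> = 0")
  case False
  then have "(norm \<zeta>)\<^sup>2 \<noteq> 0" by simp
  then show ?thesis
    by (simp add: reflection_def inner_diff_left inner_diff_right inner_commute field_simps flip: power2_norm_eq_inner)
qed (simp add: reflection_def)

lemma norm_reflection [simp]: "norm (reflection \<zeta> a) = norm a"
  by (simp add: norm_eq_sqrt_inner)

abbreviation inversion :: "real \<Rightarrow> real^'n \<Rightarrow> real^'n \<Rightarrow> real^'n" where
  "inversion \<rho> x \<zeta> \<equiv> x + (\<rho>\<^sup>2 / (norm \<zeta>)\<^sup>2) *\<^sub>R \<zeta>"

text \<open>The Hessian at \<zeta> of the Kelvin transform \<open>(norm \<zeta>)\<^sup>2 /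
  \<rho>\<^sup>2 * f (inversion \<rho> x \<zeta>)\<close>, where \<open>f0\<close>,
  \<open>p\<close>, \<open>X\<close> form the jet of \<open>f\<close> at the inverted point;
  \<open>kelvin_grad\<close> is its gradient.\<close>

definition kelvin_hess :: "real \<Rightarrow> real^'n \<Rightarrow> real \<Rightarrow> real^'n \<Rightarrow> real^'n^'n \<Rightarrow> real^'n^'n" where
  "kelvin_hess \<rho> \<zeta> f0 p X = (2 * f0 / \<rho>\<^sup>2 - 2 * (p \<bullet> \<zeta>) / (norm \<zeta>)\<^sup>2) *\<^sub>R mat 1
     + (\<rho>\<^sup>2 / (norm \<zeta>)\<^sup>2) *\<^sub>R (transpose (matrix (reflection \<zeta>)) ** X ** matrix (reflection \<zeta>))"

definition kelvin_grad :: "real \<Rightarrow> real^'n \<Rightarrow> real \<Rightarrow> real^'n \<Rightarrow> real^'n" where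
  "kelvin_grad \<rho> \<zeta> f0 p = (2 * f0 / \<rho>\<^sup>2) *\<^sub>R \<zeta> + reflection \<zeta> p"

lemma transpose_kelvin_hess:
  assumes "transpose X = X" shows "transpose (kelvin_hess \<rho> \<zeta> f0 p X) = kelvin_hess \<rho> \<zeta> f0 p X"
proof -
  let ?R = "matrix (reflection \<zeta>)"
  have s: "transpose (transpose ?R ** X ** ?R) = transpose ?R ** X ** ?R"
    by (simp add: matrix_transpose_mul assms matrix_mul_assoc)
  have lin: "transpose (c *\<^sub>R mat 1 + b *\<^sub>R Y) = c *\<^sub>R mat 1 + b *\<^sub>R transpose Y" for c b and Y :: "real^'n^'n"
    by (auto simp: transpose_def vec_eq_iff mat_def)
  show ?thesis unfolding kelvin_hess_def lin s ..
qed

lemma kelvin_hess_quadratic: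
  "h \<bullet> (kelvin_hess \<rho> \<zeta> f0 p X *v h) = (2 * f0 / \<rho>\<^sup>2 - 2 * (p \<bullet> \<zeta>) / (norm \<zeta>)\<^sup>2) * (norm h)\<^sup>2
     + \<rho>\<^sup>2 / (norm \<zeta>)\<^sup>2 * (reflection \<zeta> h \<bullet> (X *v reflection \<zeta> h))"
proof -
  let ?R = "matrix (reflection \<zeta>)"
  have "?R *v h = reflection \<zeta> h"
    by (simp add: matrix_works linear_reflection)
  moreover have "h \<bullet> ((transpose ?R ** X ** ?R) *v h) = (?R *v h) \<bullet> (X *v (?R *v h))"
    by (metis dot_lmul_matrix matrix_vector_mul_assoc transpose_matrix_vector transpose_transpose)
  ultimately show ?thesis
    by (simp add: kelvin_hess_def matrix_vector_mult_add_rdistrib scaleR_matrix_vector_assoc[symmetric]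
        inner_add_right power2_norm_eq_inner)
qed

text \<open>Conformal invariance: the terms with \<open>f0\<close> and
  \<open>p \<bullet> \<zeta>\<close> cancel between the Hessian and the squared gradient, and only
  conjugation by the reflection is left. Reflections permute frames, so frame conditions carry over
  unchanged.\<close>

lemma conformal_jet_kelvin:
  assumes \<zeta>: "\<zeta> \<noteq> 0" and \<rho>: "0 < \<rho>" and e: "norm e = 1"
  shows "e \<bullet> (conformal_jet (f0 * (norm \<zeta>)\<^sup>2 / \<rho>\<^sup>2) (kelvin_grad \<rho> \<zeta> f0 p) (kelvin_hess \<rho> \<zeta> f0 p X) *v e)
    = reflection \<zeta> e \<bullet> (conformal_jet f0 p X *v reflection \<zeta> e)"
proof -
  have e': "norm (reflection \<zeta> e) = 1" using e by simp
  have n0: "(norm \<zeta>)\<^sup>2 \<noteq> 0" using \<zeta> by simp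
  have "\<zeta> \<bullet> reflection \<zeta> p = - (p \<bullet> \<zeta>)"
    using n0 by (simp add: reflection_def inner_diff_right power2_norm_eq_inner inner_commute)
  moreover have "(norm (reflection \<zeta> p))\<^sup>2 = (norm p)\<^sup>2" by simp
  moreover have "(norm (c *\<^sub>R \<zeta> + v))\<^sup>2 = c\<^sup>2 * (norm \<zeta>)\<^sup>2 + 2 * c * (\<zeta> \<bullet> v) + (norm v)\<^sup>2" for c v
    unfolding power2_norm_eq_inner by (simp add: inner_add_left inner_add_right inner_commute power2_eq_square algebra_simps)
  ultimately have g: "(norm (kelvin_grad \<rho> \<zeta> f0 p))\<^sup>2
      = (2 * f0 / \<rho>\<^sup>2)\<^sup>2 * (norm \<zeta>)\<^sup>2 - 2 * (2 * f0 / \<rho>\<^sup>2) * (p \<bullet> \<zeta>) + (norm p)\<^sup>2"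
    unfolding kelvin_grad_def by simp
  have *: "f0 * Z / L * ((2 * f0 / L - 2 * t / Z) * 1\<^sup>2 + L / Z * Q) - ((2 * f0 / L)\<^sup>2 * Z - 2 * (2 * f0 / L) * t + P) / 2
      = f0 * Q - P / 2" if "Z \<noteq> 0" "L \<noteq> 0" for Z L t Q P :: real
    using that by (simp add: field_simps power2_eq_square)
  show ?thesis
    unfolding conformal_jet_quadratic[OF e] conformal_jet_quadratic[OF e'] kelvin_hess_quadratic e g
    by (rule *) (use n0 \<rho> in simp_all)
qed

text \<open>The reflected increment \<open>m\<close> below is \<open>|\<zeta> + h|\<^sup>2 / \<rho>\<^sup>2\<close> times the increment of the inversion, and it is
  a polynomial in \<open>h\<close>.\<close>

lemma kelvin_jet:
  fixes f :: "real^'n \<Rightarrow> real"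
  assumes \<zeta>: "\<zeta> \<noteq> 0" and \<rho>: "0 < \<rho>" and X: "transpose X = X" and C: "0 \<le> C"
    and T: "\<And>k. norm k \<le> 1 \<Longrightarrow> jet2 f0 p X k - C * norm k ^ 3 \<le> f (inversion \<rho> x \<zeta> + k)"
  shows "\<exists>C' r. 0 < r \<and> (\<forall>h. norm h < r \<longrightarrow>
     f0 * (norm \<zeta>)\<^sup>2 / \<rho>\<^sup>2 + kelvin_grad \<rho> \<zeta> f0 p \<bullet> h + h \<bullet> (kelvin_hess \<rho> \<zeta> f0 p X *v h) / 2 - C' * norm h ^ 3
       \<le> (norm (\<zeta> + h))\<^sup>2 / \<rho>\<^sup>2 * f (inversion \<rho> x (\<zeta> + h)))"
proof -
  define z where "z = norm \<zeta>"
  have z: "0 < z" using \<zeta> by (simp add: z_def)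
  obtain K where K: "0 < K" "\<And>v. norm (X *v v) \<le> norm v * K"
    using bounded_linear.pos_bounded[OF matrix_vector_mul_bounded_linear[of X]] by blast
  have KX: "\<bar>a \<bullet> (X *v b)\<bar> \<le> norm a * (norm b * K)" for a b
    by (rule order_trans[OF Cauchy_Schwarz_ineq2]) (use K(2)[of b] in \<open>auto intro: mult_left_mono\<close>)
  \<comment> \<open>The first entry keeps \<open>\<zeta> + h\<close> away from the pole, the second
    keeps the increment \<open>k\<close> of the inversion in the unit ball, where \<open>T\<close>
    applies.\<close>
  define r where "r = min (z / 2) (z\<^sup>2 / (8 * \<rho>\<^sup>2))"
  have r: "0 < r" using z \<rho> by (simp add: r_def)
  \<comment> \<open>\<open>C1\<close> accounts for replacing \<open>a + b\<close> by
    \<open>a\<close> in the quadratic form, \<open>C2\<close> for replacing \<open>n1\<close> by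
    \<open>z\<^sup>2\<close>, and \<open>C3\<close> for the cubic error in the jet of
    \<open>f\<close>.\<close>
  define C1 where "C1 = \<rho>\<^sup>2 * (4 / z\<^sup>2) * (4 * K / z)"
  define C2 where "C2 = \<rho>\<^sup>2 * (16 / z ^ 3) * K"
  define C3 where "C3 = (4 * z\<^sup>2 / \<rho>\<^sup>2) * (C * (8 * \<rho>\<^sup>2 / z\<^sup>2) ^ 3)"
  have main: "f0 * (norm \<zeta>)\<^sup>2 / \<rho>\<^sup>2 + kelvin_grad \<rho> \<zeta> f0 p \<bullet> h + h \<bullet> (kelvin_hess \<rho> \<zeta> f0 p X *v h) / 2
      - (C1 + C2 + C3) * norm h ^ 3
      \<le> (norm (\<zeta> + h))\<^sup>2 / \<rho>\<^sup>2 * f (inversion \<rho> x (\<zeta> + h))" if h: "norm h < r" for h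
  proof -
    define n1 where "n1 = (norm (\<zeta> + h))\<^sup>2"
    define a where "a = reflection \<zeta> h"
    define b where "b = - ((norm h)\<^sup>2 / z\<^sup>2) *\<^sub>R \<zeta>"
    define k where "k = (\<rho>\<^sup>2 / n1) *\<^sub>R (a + b)"
    let ?n = "norm h"
    have hz: "?n \<le> z / 2" "?n \<le> z\<^sup>2 / (8 * \<rho>\<^sup>2)" using h by (auto simp: r_def)
    have "z / 2 \<le> norm (\<zeta> + h)" "norm (\<zeta> + h) \<le> 2 * z"
      using norm_triangle_ineq[of \<zeta> h] norm_diff_ineq[of \<zeta> h] hz(1) z unfolding z_def by linarith+
    then have "(z / 2)\<^sup>2 \<le> n1" "n1 \<le> (2 * z)\<^sup>2" unfolding n1_def using z by (intro power_mono; simp)+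
    then have n1: "z\<^sup>2 / 4 \<le> n1" "n1 \<le> 4 * z\<^sup>2" by (auto simp: power_divide power_mult_distrib)
    have z2: "0 < z\<^sup>2" using z by simp
    have n1p: "0 < n1" using n1 z2 by linarith
    have na: "norm a = ?n" by (simp add: a_def)
    have nb: "norm b = ?n\<^sup>2 / z" using z by (simp add: b_def z_def[symmetric] power2_eq_square)
    have nb': "norm b \<le> ?n"
    proof -
      have "?n * ?n \<le> ?n * z" using hz z by (intro mult_left_mono) auto
      then show ?thesis unfolding nb using z by (simp add: power2_eq_square divide_le_eq)
    qed
    have n1eq: "n1 = z\<^sup>2 + (2 * (\<zeta> \<bullet> h) + ?n\<^sup>2)"
      by (simp add: n1_def z_def power2_norm_eq_inner inner_add_left inner_add_right inner_commute)
    have ab: "a + b = h - ((2 * (\<zeta> \<bullet> h) + ?n\<^sup>2) / z\<^sup>2) *\<^sub>R \<zeta>"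
      by (simp add: a_def b_def reflection_def z_def[symmetric] add_divide_distrib scaleR_add_left)
    have inv: "x + (\<rho>\<^sup>2 / n1) *\<^sub>R (\<zeta> + h) = x + (\<rho>\<^sup>2 / z\<^sup>2) *\<^sub>R \<zeta> + k"
    proof -
      have c: "\<rho>\<^sup>2 / n1 = \<rho>\<^sup>2 / z\<^sup>2 - \<rho>\<^sup>2 / n1 * ((2 * (\<zeta> \<bullet> h) + ?n\<^sup>2) / z\<^sup>2)"
      proof -
        have \<tau>: "2 * (\<zeta> \<bullet> h) + ?n\<^sup>2 = n1 - z\<^sup>2" using n1eq by simp
        show ?thesis unfolding \<tau> using n1p z by (simp add: field_simps)
      qed
      have "k = (\<rho>\<^sup>2 / n1) *\<^sub>R h - (\<rho>\<^sup>2 / n1 * ((2 * (\<zeta> \<bullet> h) + ?n\<^sup>2) / z\<^sup>2)) *\<^sub>R \<zeta>"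
        unfolding k_def ab scaleR_diff_right by simp
      moreover have "(\<rho>\<^sup>2 / n1) *\<^sub>R \<zeta> = (\<rho>\<^sup>2 / z\<^sup>2) *\<^sub>R \<zeta> - (\<rho>\<^sup>2 / n1 * ((2 * (\<zeta> \<bullet> h) + ?n\<^sup>2) / z\<^sup>2)) *\<^sub>R \<zeta>"
        using arg_cong[OF c, of "\<lambda>t. t *\<^sub>R \<zeta>"] unfolding scaleR_diff_left .
      ultimately show ?thesis by (simp add: scaleR_add_right)
    qed
    have combine: "A \<le> F \<Longrightarrow> A = g + g' + v - e \<Longrightarrow> e \<le> E3 \<Longrightarrow> \<bar>v - v'\<bar> \<le> E1 \<Longrightarrow> \<bar>v' - v''\<bar> \<le> E2 \<Longrightarrow>
        g + g' + v'' = H + H' + H'' \<Longrightarrow> H + H' + H'' - (E1 + E2 + E3) \<le> F"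
      for A F g g' v v' v'' e E1 E2 E3 H H' H'' :: real by linarith
    have l4: "\<rho>\<^sup>2 / n1 \<le> \<rho>\<^sup>2 * (4 / z\<^sup>2)"
    proof -
      have "\<rho>\<^sup>2 / n1 \<le> \<rho>\<^sup>2 / (z\<^sup>2 / 4)"
        by (rule divide_left_mono[OF n1(1) zero_le_power2 mult_pos_pos[OF n1p]]) (use z in simp)
      then show ?thesis by (simp add: mult.commute)
    qed
    have nk: "norm k \<le> 8 * \<rho>\<^sup>2 / z\<^sup>2 * ?n"
    proof -
      have "norm k = \<rho>\<^sup>2 / n1 * norm (a + b)" using n1p by (simp add: k_def)
      also have "\<dots> \<le> \<rho>\<^sup>2 * (4 / z\<^sup>2) * (2 * ?n)"
        using l4 norm_triangle_ineq[of a b] na nb' n1p by (intro mult_mono) auto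
      finally show ?thesis by simp
    qed
    have nk1: "norm k \<le> 1"
    proof -
      have "8 * \<rho>\<^sup>2 / z\<^sup>2 * ?n \<le> 8 * \<rho>\<^sup>2 / z\<^sup>2 * (z\<^sup>2 / (8 * \<rho>\<^sup>2))"
        using hz(2) by (intro mult_left_mono) auto
      also have "\<dots> = 1" using z \<rho> by simp
      finally show ?thesis using nk by linarith
    qed
    have "n1 / \<rho>\<^sup>2 * (jet2 f0 p X k - C * norm k ^ 3) \<le> n1 / \<rho>\<^sup>2 * f (x + (\<rho>\<^sup>2 / n1) *\<^sub>R (\<zeta> + h))"
      unfolding inv using T[OF nk1] n1p by (intro mult_left_mono) (auto simp: z_def)
    moreover have "n1 / \<rho>\<^sup>2 * (jet2 f0 p X k - C * norm k ^ 3)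
      = n1 / \<rho>\<^sup>2 * f0 + p \<bullet> (a + b) + \<rho>\<^sup>2 / n1 * ((a + b) \<bullet> (X *v (a + b))) / 2 - n1 / \<rho>\<^sup>2 * (C * norm k ^ 3)"
    proof -
      have "n1 / \<rho>\<^sup>2 * (p \<bullet> k) = p \<bullet> (a + b)" using n1p \<rho> by (simp add: k_def)
      moreover have "n1 / \<rho>\<^sup>2 * (k \<bullet> (X *v k)) = \<rho>\<^sup>2 / n1 * ((a + b) \<bullet> (X *v (a + b)))"
      proof -
        have *: "N / L * (L / N * (L / N * Q)) = L / N * Q" if "0 < N" "0 < L" for N L Q :: real
          using that by simp
        have kk: "k \<bullet> (X *v k) = \<rho>\<^sup>2 / n1 * (\<rho>\<^sup>2 / n1 * ((a + b) \<bullet> (X *v (a + b))))"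
          unfolding k_def matrix_vector_mult_scaleR inner_scaleR_left inner_scaleR_right ..
        show ?thesis unfolding kk by (rule *) (use n1p \<rho> in simp_all)
      qed
      ultimately show ?thesis by (simp add: distrib_left right_diff_distrib)
    qed
    moreover have "n1 / \<rho>\<^sup>2 * (C * norm k ^ 3) \<le> C3 * ?n ^ 3"
    proof -
      have "norm k ^ 3 \<le> (8 * \<rho>\<^sup>2 / z\<^sup>2 * ?n) ^ 3" using nk by (intro power_mono) auto
      then have e1: "C * norm k ^ 3 \<le> C * (8 * \<rho>\<^sup>2 / z\<^sup>2 * ?n) ^ 3" using C by (intro mult_left_mono)
      have e2: "n1 / \<rho>\<^sup>2 \<le> 4 * z\<^sup>2 / \<rho>\<^sup>2" using n1 by (intro divide_right_mono) auto
      have "n1 / \<rho>\<^sup>2 * (C * norm k ^ 3) \<le> 4 * z\<^sup>2 / \<rho>\<^sup>2 * (C * (8 * \<rho>\<^sup>2 / z\<^sup>2 * ?n) ^ 3)"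
        by (rule mult_mono[OF e2 e1]) (use C in auto)
      then show ?thesis by (simp only: C3_def power_mult_distrib mult.assoc)
    qed
    moreover have "\<bar>\<rho>\<^sup>2 / n1 * ((a + b) \<bullet> (X *v (a + b))) / 2 - \<rho>\<^sup>2 / n1 * (a \<bullet> (X *v a)) / 2\<bar> \<le> C1 * ?n ^ 3"
    proof -
      have "(a + b) \<bullet> (X *v (a + b)) - a \<bullet> (X *v a) = 2 * (b \<bullet> (X *v a)) + b \<bullet> (X *v b)"
        using inner_symmetric_matrix[OF X, of a b]
        by (simp add: matrix_vector_right_distrib inner_add_left inner_add_right)
      moreover have "\<bar>b \<bullet> (X *v a)\<bar> \<le> ?n\<^sup>2 / z * (?n * K)" using KX[of b a] by (simp add: na nb)
      moreover have "\<bar>b \<bullet> (X *v b)\<bar> \<le> ?n\<^sup>2 / z * (?n * K)"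
      proof -
        have "norm b * (norm b * K) \<le> ?n\<^sup>2 / z * (?n * K)"
          using nb nb' K(1) z by (intro mult_mono) auto
        then show ?thesis using KX[of b b] by linarith
      qed
      ultimately have "\<bar>(a + b) \<bullet> (X *v (a + b)) - a \<bullet> (X *v a)\<bar> \<le> 3 * (?n\<^sup>2 / z * (?n * K))" by linarith
      also have "\<dots> \<le> 4 * K / z * ?n ^ 3"
        using K(1) z by (simp add: power2_eq_square power3_eq_cube field_simps)
      finally have d: "\<bar>(a + b) \<bullet> (X *v (a + b)) - a \<bullet> (X *v a)\<bar> \<le> 4 * K / z * ?n ^ 3" .
      have "\<rho>\<^sup>2 / n1 * ((a + b) \<bullet> (X *v (a + b))) / 2 - \<rho>\<^sup>2 / n1 * (a \<bullet> (X *v a)) / 2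
        = \<rho>\<^sup>2 / n1 * (((a + b) \<bullet> (X *v (a + b)) - a \<bullet> (X *v a)) / 2)"
        by (simp add: right_diff_distrib diff_divide_distrib)
      also have "\<bar>\<dots>\<bar> \<le> \<rho>\<^sup>2 * (4 / z\<^sup>2) * (4 * K / z * ?n ^ 3)"
        unfolding abs_mult using l4 d n1p by (intro mult_mono) auto
      finally show ?thesis by (simp only: C1_def mult.assoc)
    qed
    moreover have "\<bar>\<rho>\<^sup>2 / n1 * (a \<bullet> (X *v a)) / 2 - \<rho>\<^sup>2 / z\<^sup>2 * (a \<bullet> (X *v a)) / 2\<bar> \<le> C2 * ?n ^ 3"
    proof -
      have "\<bar>\<zeta> \<bullet> h\<bar> \<le> z * ?n" unfolding z_def by (rule Cauchy_Schwarz_ineq2)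
      moreover have "?n\<^sup>2 \<le> z * ?n" using hz z by (simp add: power2_eq_square mult_right_mono)
      ultimately have t: "\<bar>n1 - z\<^sup>2\<bar> \<le> 4 * (z * ?n)" unfolding n1eq using zero_le_power2[of ?n] by linarith
      have "\<rho>\<^sup>2 / n1 - \<rho>\<^sup>2 / z\<^sup>2 = (\<rho>\<^sup>2 / n1) * (- (n1 - z\<^sup>2) / z\<^sup>2)"
        using n1p z2 by (simp add: field_simps)
      also have "\<bar>\<dots>\<bar> \<le> \<rho>\<^sup>2 * (4 / z\<^sup>2) * (4 * (z * ?n) / z\<^sup>2)"
        unfolding abs_mult using l4 t n1p z2 by (intro mult_mono) (auto intro: divide_right_mono)
      also have "\<dots> = \<rho>\<^sup>2 * (16 / z ^ 3) * ?n"
        using z by (simp add: power2_eq_square power3_eq_cube)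
      finally have c: "\<bar>\<rho>\<^sup>2 / n1 - \<rho>\<^sup>2 / z\<^sup>2\<bar> \<le> \<rho>\<^sup>2 * (16 / z ^ 3) * ?n" .
      have "\<bar>(a \<bullet> (X *v a)) / 2\<bar> \<le> ?n\<^sup>2 * K"
        using KX[of a a] K(1) by (simp add: na power2_eq_square)
      then have "\<bar>(\<rho>\<^sup>2 / n1 - \<rho>\<^sup>2 / z\<^sup>2) * ((a \<bullet> (X *v a)) / 2)\<bar> \<le> \<rho>\<^sup>2 * (16 / z ^ 3) * ?n * (?n\<^sup>2 * K)"
        unfolding abs_mult using c z by (intro mult_mono) auto
      also have "\<dots> = C2 * ?n ^ 3" by (simp add: C2_def power2_eq_square power3_eq_cube)
      finally show ?thesis by (simp add: left_diff_distrib)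
    qed
    moreover have "n1 / \<rho>\<^sup>2 * f0 + p \<bullet> (a + b) + \<rho>\<^sup>2 / z\<^sup>2 * (a \<bullet> (X *v a)) / 2
      = f0 * z\<^sup>2 / \<rho>\<^sup>2 + kelvin_grad \<rho> \<zeta> f0 p \<bullet> h + h \<bullet> (kelvin_hess \<rho> \<zeta> f0 p X *v h) / 2"
    proof -
      have *: "(Z + (2 * s + H)) / L * f0 + (w + - t / Z * H) + L / Z * Q / 2
        = f0 * Z / L + ((2 * f0 / L) * s + w) + ((2 * f0 / L - 2 * t / Z) * H + L / Z * Q) / 2"
        if "Z \<noteq> 0" "L \<noteq> 0" for Z s H L w t Q :: real
        using that by (simp add: field_simps)
      have pa: "p \<bullet> a = reflection \<zeta> p \<bullet> h" by (simp add: a_def reflection_self_adjoint)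
      have pb: "p \<bullet> b = - (p \<bullet> \<zeta>) / z\<^sup>2 * ?n\<^sup>2" by (simp add: b_def)
      show ?thesis
        unfolding kelvin_hess_quadratic kelvin_grad_def n1eq z_def[symmetric] a_def[symmetric]
          inner_add_right inner_add_left inner_scaleR_left pa pb
        by (rule *) (use z \<rho> in simp_all)
    qed
    ultimately have "f0 * z\<^sup>2 / \<rho>\<^sup>2 + kelvin_grad \<rho> \<zeta> f0 p \<bullet> h + h \<bullet> (kelvin_hess \<rho> \<zeta> f0 p X *v h) / 2
       - (C1 * ?n ^ 3 + C2 * ?n ^ 3 + C3 * ?n ^ 3) \<le> n1 / \<rho>\<^sup>2 * f (x + (\<rho>\<^sup>2 / n1) *\<^sub>R (\<zeta> + h))"
      by (rule combine)
    then show ?thesis by (simp only: distrib_right n1_def z_def)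
  qed
  show ?thesis
    by (rule exI[of _ "C1 + C2 + C3"], rule exI[of _ r], intro conjI allI impI r) (rule main)
qed

section \<open>Strict subsolutions and moving spheres\<close>

text \<open>The bound is the minimum over \<open>b\<close> of \<open>2 - 2 b \<bullet> x + |b|\<^sup>2 (1 + |x|\<^sup>2) / 2\<close>.\<close>

lemma round_sphere_strict:
  fixes b x :: "'a::real_inner"
  shows "2 / (1 + (norm x)\<^sup>2) \<le> 2 - 2 * (b \<bullet> x) + (norm b)\<^sup>2 * (1 + (norm x)\<^sup>2) / 2"
proof -
  define N where "N = 1 + (norm x)\<^sup>2"
  have N: "0 < N" by (simp add: N_def add_pos_nonneg)
  have "0 \<le> (norm b * N - 2 * norm x)\<^sup>2" by simp
  also have "\<dots> = (norm b)\<^sup>2 * N\<^sup>2 - 4 * (norm b * norm x) * N + 4 * (N - 1)"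
    by (simp add: N_def power2_eq_square algebra_simps)
  finally have "4 \<le> (4 - 4 * (norm b * norm x) + (norm b)\<^sup>2 * N) * N"
    by (simp add: power2_eq_square algebra_simps)
  then have "4 / N \<le> 4 - 4 * (norm b * norm x) + (norm b)\<^sup>2 * N" using N by (simp add: pos_divide_le_eq)
  moreover have "b \<bullet> x \<le> norm b * norm x" by (rule norm_cauchy_schwarz)
  moreover have "2 / N = 4 / N / 2" by simp
  ultimately show ?thesis unfolding N_def[symmetric] by linarith
qed

text \<open>The linearised condition in the form required of a generator: the square roots use that
  dual weights are nonnegative, and the drift stems from \<open>b \<bullet> q\<close>.\<close>

abbreviation frame_generator where
  "frame_generator a E b \<equiv> generator (\<lambda>i. sqrt (a i) *\<^sub>R E $ i) (- sum a UNIV *\<^sub>R b)"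

lemma frame_generator:
  assumes "\<And>i. 0 \<le> a i"
  shows "frame_generator a E b q Y = weighted_diagonal a E Y - sum a UNIV * (b \<bullet> q)"
  using assms by (simp add: generator_def matrix_vector_mult_scaleR mult.assoc[symmetric])

text \<open>Only a lower jet is recorded, since Kelvin transforms of multiples of \<open>f\<close>
  are to touch \<open>w\<close> from below.\<close>

definition strict_subsolution_at :: "(real^'n) set \<Rightarrow> (real^'n \<Rightarrow> real) \<Rightarrow> real^'n \<Rightarrow> bool" where
  "strict_subsolution_at \<Gamma> f x \<longleftrightarrow> (\<exists>p X C \<kappa>. transpose X = X \<and> 0 \<le> C \<and> 0 < \<kappa> \<and>
     (\<forall>h. norm h \<le> 1 \<longrightarrow> jet2 (f x) p X h - C * norm h ^ 3 \<le> f (x + h)) \<and>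
     (\<forall>E a. orthonormal E \<longrightarrow> a \<in> dual_weights \<Gamma> \<longrightarrow>
        \<kappa> * sum a UNIV \<le> weighted_diagonal a E (conformal_jet (f x) p X)))"

text \<open>What is kept of the equation: \<open>u\<close> and the eigenvalues are gone, and only
  frames, dual weights and jets of the conformal factor occur.\<close>

locale conformal_solution =
  fixes \<Omega> \<Gamma> :: "(real^'n) set" and w :: "real^'n \<Rightarrow> real"
  assumes open_\<Omega>: "open \<Omega>" and pos_\<Gamma>: "{l. \<forall>i. l $ i > 0} \<subseteq> \<Gamma>"
    and cont: "continuous_on \<Omega> w" and w_pos: "\<And>x. x \<in> \<Omega> \<Longrightarrow> 0 < w x"
    and upper: "\<And>x q Y C r E a. x \<in> \<Omega> \<Longrightarrow> transpose Y = Y \<Longrightarrow> 0 < r \<Longrightarrow>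
      (\<And>h. norm h < r \<Longrightarrow> w (x + h) \<le> jet2 (w x) q Y h + C * norm h ^ 3) \<Longrightarrow>
      orthonormal E \<Longrightarrow> a \<in> dual_weights \<Gamma> \<Longrightarrow>
      0 \<le> weighted_diagonal a E (conformal_jet (w x) q Y)"
    and lower: "\<And>x q Y C r c. x \<in> \<Omega> \<Longrightarrow> transpose Y = Y \<Longrightarrow> 0 < r \<Longrightarrow>
      (\<And>h. norm h < r \<Longrightarrow> jet2 (w x) q Y h - C * norm h ^ 3 \<le> w (x + h)) \<Longrightarrow> 0 < c \<Longrightarrow>
      (\<And>E a. orthonormal E \<Longrightarrow> a \<in> dual_weights \<Gamma> \<Longrightarrow>
        c * sum a UNIV \<le> weighted_diagonal a E (conformal_jet (w x) q Y)) \<Longrightarrow> False"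
begin

section \<open>Strict subsolutions by mollification\<close>

lemma sum_conformal_jet:
  assumes "orthonormal E"
  shows "weighted_diagonal a E (conformal_jet f0 p X)
    = f0 * weighted_diagonal a E X - (norm p)\<^sup>2 / 2 * sum a UNIV"
proof -
  have "a i * (f0 * t - (norm p)\<^sup>2 / 2) = f0 * (a i * t) - (norm p)\<^sup>2 / 2 * a i" for i t
    by (simp add: right_diff_distrib)
  then show ?thesis
    unfolding conformal_jet_quadratic[OF orthonormal_norm[OF assms]] by (simp only: sum_subtractf sum_distrib_left)
qed

text \<open>As \<open>|q|\<^sup>2 / (2 w)\<close> is the maximum over \<open>b\<close> of \<open>b \<bullet> q - |b|\<^sup>2 w / 2\<close>, the condition on \<open>w\<close> amounts to a
  family of linear inequalities with constant coefficients, which mollification preserves.\<close>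

lemma linear_upper:
  assumes x: "x \<in> \<Omega>" and Y: "transpose Y = Y" and r: "0 < r"
    and jet: "\<And>h. norm h < r \<Longrightarrow> w (x + h) \<le> jet2 (w x) q Y h + C * norm h ^ 3"
    and E: "orthonormal E" and a: "a \<in> dual_weights \<Gamma>"
  defines "s \<equiv> sum a UNIV"
  shows "0 \<le> frame_generator a E b q Y + s * (norm b)\<^sup>2 / 2 * w x"
proof -
  have a0: "0 \<le> a i" for i by (rule dual_weights_nonneg[OF pos_\<Gamma> a])
  have s: "0 \<le> s" unfolding s_def by (intro sum_nonneg a0)
  have w0: "0 < w x" using x by (rule w_pos)
  define S where "S = weighted_diagonal a E Y"
  have gen: "frame_generator a E b q Y = S - s * (b \<bullet> q)"
    unfolding S_def s_def by (rule frame_generator[OF a0])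
  have "0 \<le> w x * S - (norm q)\<^sup>2 / 2 * s"
    using upper[OF x Y r jet E a] unfolding sum_conformal_jet[OF E] S_def s_def .
  \<comment> \<open>The square is \<open>2 * w x\<close> times the defect in the inequality of |q|^2
    / (2 w) with the value at \<open>b\<close>.\<close>
  moreover have "0 \<le> s * ((norm (q - w x *\<^sub>R b))\<^sup>2 / 2)" using s by simp
  moreover have "(norm (q - w x *\<^sub>R b))\<^sup>2 = (norm q)\<^sup>2 - 2 * w x * (b \<bullet> q) + (w x)\<^sup>2 * (norm b)\<^sup>2"
    unfolding power2_norm_eq_inner
    by (simp add: inner_diff_left inner_diff_right inner_commute power2_eq_square algebra_simps)
  moreover have "w x * (S - s * (b \<bullet> q) + s * (norm b)\<^sup>2 / 2 * w x)
    = (w x * S - (norm q)\<^sup>2 / 2 * s) + s * (((norm q)\<^sup>2 - 2 * w x * (b \<bullet> q) + (w x)\<^sup>2 * (norm b)\<^sup>2) / 2)"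
    by (simp add: power2_eq_square field_simps)
  ultimately have "0 \<le> w x * (S - s * (b \<bullet> q) + s * (norm b)\<^sup>2 / 2 * w x)"
    by (simp only: add_nonneg_nonneg)
  then show ?thesis unfolding gen using w0 by (simp add: zero_le_mult_iff)
qed

text \<open>The function \<open>1 + |x|^2\<close> is the conformal factor of the round sphere, for
  which w D^2w - |Dw|^2 / 2 I is twice the identity; adding a small multiple creates the
  margin.\<close>

lemma smooth_subsolution:
  assumes R: "0 < R" "cball c (4 * R) \<subseteq> \<Omega>" and e: "0 < e"
  shows "\<exists>f. continuous_on UNIV f \<and>
    (\<forall>x\<in>cball c (2 * R). \<bar>f x - w x\<bar> \<le> e \<and> 0 < f x \<and> strict_subsolution_at \<Gamma> f x)"
proof -
  let ?B = "cball c (4 * R)"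
  have B: "closed ?B" "convex ?B" "?B \<noteq> {}" using R by auto
  \<comment> \<open>Extends \<open>w\<close> from the ball to a bounded, uniformly continuous
    function on the whole space, as the mollification result demands.\<close>
  define v where "v = (\<lambda>x. w (closest_point ?B x))"
  have vw: "v x = w x" if "x \<in> ?B" for x using that by (simp add: v_def closest_point_self)
  have inB: "closest_point ?B x \<in> ?B" for x using B by (intro closest_point_in_set)
  have contB: "continuous_on ?B w" by (rule continuous_on_subset[OF cont R(2)])
  have v_unif: "uniformly_continuous_on UNIV v"
  proof -
    have "uniformly_continuous_on UNIV (closest_point ?B)"
      unfolding uniformly_continuous_on_def
    proof (intro allI impI)
      fix e :: real assume "0 < e"
      then show "\<exists>d>0. \<forall>x\<in>UNIV. \<forall>x'\<in>UNIV. dist x' x < d \<longrightarrow> dist (closest_point ?B x') (closest_point ?B x) < e"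
        by (intro exI[of _ e] conjI ballI impI) (auto intro: le_less_trans[OF closest_point_lipschitz[OF B(2,1,3)]])
    qed
    moreover have "uniformly_continuous_on (closest_point ?B ` UNIV) w"
    proof -
      have "closest_point ?B ` UNIV \<subseteq> ?B" using inB by blast
      then show ?thesis
        using compact_uniformly_continuous[OF contB compact_cball]
        unfolding uniformly_continuous_on_def by (meson subsetD)
    qed
    ultimately show ?thesis unfolding v_def by (rule uniformly_continuous_on_compose)
  qed
  then have v_cont: "continuous_on UNIV v" by (rule uniformly_continuous_imp_continuous)
  obtain xm where xm: "xm \<in> ?B" "\<And>x. x \<in> ?B \<Longrightarrow> w xm \<le> w x"
    using continuous_attains_inf[OF compact_cball B(3) contB] by blast
  obtain xM where xM: "xM \<in> ?B" "\<And>x. x \<in> ?B \<Longrightarrow> w x \<le> w xM"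
    using continuous_attains_sup[OF compact_cball B(3) contB] by blast
  have wxm: "0 < w xm" using xm(1) R(2) w_pos by blast
  have v_lower: "w xm \<le> v x" and v_upper: "v x \<le> w xM" for x
    using inB xm(2) xM(2) by (auto simp: v_def)
  have v_bdd: "\<bar>v x\<bar> \<le> w xM" for x using v_lower[of x] v_upper[of x] wxm by linarith
  obtain s where s: "0 < s" "\<And>x y. dist y x < s \<Longrightarrow> dist (v y) (v x) < e / 2"
    using v_unif half_gt_zero[OF e] unfolding uniformly_continuous_on_def by blast
  define r where "r = min (s / 2) (R / 2)"
  have r: "0 < r" "r < s" "r \<le> R / 2" using s R by (auto simp: r_def)
  define N where "N = 1 + (norm c + 2 * R)\<^sup>2"
  have N: "0 < N" by (simp add: N_def add_pos_nonneg)
  \<comment> \<open>\<open>N\<close> bounds \<open>1 + (norm x)\<^sup>2\<close> on the ball of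
    radius \<open>2 * R\<close>, so the added term uses at most half of \<open>e\<close>.\<close>
  define \<delta> where "\<delta> = e / (2 * N)"
  have \<delta>: "0 < \<delta>" using e N by (simp add: \<delta>_def)
  define f where "f = (\<lambda>x. moll r v x + \<delta> * (1 + (norm x)\<^sup>2))"
  have moll_lower: "w xm \<le> moll r v x" for x
    using moll_mono[of "\<lambda>_. w xm" v r x] v_cont v_lower r(1) by (simp add: moll_const)
  have fpos: "0 < f x" for x using moll_lower[of x] wxm \<delta> by (simp add: f_def add_pos_nonneg)
  show ?thesis
  proof (intro exI[of _ f] conjI ballI)
    show "continuous_on UNIV f"
      unfolding f_def by (intro continuous_intros continuous_on_moll[OF v_cont r(1) v_bdd])
    show "0 < f x" for x by (rule fpos)
    show "\<bar>f x - w x\<bar> \<le> e" if x: "x \<in> cball c (2 * R)" for x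
    proof -
      have "\<bar>moll r v x - v x\<bar> \<le> e / 2"
      proof (rule moll_close[OF v_cont r(1)])
        show "\<bar>v (x + z) - v x\<bar> \<le> e / 2" if "norm z \<le> r" for z
          using s(2)[of "x + z" x] that r(2) by (simp add: dist_norm)
      qed
      moreover have "v x = w x" using x R by (intro vw) (simp add: mem_cball)
      moreover have "norm x \<le> norm c + 2 * R"
        using x norm_triangle_ineq2[of x c] by (simp add: dist_norm norm_minus_commute)
      then have "(norm x)\<^sup>2 \<le> (norm c + 2 * R)\<^sup>2" by (intro power_mono) auto
      then have "\<delta> * (1 + (norm x)\<^sup>2) \<le> \<delta> * N" using \<delta> by (intro mult_left_mono) (auto simp: N_def)
      moreover have "\<delta> * N = e / 2" using N by (simp add: \<delta>_def)
      moreover have "0 \<le> \<delta> * (1 + (norm x)\<^sup>2)" using \<delta> by simp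
      ultimately show ?thesis unfolding f_def by linarith
    qed
    fix x assume x: "x \<in> cball c (2 * R)"
    obtain C p0 X0 where T: "taylor2 C (moll r v) x p0 X0"
      using moll_taylor2[OF r(1), where ?'n = 'n] v_cont v_bdd by blast
    have C: "0 \<le> C" using T norm_ge_zero[of p0] unfolding taylor2_def by linarith
    define p where "p = p0 + (2 * \<delta>) *\<^sub>R x"
    define X where "X = X0 + (2 * \<delta>) *\<^sub>R mat 1"
    define F where "F = f x"
    define F0 where "F0 = moll r v x"
    have F: "0 < F" using fpos by (simp add: F_def)
    \<comment> \<open>The maximiser in the linearisation at the jet of \<open>f\<close>, so that
      nothing is lost on returning from the linear inequality to the quadratic one.\<close>
    define b where "b = (1 / F) *\<^sub>R p"
    have pb: "p = F *\<^sub>R b" using F by (simp add: b_def)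
    define \<kappa> where "\<kappa> = F * \<delta> * (2 / (1 + (norm x)\<^sup>2))"
    have \<kappa>: "0 < \<kappa>" using F \<delta> by (simp add: \<kappa>_def add_pos_nonneg)
    have X: "transpose X = X"
      using T by (auto simp: X_def taylor2_def transpose_def vec_eq_iff mat_def)
    have jet: "jet2 (f x) p X h - C * norm h ^ 3 \<le> f (x + h)" if h: "norm h \<le> 1" for h
    proof -
      have "\<bar>moll r v (x + h) - moll r v x - p0 \<bullet> h - h \<bullet> (X0 *v h) / 2\<bar> \<le> C * norm h ^ 3"
        using T h unfolding taylor2_def by blast
      moreover have "(norm (x + h))\<^sup>2 = (norm x)\<^sup>2 + 2 * (x \<bullet> h) + (norm h)\<^sup>2"
        by (simp add: power2_norm_eq_inner inner_add_left inner_add_right inner_commute)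
      then have "\<delta> * (1 + (norm (x + h))\<^sup>2) = \<delta> * (1 + (norm x)\<^sup>2) + (2 * \<delta>) * (x \<bullet> h) + \<delta> * (norm h)\<^sup>2"
        by (simp add: distrib_left)
      moreover have "h \<bullet> (X *v h) / 2 = h \<bullet> (X0 *v h) / 2 + \<delta> * (norm h)\<^sup>2"
        by (simp add: X_def matrix_vector_mult_add_rdistrib scaleR_matrix_vector_assoc[symmetric] inner_add_right
            power2_norm_eq_inner add_divide_distrib)
      moreover have "p \<bullet> h = p0 \<bullet> h + (2 * \<delta>) * (x \<bullet> h)" by (simp add: p_def inner_add_left)
      ultimately show ?thesis unfolding f_def by linarith
    qed
    have strict: "\<kappa> * sum a UNIV \<le> weighted_diagonal a E (conformal_jet (f x) p X)"
      if E: "orthonormal E" and a: "a \<in> dual_weights \<Gamma>" for E :: "real^'n^'n" and a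
    proof -
      define S where "S = sum a UNIV"
      define S0 where "S0 = weighted_diagonal a E X0"
      have a0: "0 \<le> a i" for i by (rule dual_weights_nonneg[OF pos_\<Gamma> a])
      have S: "0 \<le> S" unfolding S_def by (intro sum_nonneg a0)
      have gen: "frame_generator a E b p0 X0 = S0 - S * (b \<bullet> p0)"
        unfolding S0_def S_def by (rule frame_generator[OF a0])
      \<comment> \<open>The open ball serves as \<open>U\<close> because there jets of the extension
        \<open>v\<close> are jets of \<open>w\<close>.\<close>
      have "0 \<le> frame_generator a E b p0 X0 + S * (norm b)\<^sup>2 / 2 * moll r v x"
      proof (rule viscosity_moll[OF v_unif v_bdd _ _ r(1) _ _ T, where U = "ball c (4 * R)" and R = R])
        show "0 \<le> S * (norm b)\<^sup>2 / 2" using S by simp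
        show "0 < R" by (rule R(1))
        show "cball x (r + R) \<subseteq> ball c (4 * R)"
        proof
          fix y assume "y \<in> cball x (r + R)"
          then have "dist c y \<le> 2 * R + (r + R)" using x dist_triangle[of c y x] by simp
          then show "y \<in> ball c (4 * R)" using r(3) R(1) by simp
        qed
        fix y q Y C' r' assume y: "y \<in> ball c (4 * R)" and Y: "transpose Y = Y" and r': "0 < r'"
          and jet: "\<And>h. norm h < r' \<Longrightarrow> v (y + h) \<le> jet2 (v y) q Y h + C' * norm h ^ 3"
        have yB: "y \<in> ?B" using y by auto
        have "0 \<le> frame_generator a E b q Y + S * (norm b)\<^sup>2 / 2 * w y"
          unfolding S_def
        proof (rule linear_upper[OF _ Y _ _ E a, where r = "min r' (4 * R - dist c y)"])
          show "y \<in> \<Omega>" using yB R(2) by blast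
          show "0 < min r' (4 * R - dist c y)" using y r' by simp
          fix h :: "real^'n" assume h: "norm h < min r' (4 * R - dist c y)"
          have "y + h \<in> ?B" using h dist_triangle[of c "y + h" y] by (simp add: dist_norm)
          then show "w (y + h) \<le> jet2 (w y) q Y h + C' * norm h ^ 3"
            using jet[of h] h vw yB by simp
        qed
        then show "0 \<le> frame_generator a E b q Y + S * (norm b)\<^sup>2 / 2 * v y"
          using vw[OF yB] by simp
      qed
      then have lin: "0 \<le> S0 - S * (b \<bullet> p0) + S * (norm b)\<^sup>2 / 2 * F0" unfolding gen F0_def .
      have F0: "F0 = F - \<delta> * (1 + (norm x)\<^sup>2)" by (simp add: F0_def F_def f_def)
      have p0: "b \<bullet> p0 = F * (norm b)\<^sup>2 - 2 * \<delta> * (b \<bullet> x)"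
      proof -
        have "p0 = F *\<^sub>R b - (2 * \<delta>) *\<^sub>R x" using pb by (simp add: p_def algebra_simps)
        then show ?thesis by (simp add: inner_diff_right power2_norm_eq_inner)
      qed
      have SX: "weighted_diagonal a E X = S0 + 2 * \<delta> * S"
      proof -
        have "a i * (E $ i \<bullet> (X *v E $ i)) = a i * (E $ i \<bullet> (X0 *v E $ i)) + 2 * \<delta> * a i" for i
          using orthonormal_norm[OF E, of i]
          by (simp add: X_def matrix_vector_mult_add_rdistrib scaleR_matrix_vector_assoc[symmetric]
              inner_add_right distrib_left norm_eq_1)
        then show ?thesis by (simp only: S0_def S_def sum.distrib sum_distrib_left)
      qed
      have np: "(norm p)\<^sup>2 = F\<^sup>2 * (norm b)\<^sup>2" by (simp add: pb power_mult_distrib)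
      define T where "T = 2 - 2 * (b \<bullet> x) + (norm b)\<^sup>2 * (1 + (norm x)\<^sup>2) / 2"
      have "\<kappa> * S = S * F * \<delta> * (2 / (1 + (norm x)\<^sup>2))" by (simp add: \<kappa>_def)
      also have "\<dots> \<le> S * F * \<delta> * T"
        unfolding T_def using S F \<delta> by (intro mult_left_mono round_sphere_strict) auto
      also have "\<dots> = F * (S * (b \<bullet> p0) - S * (norm b)\<^sup>2 / 2 * F0 + 2 * \<delta> * S) - F\<^sup>2 * (norm b)\<^sup>2 / 2 * S"
        unfolding F0 p0 T_def by (simp add: field_simps power2_eq_square)
      also have "\<dots> \<le> F * (S0 + 2 * \<delta> * S) - F\<^sup>2 * (norm b)\<^sup>2 / 2 * S"
        using lin F by (intro diff_right_mono mult_left_mono) auto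
      finally show ?thesis
        unfolding sum_conformal_jet[OF E] SX np by (simp add: S_def F_def)
    qed
    from X C \<kappa> jet strict show "strict_subsolution_at \<Gamma> f x"
      unfolding strict_subsolution_at_def
      by (intro exI[of _ p] exI[of _ X] exI[of _ C] exI[of _ \<kappa>] conjI allI impI)
  qed
qed

end

section \<open>Comparison with Kelvin transforms\<close>

lemma conformal_jet_scale: "conformal_jet (t * a) (t *\<^sub>R p) (t *\<^sub>R X) = t\<^sup>2 *\<^sub>R conformal_jet a p X"
  by (simp add: conformal_jet_def power_mult_distrib power2_eq_square algebra_simps)

context conformal_solution
begin

text \<open>Comparison of \<open>w\<close> with its Kelvin transform \<open>wk\<close> in an annulus: at an interior minimum of \<open>wk / f\<close> the
  Kelvin transform of a multiple of the strict subsolution \<open>f\<close> would touch \<open>w\<close> from below.\<close>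

lemma moving_sphere:
  assumes R: "0 < R" "cball c (4 * R) \<subseteq> \<Omega>" and x: "x \<in> cball c R"
    and m: "0 < m" "\<And>y. y \<in> cball c (2 * R) \<Longrightarrow> m \<le> w y" and M: "\<And>y. y \<in> cball c (2 * R) \<Longrightarrow> w y \<le> M"
    and \<rho>: "0 < \<rho>" "\<rho>\<^sup>2 * M \<le> R\<^sup>2 * m" and y: "\<rho> \<le> norm (y - x)" "norm (y - x) \<le> R"
  shows "w y \<le> (norm (y - x))\<^sup>2 / \<rho>\<^sup>2 * w (inversion \<rho> x (y - x))"
proof -
  define invp where "invp = (\<lambda>y. inversion \<rho> x (y - x))"
  have invp_eq: "invp y = inversion \<rho> x (y - x)" for y by (simp add: invp_def)
  define wk where "wk = (\<lambda>y. (norm (y - x))\<^sup>2 / \<rho>\<^sup>2 * w (invp y))"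
  define A where "A = {y. \<rho> \<le> norm (y - x) \<and> norm (y - x) \<le> R}"
  have \<rho>R: "\<rho> \<le> R" using y by linarith
  have near: "y \<in> cball c (2 * R)" if "norm (y - x) \<le> R" for y
    using that x norm_triangle_ineq4[of "y - x" "c - x"] by (simp add: dist_norm norm_minus_commute)
  have sub: "cball c (2 * R) \<subseteq> \<Omega>" using R by (intro order_trans[OF subset_cball R(2)]) simp
  have norm_inv: "norm (invp y - x) = \<rho>\<^sup>2 / norm (y - x)" if "y \<noteq> x" for y
    using that by (simp add: invp_def power2_eq_square)
  have A_ne: "y \<noteq> x" if "y \<in> A" for y using that \<rho>(1) by (auto simp: A_def)
  have A_near: "y \<in> cball c (2 * R)" if "y \<in> A" for y using that near by (simp add: A_def)
  have inv_near: "invp y \<in> cball c (2 * R)" if yA: "y \<in> A" for y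
  proof (rule near)
    have "\<rho>\<^sup>2 / norm (y - x) \<le> \<rho>\<^sup>2 / \<rho>"
      using yA \<rho>(1) A_ne[OF yA] by (intro divide_left_mono mult_pos_pos) (simp_all add: A_def)
    then show "norm (invp y - x) \<le> R"
      unfolding norm_inv[OF A_ne[OF yA]] using \<rho>(1) \<rho>R by (simp add: power2_eq_square)
  qed
  have yA: "y \<in> A" using y by (simp add: A_def)
  have "A = cball x R - ball x \<rho>" by (auto simp: A_def dist_norm norm_minus_commute)
  then have A_compact: "compact A" by (simp add: compact_diff)
  have wk_cont: "continuous_on A wk"
  proof -
    have "continuous_on A invp" unfolding invp_def using A_ne by (intro continuous_intros) auto
    then have "continuous_on A (\<lambda>y. w (invp y))"
      by (rule continuous_on_compose2[OF cont]) (use inv_near sub in auto)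
    then show ?thesis unfolding wk_def using \<rho>(1) by (intro continuous_intros) auto
  qed
  have wk_pos: "0 < wk y" if "y \<in> A" for y
    using that A_ne[OF that] \<rho>(1) w_pos[of "invp y"] inv_near[OF that] sub by (auto simp: wk_def)
  \<comment> \<open>The factor \<open>1 - e / m\<close> makes up for \<open>f \<le> w + e\<close> on
    the boundary, where \<open>w\<close> is at least \<open>m\<close>.\<close>
  have key: "(1 - e / m) * (w y - e) \<le> wk y" if e: "0 < e" "e < m" for e
  proof -
    obtain f where f_cont: "continuous_on UNIV f"
      and f: "\<forall>y\<in>cball c (2 * R). \<bar>f y - w y\<bar> \<le> e \<and> 0 < f y \<and> strict_subsolution_at \<Gamma> f y"
      using smooth_subsolution[OF R e(1)] by blast
    then have fw: "\<And>y. y \<in> cball c (2 * R) \<Longrightarrow> \<bar>f y - w y\<bar> \<le> e"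
      and f_pos: "\<And>y. y \<in> cball c (2 * R) \<Longrightarrow> 0 < f y"
      and f_jet: "\<And>y. y \<in> cball c (2 * R) \<Longrightarrow> strict_subsolution_at \<Gamma> f y"
      by blast+
    have "continuous_on A (\<lambda>y. wk y / f y)"
      by (intro continuous_on_divide wk_cont continuous_on_subset[OF f_cont]) (use A_near f_pos in force)+
    then obtain y0 where y0: "y0 \<in> A" and min: "\<And>y. y \<in> A \<Longrightarrow> wk y0 / f y0 \<le> wk y / f y"
      using continuous_attains_inf[OF A_compact] yA by blast
    \<comment> \<open>The largest multiple of \<open>f\<close> lying below \<open>wk\<close> on the
      annulus. Strictness excludes interior contact, and contact on the boundary bounds
      \<open>t\<close> from below.\<close>
    define t where "t = wk y0 / f y0"
    have f0: "0 < f y0" using A_near[OF y0] by (rule f_pos)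
    have t: "0 < t" using wk_pos[OF y0] f0 by (simp add: t_def)
    have tf: "t * f y \<le> wk y" if "y \<in> A" for y
      using min[OF that] f_pos[OF A_near[OF that]] by (simp add: t_def pos_le_divide_eq)
    have tf0: "t * f y0 = wk y0" using f0 by (simp add: t_def)
    have w0: "m \<le> w y0" "w y0 \<le> M" using A_near[OF y0] m M by auto
    have "1 - e / m \<le> t"
    \<comment> \<open>On the inner sphere the inversion is the identity; on the outer one
      \<open>w \<le> wk\<close> is what the hypothesis
      \<open>\<rho>\<^sup>2 * M \<le> R\<^sup>2 * m\<close> provides.\<close>
    proof (cases "norm (y0 - x) = \<rho> \<or> norm (y0 - x) = R")
      case True
      have "w y0 \<le> wk y0"
        using True
      proof
        assume "norm (y0 - x) = \<rho>"
        then show ?thesis using \<rho>(1) by (simp add: wk_def invp_def)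
      next
        assume n: "norm (y0 - x) = R"
        have "M \<le> R\<^sup>2 / \<rho>\<^sup>2 * m" using \<rho> by (simp add: field_simps)
        also have "\<dots> \<le> R\<^sup>2 / \<rho>\<^sup>2 * w (invp y0)"
          using m(2)[OF inv_near[OF y0]] by (intro mult_left_mono) auto
        finally show ?thesis using w0 by (simp add: wk_def n)
      qed
      moreover have "(1 - e / m) * f y0 \<le> w y0"
      proof -
        have "(1 - e / m) * f y0 \<le> (1 - e / m) * (w y0 + e)"
          using fw[OF A_near[OF y0]] e m(1) by (intro mult_left_mono) auto
        also have "\<dots> = w y0 + e - e * (w y0 / m) - e * (e / m)" by (simp add: algebra_simps)
        also have "\<dots> \<le> w y0"
        proof -
          have "e * 1 \<le> e * (w y0 / m)" using e w0 m(1) by (intro mult_left_mono) (auto simp: pos_le_divide_eq)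
          moreover have "0 \<le> e * (e / m)" using e m(1) by simp
          ultimately show ?thesis by linarith
        qed
        finally show ?thesis .
      qed
      ultimately have "(1 - e / m) * f y0 \<le> t * f y0" unfolding tf0 by linarith
      then show ?thesis using f0 by simp
    next
      case False
      then have n0: "\<rho> < norm (y0 - x)" "norm (y0 - x) < R" using y0 by (auto simp: A_def)
      have n0p: "0 < norm (y0 - x)" using n0 \<rho>(1) by linarith
      obtain p X C \<kappa> where X: "transpose X = X" and C: "0 \<le> C" and \<kappa>: "0 < \<kappa>"
        and jet: "\<And>h. norm h \<le> 1 \<Longrightarrow> jet2 (f y0) p X h - C * norm h ^ 3 \<le> f (y0 + h)"
        and strict: "\<And>E a. orthonormal E \<Longrightarrow> a \<in> dual_weights \<Gamma> \<Longrightarrow>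
          \<kappa> * sum a UNIV \<le> weighted_diagonal a E (conformal_jet (f y0) p X)"
        using f_jet[OF A_near[OF y0]] unfolding strict_subsolution_at_def by blast
      \<comment> \<open>The contact is carried inside the sphere of radius \<rho>, where
        \<open>w\<close> itself and the Kelvin transform of \<open>t * f\<close> meet; the open
        annulus corresponds to norms between \<open>\<rho>\<^sup>2 / R\<close> and \<rho>.\<close>
      define \<zeta> where "\<zeta> = invp y0 - x"
      have n\<zeta>: "norm \<zeta> = \<rho>\<^sup>2 / norm (y0 - x)" unfolding \<zeta>_def by (rule norm_inv[OF A_ne[OF y0]])
      have n\<zeta>': "\<rho>\<^sup>2 / R < norm \<zeta>" "norm \<zeta> < \<rho>"
      proof -
        have "\<rho>\<^sup>2 / R < \<rho>\<^sup>2 / norm (y0 - x)" using n0p n0 \<rho>(1) R(1) by (intro divide_strict_left_mono mult_pos_pos) simp_all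
        then show "\<rho>\<^sup>2 / R < norm \<zeta>" by (simp add: n\<zeta>)
        have "\<rho>\<^sup>2 / norm (y0 - x) < \<rho>\<^sup>2 / \<rho>" using n0p n0 \<rho>(1) by (intro divide_strict_left_mono mult_pos_pos) simp_all
        then show "norm \<zeta> < \<rho>" using \<rho>(1) by (simp add: n\<zeta> power2_eq_square)
      qed
      let ?q = "kelvin_grad \<rho> \<zeta> (t * f y0) (t *\<^sub>R p)"
      let ?Y = "kelvin_hess \<rho> \<zeta> (t * f y0) (t *\<^sub>R p) (t *\<^sub>R X)"
      have \<zeta>0: "\<zeta> \<noteq> 0" using n\<zeta> n0 \<rho>(1) by auto
      have inv_\<zeta>: "inversion \<rho> x \<zeta> = y0"
      proof -
        have "\<rho>\<^sup>2 / (norm \<zeta>)\<^sup>2 * (\<rho>\<^sup>2 / (norm (y0 - x))\<^sup>2) = 1"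
          unfolding n\<zeta> using \<rho>(1) A_ne[OF y0] by (simp add: power_divide field_simps power2_eq_square)
        then show ?thesis by (simp add: \<zeta>_def invp_def)
      qed
      have "t * f y0 + (t *\<^sub>R p) \<bullet> k + k \<bullet> ((t *\<^sub>R X) *v k) / 2 - (t * C) * norm k ^ 3
          \<le> t * f (inversion \<rho> x \<zeta> + k)" if "norm k \<le> 1" for k
      proof -
        have "t * (jet2 (f y0) p X k - C * norm k ^ 3) \<le> t * f (y0 + k)"
          using jet[OF that] t by (intro mult_left_mono) auto
        then show ?thesis
          unfolding inv_\<zeta> by (simp add: distrib_left right_diff_distrib scaleR_matrix_vector_assoc[symmetric] mult.assoc)
      qed
      moreover have "transpose (t *\<^sub>R X) = t *\<^sub>R X" using X by (simp add: transpose_def vec_eq_iff)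
      ultimately have "\<exists>C' r. 0 < r \<and> (\<forall>h. norm h < r \<longrightarrow>
        t * f y0 * (norm \<zeta>)\<^sup>2 / \<rho>\<^sup>2 + ?q \<bullet> h
          + h \<bullet> (?Y *v h) / 2 - C' * norm h ^ 3
        \<le> (norm (\<zeta> + h))\<^sup>2 / \<rho>\<^sup>2 * (t * f (inversion \<rho> x (\<zeta> + h))))"
        using t C by (intro kelvin_jet[where C = "t * C", OF \<zeta>0 \<rho>(1)]) simp_all
      then obtain C' r where r: "0 < r" and K: "\<And>h. norm h < r \<Longrightarrow>
        t * f y0 * (norm \<zeta>)\<^sup>2 / \<rho>\<^sup>2 + ?q \<bullet> h
          + h \<bullet> (?Y *v h) / 2 - C' * norm h ^ 3
        \<le> (norm (\<zeta> + h))\<^sup>2 / \<rho>\<^sup>2 * (t * f (inversion \<rho> x (\<zeta> + h)))"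
        by blast
      have wz: "w (x + \<zeta>) = t * f y0 * (norm \<zeta>)\<^sup>2 / \<rho>\<^sup>2"
      proof -
        have one: "(norm (y0 - x))\<^sup>2 / \<rho>\<^sup>2 * ((norm \<zeta>)\<^sup>2 / \<rho>\<^sup>2) = 1"
          unfolding n\<zeta> using \<rho>(1) A_ne[OF y0] by (simp add: power_divide field_simps power2_eq_square)
        have "t * f y0 * ((norm \<zeta>)\<^sup>2 / \<rho>\<^sup>2) = ((norm (y0 - x))\<^sup>2 / \<rho>\<^sup>2 * ((norm \<zeta>)\<^sup>2 / \<rho>\<^sup>2)) * w (invp y0)"
          unfolding tf0 wk_def by (simp only: mult_ac)
        then show ?thesis unfolding one by (simp add: \<zeta>_def)
      qed
      have False
      proof (rule lower[where x = "x + \<zeta>" and q = "?q"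
            and Y = "?Y" and C = C' and c = "t\<^sup>2 * \<kappa>"
            and r = "min r (min (\<rho> - norm \<zeta>) (norm \<zeta> - \<rho>\<^sup>2 / R))"])
        show "x + \<zeta> \<in> \<Omega>" using inv_near[OF y0] sub by (auto simp: \<zeta>_def)
        show "transpose ?Y = ?Y"
          by (rule transpose_kelvin_hess) fact
        show "0 < min r (min (\<rho> - norm \<zeta>) (norm \<zeta> - \<rho>\<^sup>2 / R))" using r n\<zeta>' by simp
        show "0 < t\<^sup>2 * \<kappa>" using t \<kappa> by simp
        fix h :: "real^'n" assume h: "norm h < min r (min (\<rho> - norm \<zeta>) (norm \<zeta> - \<rho>\<^sup>2 / R))"
        have n1: "norm (\<zeta> + h) < \<rho>" "\<rho>\<^sup>2 / R < norm (\<zeta> + h)"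
          using h norm_triangle_ineq[of \<zeta> h] norm_diff_ineq[of \<zeta> h] by auto
        have n1p: "0 < norm (\<zeta> + h)" using n1(2) \<rho>(1) R(1) by (meson divide_pos_pos less_trans zero_less_power)
        define z where "z = x + \<zeta> + h"
        have zx: "z - x = \<zeta> + h" by (simp add: z_def)
        have zne: "z \<noteq> x" using n1p zx by auto
        have niz: "norm (invp z - x) = \<rho>\<^sup>2 / norm (\<zeta> + h)" using norm_inv[OF zne] zx by simp
        have "invp z \<in> A"
        proof -
          have "\<rho> * norm (\<zeta> + h) \<le> \<rho> * \<rho>" using n1 \<rho>(1) by (intro mult_left_mono) auto
          then have "\<rho> \<le> \<rho>\<^sup>2 / norm (\<zeta> + h)" using n1p by (simp add: pos_le_divide_eq power2_eq_square)
          moreover have "\<rho>\<^sup>2 / norm (\<zeta> + h) \<le> R"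
            using n1(2) n1p R(1) by (simp add: divide_less_eq pos_divide_le_eq mult.commute)
          ultimately show ?thesis by (simp add: A_def niz)
        qed
        from tf[OF this] have "t * f (invp z) \<le> (\<rho>\<^sup>2 / norm (\<zeta> + h))\<^sup>2 / \<rho>\<^sup>2 * w (invp (invp z))"
          by (simp add: wk_def niz)
        moreover have "invp (invp z) = z"
        proof -
          have "\<rho>\<^sup>2 / (\<rho>\<^sup>2 / norm (\<zeta> + h))\<^sup>2 * (\<rho>\<^sup>2 / (norm (z - x))\<^sup>2) = 1"
            unfolding zx using \<rho>(1) n1p by (simp add: power_divide field_simps power2_eq_square)
          moreover have "invp (invp z) = x + (\<rho>\<^sup>2 / (\<rho>\<^sup>2 / norm (\<zeta> + h))\<^sup>2 * (\<rho>\<^sup>2 / (norm (z - x))\<^sup>2)) *\<^sub>R (z - x)"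
            unfolding invp_eq[of "invp z"] niz by (simp add: invp_def)
          ultimately show ?thesis by simp
        qed
        ultimately have "(norm (\<zeta> + h))\<^sup>2 / \<rho>\<^sup>2 * (t * f (invp z)) \<le>
            (norm (\<zeta> + h))\<^sup>2 / \<rho>\<^sup>2 * ((\<rho>\<^sup>2 / norm (\<zeta> + h))\<^sup>2 / \<rho>\<^sup>2 * w z)"
          by (intro mult_left_mono) auto
        also have "\<dots> = w z"
        proof -
          have "(norm (\<zeta> + h))\<^sup>2 / \<rho>\<^sup>2 * ((\<rho>\<^sup>2 / norm (\<zeta> + h))\<^sup>2 / \<rho>\<^sup>2) = 1"
            using \<rho>(1) n1p by (simp add: power_divide field_simps power2_eq_square)
          then show ?thesis by (simp only: mult.assoc[symmetric] mult_1)
        qed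
        finally have "(norm (\<zeta> + h))\<^sup>2 / \<rho>\<^sup>2 * (t * f (inversion \<rho> x (\<zeta> + h))) \<le> w (x + \<zeta> + h)"
          by (simp only: invp_def zx) (simp only: z_def)
        then show "w (x + \<zeta>) + ?q \<bullet> h
          + h \<bullet> (?Y *v h) / 2 - C' * norm h ^ 3 \<le> w (x + \<zeta> + h)"
          using K[of h] h unfolding wz by linarith
      next
        fix E :: "real^'n^'n" and a :: "'n \<Rightarrow> real"
        assume E: "orthonormal E" and a: "a \<in> dual_weights \<Gamma>"
        define E' where "E' = (\<chi> i. reflection \<zeta> (E $ i))"
        have E': "orthonormal E'" using E by (simp add: orthonormal_def E'_def)
        have "t\<^sup>2 * (\<kappa> * sum a UNIV) \<le> t\<^sup>2 * weighted_diagonal a E' (conformal_jet (f y0) p X)"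
          using strict[OF E' a] by (intro mult_left_mono) auto
        also have "\<dots> = weighted_diagonal a E (conformal_jet (w (x + \<zeta>)) ?q ?Y)"
          unfolding wz conformal_jet_kelvin[OF \<zeta>0 \<rho>(1) orthonormal_norm[OF E]] conformal_jet_scale
          by (simp add: E'_def sum_distrib_left scaleR_matrix_vector_assoc[symmetric] mult.left_commute)
        finally show "t\<^sup>2 * \<kappa> * sum a UNIV \<le> weighted_diagonal a E (conformal_jet (w (x + \<zeta>)) ?q ?Y)"
          by (simp only: mult.assoc)
      qed
      then show ?thesis ..
    qed
    then have "(1 - e / m) * f y \<le> t * f y"
      using f_pos[OF A_near[OF yA]] by (intro mult_right_mono) auto
    also have "\<dots> \<le> wk y" by (rule tf[OF yA])
    finally have "(1 - e / m) * f y \<le> wk y" .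
    moreover have "(1 - e / m) * (w y - e) \<le> (1 - e / m) * f y"
      using fw[OF A_near[OF yA]] e m(1) by (intro mult_left_mono) auto
    ultimately show ?thesis by linarith
  qed
  have "w y \<le> wk y"
  proof (rule field_le_epsilon)
    fix \<eta> :: real assume \<eta>: "0 < \<eta>"
    have wy: "0 < w y" using A_near[OF yA] sub w_pos by blast
    have q: "0 < 1 + w y / m" using wy m(1) by (simp add: add_pos_pos)
    define e where "e = min (m / 2) (\<eta> / (1 + w y / m))"
    have e: "0 < e" "e < m" using m(1) \<eta> q by (auto simp: e_def)
    have "e * (1 + w y / m) \<le> \<eta>"
    proof -
      have "e \<le> \<eta> / (1 + w y / m)" by (simp add: e_def)
      then show ?thesis using q by (simp add: pos_le_divide_eq)
    qed
    moreover have "(1 - e / m) * (w y - e) = w y - e * (1 + w y / m) + e * (e / m)"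
      by (simp add: algebra_simps)
    moreover have "0 \<le> e * (e / m)" using e m(1) by simp
    ultimately show "w y \<le> wk y + \<eta>" using key[OF e] by linarith
  qed
  then show ?thesis by (simp add: wk_def invp_def)
qed

text \<open>Moving spheres about \<open>x\<close> make \<open>w / |y - x|\<close> nonincreasing along rays; \<open>x\<close> is taken on the line
  through \<open>y\<close> and \<open>z\<close>, at a fixed distance behind \<open>z\<close>.\<close>

lemma w_local_lipschitz:
  assumes "c \<in> \<Omega>"
  shows "\<exists>r>0. \<exists>L\<ge>0. \<exists>m>0. cball c r \<subseteq> \<Omega> \<and> (\<forall>y\<in>cball c r. m \<le> w y) \<and>
    (\<forall>y\<in>cball c r. \<forall>z\<in>cball c r. w y \<le> w z + L * norm (y - z))"
proof -
  obtain d where d: "0 < d" "cball c d \<subseteq> \<Omega>" using open_\<Omega> assms open_contains_cball by blast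
  define R where "R = d / 4"
  have R: "0 < R" "cball c (4 * R) \<subseteq> \<Omega>" using d by (auto simp: R_def)
  have sub: "cball c (2 * R) \<subseteq> \<Omega>" using R by (intro order_trans[OF subset_cball R(2)]) simp
  have ne: "cball c (2 * R) \<noteq> {}" using R by auto
  have cw: "continuous_on (cball c (2 * R)) w" by (rule continuous_on_subset[OF cont sub])
  obtain xm where xm: "xm \<in> cball c (2 * R)" "\<And>y. y \<in> cball c (2 * R) \<Longrightarrow> w xm \<le> w y"
    using continuous_attains_inf[OF compact_cball ne cw] by blast
  obtain xM where xM: "xM \<in> cball c (2 * R)" "\<And>y. y \<in> cball c (2 * R) \<Longrightarrow> w y \<le> w xM"
    using continuous_attains_sup[OF compact_cball ne cw] by blast
  define m where "m = w xm"
  define M where "M = w xM"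
  have m: "0 < m" using xm(1) sub w_pos by (auto simp: m_def)
  have mM: "m \<le> M" using xm(1) xM(2) by (simp add: m_def M_def)
  \<comment> \<open>The largest radius of an inversion that \<open>moving_sphere\<close>
    admits.\<close>
  define \<rho>0 where "\<rho>0 = R * sqrt (m / M)"
  have \<rho>0: "0 < \<rho>0" using R m mM by (simp add: \<rho>0_def)
  have \<rho>0R: "\<rho>0 \<le> R" using R m mM by (simp add: \<rho>0_def mult_left_le)
  have \<rho>0M: "\<rho>0\<^sup>2 * M = R\<^sup>2 * m" using m mM by (simp add: \<rho>0_def power_mult_distrib)
  \<comment> \<open>Also the largest distance between two points of the ball of radius
    \<open>\<rho>0 / 4\<close>.\<close>
  define s where "s = \<rho>0 / 2"
  have s: "0 < s" using \<rho>0 by (simp add: s_def)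
  have near: "cball c (\<rho>0 / 4) \<subseteq> cball c (2 * R)" using \<rho>0R R by (intro subset_cball) simp
  have main: "w y \<le> w z + M / s * norm (y - z)" if y: "y \<in> cball c (\<rho>0 / 4)" and z: "z \<in> cball c (\<rho>0 / 4)" for y z
  proof (cases "y = z")
    case True
    then show ?thesis by simp
  next
    case False
    define D where "D = norm (y - z)"
    have D: "0 < D" using False by (simp add: D_def)
    have Ds: "D \<le> s"
    proof -
      have "dist y z \<le> dist c y + dist c z" by (rule dist_triangle3)
      then show ?thesis using y z by (simp add: D_def s_def dist_norm)
    qed
    define \<nu> where "\<nu> = (1 / D) *\<^sub>R (y - z)"
    have \<nu>: "norm \<nu> = 1" using D by (simp add: \<nu>_def D_def)
    have yz: "y = z + D *\<^sub>R \<nu>" using D by (simp add: \<nu>_def)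
    define x where "x = z - s *\<^sub>R \<nu>"
    have yx: "y - x = (D + s) *\<^sub>R \<nu>" unfolding x_def by (subst yz) (simp add: algebra_simps)
    have nyx: "norm (y - x) = D + s" using \<nu> D s by (simp add: yx)
    \<comment> \<open>The geometric mean of the distances of \<open>y\<close> and \<open>z\<close>
      from \<open>x\<close>, so that the inversion maps \<open>y\<close> to
      \<open>z\<close>.\<close>
    define \<rho> where "\<rho> = sqrt ((D + s) * s)"
    have \<rho>2: "\<rho>\<^sup>2 = (D + s) * s" using D s by (simp add: \<rho>_def)
    have \<rho>: "0 < \<rho>" using D s by (simp add: \<rho>_def)
    have "w y \<le> (norm (y - x))\<^sup>2 / \<rho>\<^sup>2 * w (inversion \<rho> x (y - x))"
    proof (rule moving_sphere[OF R _ m _ _ \<rho>, where M = M])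
      have "norm (c - x) \<le> norm (c - z) + norm (s *\<^sub>R \<nu>)"
        using norm_triangle_ineq[of "c - z" "s *\<^sub>R \<nu>"] by (simp add: x_def algebra_simps)
      also have "\<dots> \<le> \<rho>0 / 4 + s" using z \<nu> s by (simp add: dist_norm)
      also have "\<dots> \<le> R" using \<rho>0R \<rho>0 by (simp add: s_def)
      finally show "x \<in> cball c R" by (simp add: dist_norm)
      show "m \<le> w y" if "y \<in> cball c (2 * R)" for y using xm(2)[OF that] by (simp add: m_def)
      show "w y \<le> M" if "y \<in> cball c (2 * R)" for y using xM(2)[OF that] by (simp add: M_def)
      have le: "\<rho>\<^sup>2 \<le> \<rho>0\<^sup>2"
        unfolding \<rho>2 power2_eq_square[of \<rho>0] using D s Ds by (intro mult_mono) (auto simp: s_def)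
      then have "\<rho>\<^sup>2 * M \<le> \<rho>0\<^sup>2 * M" using m mM by (intro mult_right_mono) auto
      then show "\<rho>\<^sup>2 * M \<le> R\<^sup>2 * m" using \<rho>0M by simp
      have "\<rho>\<^sup>2 \<le> (D + s)\<^sup>2"
        unfolding \<rho>2 power2_eq_square[of "D + s"] using D s by (intro mult_left_mono) auto
      then show "\<rho> \<le> norm (y - x)" unfolding nyx by (rule power2_le_imp_le) (use D s in simp)
      show "norm (y - x) \<le> R" unfolding nyx using Ds \<rho>0R by (simp add: s_def)
    qed
    also have "inversion \<rho> x (y - x) = z"
    proof -
      have "(D + s) * s / (D + s)\<^sup>2 * (D + s) = s" using D s by (simp add: power2_eq_square)
      then show ?thesis unfolding nyx \<rho>2 unfolding yx scaleR_scaleR by (simp add: x_def)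
    qed
    also have "(norm (y - x))\<^sup>2 / \<rho>\<^sup>2 * w z = w z + D / s * w z"
    proof -
      have "(D + s)\<^sup>2 / ((D + s) * s) = (D + s) / s" using D s by (simp add: power2_eq_square)
      also have "\<dots> = 1 + D / s" using s by (simp add: add_divide_distrib)
      finally show ?thesis unfolding nyx \<rho>2 by (simp add: distrib_right)
    qed
    also have "\<dots> \<le> w z + D / s * M"
      using xM(2)[of z] z near D s by (intro add_left_mono mult_left_mono) (auto simp: M_def)
    finally show ?thesis by (simp add: D_def mult.commute)
  qed
  have "cball c (\<rho>0 / 4) \<subseteq> \<Omega>" using near sub by blast
  moreover have "\<forall>y\<in>cball c (\<rho>0 / 4). m \<le> w y" using near xm(2) by (auto simp: m_def)
  moreover have "\<forall>y\<in>cball c (\<rho>0 / 4). \<forall>z\<in>cball c (\<rho>0 / 4). w y \<le> w z + M / s * norm (y - z)"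
    by (intro ballI main)
  moreover have "0 < \<rho>0 / 4" "0 \<le> M / s" using \<rho>0 m mM s by simp_all
  ultimately show ?thesis using m by blast
qed

end

section \<open>Return to \<open>u\<close> and to compact sets\<close>

theorem theorem1p1:
  fixes \<Omega> \<Gamma> :: "(real^'n) set" and u :: "real^'n \<Rightarrow> real"
  assumes "CARD('n) \<ge> 3"
    and "open \<Omega>"
    and "open \<Gamma>" and "convex \<Gamma>" and "symmetric_set \<Gamma>" and "cone_at_origin \<Gamma>"
    and "{l. \<forall>i. l $ i > 0} \<subseteq> \<Gamma>"
    and "viscosity_solution \<Gamma> \<Omega> u"
  shows "C01_loc \<Omega> u"
proof -
  define m where "m = (real CARD('n) - 2) / 2"
  have m: "0 < m" using assms(1) by (simp add: m_def)
  define w where "w = (\<lambda>x. u x powr (- (1 / m)))"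
  have u: "continuous_on \<Omega> u" "\<And>x. x \<in> \<Omega> \<Longrightarrow> 0 < u x"
    using assms(8) by (auto simp: viscosity_solution_def)
  have w_pos: "0 < w x" if "x \<in> \<Omega>" for x using u(2)[OF that] by (simp add: w_def)
  have uw: "u x = w x powr (- m)" if "x \<in> \<Omega>" for x
    using u(2)[OF that] m by (simp add: w_def powr_powr)
  have uw': "\<forall>x\<in>\<Omega>. 0 < w x \<and> u x = w x powr (- ((real CARD('n) - 2) / 2))"
    using uw w_pos by (simp add: m_def)
  interpret conformal_solution \<Omega> \<Gamma> w
  proof
    show "continuous_on \<Omega> w"
      unfolding w_def
      by (intro continuous_on_powr u(1) continuous_on_const ballI) (metis u(2) less_irrefl)
  next
    fix x q Y C r and E :: "real^'n^'n" and a
    assume *: "x \<in> \<Omega>" "transpose Y = Y" "0 < r" and jet: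
      "\<And>h. norm h < r \<Longrightarrow> w (x + h) \<le> jet2 (w x) q Y h + C * norm h ^ 3"
      and **: "orthonormal E" "a \<in> dual_weights \<Gamma>"
    show "0 \<le> weighted_diagonal a E (conformal_jet (w x) q Y)"
      by (rule w_upper_jet[OF assms(1,2,8,5) uw' * _ **]) (rule jet)
  next
    fix x q Y C r c
    assume *: "x \<in> \<Omega>" "transpose Y = Y" "0 < r" and jet:
      "\<And>h. norm h < r \<Longrightarrow> jet2 (w x) q Y h - C * norm h ^ 3 \<le> w (x + h)" and c: "0 < c"
      and strict: "\<And>E a. orthonormal E \<Longrightarrow> a \<in> dual_weights \<Gamma> \<Longrightarrow>
        c * sum a UNIV \<le> weighted_diagonal a E (conformal_jet (w x) q Y)"
    show False
      by (rule w_lower_jet[OF assms(1,2,8,5) uw' * _ assms(3,4,6,7) c]) (rule jet strict, assumption+)+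
  qed (use assms w_pos in auto)
  have local: "\<exists>r>0. \<exists>L. L-lipschitz_on (cball c r \<inter> \<Omega>) u" if c: "c \<in> \<Omega>" for c
  proof -
    obtain r L b where r: "0 < r" "0 \<le> L" "0 < b" "\<forall>y\<in>cball c r. b \<le> w y"
      and lip: "\<forall>y\<in>cball c r. \<forall>z\<in>cball c r. w y \<le> w z + L * norm (y - z)"
      using w_local_lipschitz[OF c] by blast
    \<comment> \<open>Bounds the derivative of the power on the half-line starting at
      \<open>b\<close>; the positive lower bound of \<open>w\<close> is needed here.\<close>
    define B where "B = m * b powr (- m - 1)"
    have B: "0 \<le> B" using m by (simp add: B_def)
    have powr_lip: "norm (s powr (- m) - t powr (- m)) \<le> B * norm (s - t)" if "s \<in> {b..}" "t \<in> {b..}" for s t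
    proof (rule field_differentiable_bound[OF _ _ _ that(1,2)])
      show "((\<lambda>s. s powr (- m)) has_field_derivative - m * x powr (- m - 1)) (at x within {b..})" if "x \<in> {b..}" for x
        using that r(3) by (auto intro!: derivative_eq_intros)
      show "norm (- m * x powr (- m - 1)) \<le> B" if "x \<in> {b..}" for x
        using that r(3) m unfolding B_def by (auto simp: abs_mult intro!: mult_left_mono powr_mono2')
    qed simp
    have "(B * L)-lipschitz_on (cball c r \<inter> \<Omega>) u"
    proof (rule lipschitz_onI)
      fix y z assume "y \<in> cball c r \<inter> \<Omega>" "z \<in> cball c r \<inter> \<Omega>"
      then have yz: "y \<in> cball c r" "z \<in> cball c r" and yz\<Omega>: "y \<in> \<Omega>" "z \<in> \<Omega>" by auto
      have "dist (u y) (u z) \<le> B * \<bar>w y - w z\<bar>"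
        using powr_lip[of "w y" "w z"] r(4) yz by (simp add: uw yz\<Omega> dist_norm)
      also have "\<bar>w y - w z\<bar> \<le> L * norm (y - z)"
        using lip[rule_format, OF yz] lip[rule_format, OF yz(2,1)] by (simp add: norm_minus_commute)
      then have "B * \<bar>w y - w z\<bar> \<le> B * (L * norm (y - z))" using B by (rule mult_left_mono)
      finally show "dist (u y) (u z) \<le> B * L * dist y z" by (simp add: dist_norm)
    qed (use B r in simp)
    with r(1) show ?thesis by blast
  qed
  show ?thesis
    unfolding C01_loc_def
  proof (intro allI impI, elim conjE)
    fix K assume K: "compact K" "K \<subseteq> \<Omega>"
    \<comment> \<open>The passage from local to compact sets is available for families depending on
      time; time is the single point 0.\<close>
    have ll: "local_lipschitz {0::real} K (\<lambda>_. u)"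
    proof (rule local_lipschitzI)
      fix t :: real and x assume "x \<in> K"
      then obtain r L where "0 < r" "L-lipschitz_on (cball x r \<inter> \<Omega>) u" using local K(2) by blast
      then have "L-lipschitz_on (cball x r \<inter> K) u" using K(2) by (auto intro: lipschitz_on_subset)
      with \<open>0 < r\<close> show "\<exists>r>0. \<exists>L. \<forall>s\<in>cball t r \<inter> {0::real}. L-lipschitz_on (cball x r \<inter> K) u" by blast
    qed
    obtain L where "\<And>t. t \<in> {0::real} \<Longrightarrow> L-lipschitz_on K u"
      by (rule local_lipschitz_compact_implies_lipschitz[OF ll K(1)]) auto
    then show "\<exists>L. L-lipschitz_on K u" by blast
  qed
qed

end
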